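(* Let $N\ge1$, $p>1$, $p_*:=1+\frac1N$, $A>0$ and $\psi(x)=(1+|x|)^{-A}$. For $\kappa>0$ let $T(\kappa\psi)$ be the life span of solutions to the problem $$\partial_t u=\Delta u\ \ (x\in\mathbf{R}^N_+,\,t>0),\qquad -\frac{\partial u}{\partial x_N}=u^p\ \ (x\in\partial\mathbf{R}^N_+,\,t>0),\qquad u(x,0)=\kappa\psi(x).\qquad (\mathrm{P}_\kappa)$$ Then $T(\kappa\psi)\to\infty$ as $\kappa\to+0$ and the following holds. (i) Let $1<p<p_*$ or $0<A<\frac{1}{p-1}$. Then, as $\kappa\to+0$, $$T(\kappa\psi)\sim\begin{cases}\kappa^{-\left(\frac{1}{2(p-1)}-\frac12\min\{A,N\}\right)^{-1}} & \text{if } A\ne N,\\[6pt] \left(\dfrac{\kappa^{-1}}{\log(\kappa^{-1})}\right)^{\left(\frac{1}{2(p-1)}-\frac N2\right)^{-1}} & \text{if } A=N.\end{cases}$$ (ii) Let $p=p_*$ and $A\ge\frac{1}{p-1}$ $(=N)$. Then, as $\kappa\to+0$, $$\log T(\kappa\psi)\sim\begin{cases}\kappa^{-(p-1)} & \text{if } A>N,\\ \kappa^{-\frac{p-1}{p}} & \text{if } A=N.\end{cases}$$ (iii) Let $p>p_*$ and $A\ge\frac1{p-1}$. Then problem $(\mathrm{P}_\kappa)$ possesses a global-in-time solution if $\kappa>0$ is sufficiently small.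
   Context: Notation: $\mathbf{R}^N_+:=\{y\in\mathbf{R}^N:y_N>0\}$, $D:=\overline{\mathbf{R}^N_+}$, $y=(y',y_N)$ with $y'=(y_1,\dots,y_{N-1})$. $G=G(x,y,t)$ is the Green function for the heat equation on $\mathbf{R}^N_+$ with homogeneous Neumann boundary condition, i.e. $G(x,y,t)=(4\pi t)^{-N/2}\bigl[e^{-|x-y|^2/(4t)}+e^{-|x-y_*|^2/(4t)}\bigr]$ with $y_*=(y',-y_N)$. Solution: let $\varphi$ be a nonnegative measurable function in $\mathbf{R}^N_+$ and $0<T<\infty$. A nonnegative continuous function $u$ in $D\times(0,T)$ is a solution in $[0,T)$ with $u(0)=\varphi$ if $$u(x,t)=\int_D G(x,y,t)\varphi(y)\,dy+\int_0^t\int_{\mathbf{R}^{N-1}}G(x,y',0,t-s)\,u(y',0,s)^p\,dy'\,ds$$ for all $(x,t)\in D\times(0,T)$ (for $N=1$ the inner integral is just evaluation at the boundary point $0$). It is a minimal solution in $[0,T)$ if moreover $u\le w$ in $D\times(0,T)$ for every solution $w$ in $[0,T)$ with $w(0)=\varphi$. A global-in-time solution is a nonnegative continuous function on $D\times(0,\infty)$ satisfying this integral equation for all $(x,t)\in D\times(0,\infty)$. Life span: $T(\kappa\psi)$ is the maximal existence time of the minimal solution with $u(0)=\kappa\psi$, i.e. the supremum (possibly $\infty$) of all $T>0$ such that a minimal solution in $[0,T)$ exists, with $T(\kappa\psi)=0$ if there is no such $T$. For nonnegative functions $f_1,f_2$ on $(0,\infty)$, $f_1(\tau)\sim f_2(\tau)$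 as $\tau\to+0$ means that there is a constant $C>0$ with $C^{-1}f_2(\tau)\le f_1(\tau)\le Cf_2(\tau)$ for all sufficiently small $\tau>0$. *)

theory Defs
  imports "HOL-Analysis.Analysis"
begin

text \<open>
  \<open>\<real>\<^sup>N\<close> is \<^typ>\<open>real ^ 'n\<close> with \<open>N = CARD('n)\<close>, and \<open>k :: 'n\<close> is the index of the
  normal coordinate (the last one, \<open>y\<^sub>N\<close>, in the usual numbering).
\<close>

definition halfspace :: "'n::finite \<Rightarrow> (real ^ 'n) set" where
  "halfspace k = {y. 0 < y $ k}"

definition reflect :: "'n::finite \<Rightarrow> real ^ 'n \<Rightarrow> real ^ 'n" where
  "reflect k y = (\<chi> i. if i = k then - (y $ k) else y $ i)"

definition neumann_green :: "'n::finite \<Rightarrow> real ^ 'n \<Rightarrow> real ^ 'n \<Rightarrow> real \<Rightarrow> real" where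
  "neumann_green k x y t =
     (4 * pi * t) powr (- real CARD('n) / 2) *
       (exp (- (norm (x - y))\<^sup>2 / (4 * t)) + exp (- (norm (x - reflect k y))\<^sup>2 / (4 * t)))"

text \<open>
  A point \<open>y'\<close> of \<open>\<real>\<^sup>N\<^sup>-\<^sup>1\<close> is a function on the index set \<open>UNIV - {k}\<close>;
  \<open>boundary_point k y'\<close> is \<open>(y', 0)\<close>. For \<open>N = 1\<close> the index set is empty, and
  \<open>boundary_measure k\<close> is the unit mass at the only point of its space, so that integration
  against it is evaluation at the boundary point \<open>0\<close>.
\<close>

definition boundary_point :: "'n::finite \<Rightarrow> ('n \<Rightarrow> real) \<Rightarrow> real ^ 'n" where
  "boundary_point k y' = (\<chi> i. if i = k then 0 else y' i)"

definition boundary_measure :: "'n::finite \<Rightarrow> ('n \<Rightarrow> real) measure" where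
  "boundary_measure k = PiM (UNIV - {k}) (\<lambda>_. lborel)"

text \<open>
  All integrands are nonnegative, so the integrals are taken in \<^typ>\<open>ennreal\<close>; the equation
  includes the finiteness of both.
\<close>

definition integral_equation ::
    "'n::finite \<Rightarrow> real \<Rightarrow> (real ^ 'n \<Rightarrow> real) \<Rightarrow> (real ^ 'n \<Rightarrow> real \<Rightarrow> real) \<Rightarrow>
      real ^ 'n \<Rightarrow> real \<Rightarrow> bool" where
  "integral_equation k p \<phi> u x t \<longleftrightarrow>
     ennreal (u x t) =
       (\<integral>\<^sup>+ y \<in> closure (halfspace k). ennreal (neumann_green k x y t * \<phi> y) \<partial>lebesgue) +
       (\<integral>\<^sup>+ s \<in> {0<..<t}.
          (\<integral>\<^sup>+ y'. ennreal (neumann_green k x (boundary_point k y') (t - s) *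
                            u (boundary_point k y') s powr p) \<partial>boundary_measure k) \<partial>lborel)"

text \<open>
  Solutions on the time set \<open>J\<close>, which is \<open>{0<..<T}\<close> for solutions in \<open>[0, T)\<close> and \<open>{0<..}\<close> for
  global-in-time solutions; the initial datum \<open>\<phi>\<close> has to be measurable and nonnegative on the
  half-space.
\<close>

definition solution_on ::
    "real set \<Rightarrow> 'n::finite \<Rightarrow> real \<Rightarrow> (real ^ 'n \<Rightarrow> real) \<Rightarrow> (real ^ 'n \<Rightarrow> real \<Rightarrow> real) \<Rightarrow> bool" where
  "solution_on J k p \<phi> u \<longleftrightarrow>
     \<phi> \<in> borel_measurable (restrict_space lebesgue (halfspace k)) \<and>
     (\<forall>y\<in>halfspace k. 0 \<le> \<phi> y) \<and>
     continuous_on (closure (halfspace k) \<times> J) (\<lambda>(x, t). u x t) \<and>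
     (\<forall>x\<in>closure (halfspace k). \<forall>t\<in>J. 0 \<le> u x t \<and> integral_equation k p \<phi> u x t)"

definition is_solution ::
    "'n::finite \<Rightarrow> real \<Rightarrow> (real ^ 'n \<Rightarrow> real) \<Rightarrow> real \<Rightarrow> (real ^ 'n \<Rightarrow> real \<Rightarrow> real) \<Rightarrow> bool" where
  "is_solution k p \<phi> T u \<longleftrightarrow> solution_on {0<..<T} k p \<phi> u"

definition is_minimal_solution ::
    "'n::finite \<Rightarrow> real \<Rightarrow> (real ^ 'n \<Rightarrow> real) \<Rightarrow> real \<Rightarrow> (real ^ 'n \<Rightarrow> real \<Rightarrow> real) \<Rightarrow> bool" where
  "is_minimal_solution k p \<phi> T u \<longleftrightarrow>
     is_solution k p \<phi> T u \<and>
     (\<forall>w. is_solution k p \<phi> T w \<longrightarrow>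
        (\<forall>x\<in>closure (halfspace k). \<forall>t\<in>{0<..<T}. u x t \<le> w x t))"

definition is_global_solution ::
    "'n::finite \<Rightarrow> real \<Rightarrow> (real ^ 'n \<Rightarrow> real) \<Rightarrow> (real ^ 'n \<Rightarrow> real \<Rightarrow> real) \<Rightarrow> bool" where
  "is_global_solution k p \<phi> u \<longleftrightarrow> solution_on {0<..} k p \<phi> u"

text \<open>The element \<open>0\<close> is inserted because the supremum of the empty set is \<open>-\<infinity>\<close> in \<^typ>\<open>ereal\<close>.\<close>

definition life_span :: "'n::finite \<Rightarrow> real \<Rightarrow> (real ^ 'n \<Rightarrow> real) \<Rightarrow> ereal" where
  "life_span k p \<phi> = Sup (insert 0 {ereal T | T. 0 < T \<and> (\<exists>u. is_minimal_solution k p \<phi> T u)})"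

text \<open>Logarithm on \<open>[0, \<infinity>]\<close>.\<close>

definition ln_extended :: "ereal \<Rightarrow> ereal" where
  "ln_extended x = (if x = \<infinity> then \<infinity> else if x \<le> 0 then - \<infinity> else ereal (ln (real_of_ereal x)))"

text \<open>
  \<open>f\<^sub>1(\<tau>) \<sim> f\<^sub>2(\<tau>)\<close> as \<open>\<tau> \<rightarrow> +0\<close>. The left-hand side is extended-valued because a life span may
  a priori be infinite; the relation forces it to be finite for small \<open>\<tau>\<close>.
\<close>

definition sim_at_0 :: "(real \<Rightarrow> ereal) \<Rightarrow> (real \<Rightarrow> real) \<Rightarrow> bool" where
  "sim_at_0 f\<^sub>1 f\<^sub>2 \<longleftrightarrow>
     (\<exists>C>0. \<forall>\<^sub>F \<tau> in at_right 0.
        ereal (inverse C * f\<^sub>2 \<tau>) \<le> f\<^sub>1 \<tau> \<and> f\<^sub>1 \<tau> \<le> ereal (C * f\<^sub>2 \<tau>))"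

end

theory Submission
  imports Defs "HOL-Probability.Distributions" "HOL-Real_Asymp.Real_Asymp"
begin

text \<open>
  On the boundary the problem is a Volterra equation whose kernel is \<open>(\<pi> (t - s)) powr (-1/2)\<close> times
  the tangential heat kernel; everything is decided by the boundary values of a solution.

  Lower bounds of the life span. Monotone iteration below a bounded supersolution gives a minimal
  solution; it is continuous because it and its complement in an explicit potential are both lower
  semicontinuous. A supersolution is \<open>2 W powr (1/\<alpha>)\<close>, where \<open>W\<close> is the heat flow of
  \<open>(\<kappa>\<psi>) powr \<alpha>\<close>: moving the trace of \<open>W\<close> at time \<open>s\<close> on by the tangential heat flow costs at most the
  factor \<open>sqrt (t/s)\<close> relative to the trace at time \<open>t\<close>, so that only an integral in time of a power of
  \<open>\<parallel>W(s)\<parallel>\<^sub>\<infinity>\<close> has to be small. The choice \<open>\<alpha> = 1\<close> yields all finite life spans, and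
  \<open>\<alpha> > 1\<close> the global solutions.

  Upper bounds. A solution that is at least \<open>a\<close> on a parabolic box of size \<open>R\<close> satisfies
  \<open>C sqrt R a powr (p - 1) \<le> 1\<close>, by iterating the integral inequality on boxes of fixed spatial size and
  shrinking time length. Inserting the mass of the initial datum in a half ball of radius \<open>sqrt R\<close>
  settles the subcritical case. For \<open>p = 1 + 1/N\<close> a lower bound \<open>\<mu> t powr (-N/2)\<close> on \<open>|x| \<le> sqrt t\<close>
  doubles after \<open>ln t\<close> has grown by a multiple of \<open>\<mu> powr (1 - p)\<close>, a geometric series in the number
  of doublings.
\<close>

section \<open>Heat kernels\<close>

text \<open>Both sides of each estimate meet in one quantity: the mass of the datum in a ball or
  half ball of radius \<open>sqrt t\<close>, times \<open>t powr (- N / 2)\<close>. From above it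
  controls the heat flow at time t uniformly in x, up to the tail \<open>t powr (- A / 2)\<close>;
  from below it bounds every solution on the boundary box of size \<open>sqrt t\<close>. For the
  given data this mass grows like \<open>t powr ((N - min A N) / 2)\<close>, with a logarithm if A =
  N, which is the origin of \<open>min A N\<close> and of the logarithms in the result. A decay
  \<open>s powr (- a / 2)\<close> of the flow makes the time integral a power of t if a (p - 1) < 1
  and a logarithm if a (p - 1) = 1; for a = N the latter is p = 1 + 1/N. If moreover A = N, the mass
  still grows while the doubling waits to start: waiting until ln t is of order X raises it to the
  order \<kappa> X and leaves a logarithmic time of order
  \<open>(\<kappa> * X) powr (1 - p)\<close>. Equating this with X gives
  \<open>X = \<kappa> powr (- (p - 1) / p)\<close>. The life span refers to minimal solutions, so
  the lower bounds have to construct minimal ones, while the upper bounds exclude arbitrary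
  ones.\<close>

definition heat_kernel :: "real \<Rightarrow> real \<Rightarrow> real" where
  "heat_kernel t r = exp (- r\<^sup>2 / (4 * t)) / sqrt (4 * pi * t)"

lemma heat_kernel_nonneg [simp]: "0 \<le> t \<Longrightarrow> 0 \<le> heat_kernel t r"
  by (simp add: heat_kernel_def)

lemma heat_kernel_minus [simp]: "heat_kernel t (- r) = heat_kernel t r"
  by (simp add: heat_kernel_def)

lemma heat_kernel_measurable [measurable (raw)]:
  assumes [measurable]: "f \<in> borel_measurable M" "g \<in> borel_measurable M"
  shows "(\<lambda>x. heat_kernel (f x) (g x)) \<in> borel_measurable M"
  unfolding heat_kernel_def by measurable

text \<open>The kernel at time t is the centred Gaussian of variance 2t, so total mass and semigroup
  property reduce to facts about normal densities.\<close>

lemma heat_kernel_eq_normal_density: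
  "0 < t \<Longrightarrow> heat_kernel t r = normal_density 0 (sqrt (2 * t)) r"
  by (simp add: heat_kernel_def normal_density_def mult_ac)

lemma nn_integral_heat_kernel:
  assumes "0 < t"
  shows "(\<integral>\<^sup>+ r. ennreal (heat_kernel t r) \<partial>lborel) = 1"
proof -
  have "(\<integral>\<^sup>+ r. ennreal (normal_density 0 (sqrt (2 * t)) r) \<partial>lborel) = 1"
    using assms by (subst nn_integral_eq_integral) auto
  then show ?thesis
    using assms by (simp add: heat_kernel_eq_normal_density)
qed

lemma nn_integral_heat_kernel_shift:
  assumes "0 < t"
  shows "(\<integral>\<^sup>+ r. ennreal (heat_kernel t (x - r)) \<partial>lborel) = 1"
proof -
  have "(\<integral>\<^sup>+ r. ennreal (heat_kernel t r) \<partial>lborel) =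
      ennreal \<bar>-1\<bar> * (\<integral>\<^sup>+ r. ennreal (heat_kernel t (x + (-1) * r)) \<partial>lborel)"
    by (rule nn_integral_real_affine) auto
  then show ?thesis
    using nn_integral_heat_kernel[OF assms] by simp
qed

text \<open>Semigroup property: under convolution of centred Gaussians the variances add. A
  translation by w brings the integral into convolution form.\<close>

lemma heat_kernel_convolution:
  assumes "0 < a" "0 < b"
  shows "(\<integral>\<^sup>+ z. ennreal (heat_kernel a (x - z) * heat_kernel b (z - w)) \<partial>lborel) =
    ennreal (heat_kernel (a + b) (x - w))"
proof -
  let ?f = "\<lambda>z. ennreal (heat_kernel a (x - z) * heat_kernel b (z - w))"
  have "(\<integral>\<^sup>+ z. ?f z \<partial>lborel) = ennreal \<bar>1\<bar> * (\<integral>\<^sup>+ z. ?f (w + 1 * z) \<partial>lborel)"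
    by (rule nn_integral_real_affine) auto
  also have "\<dots> = (\<integral>\<^sup>+ z. ennreal (normal_density 0 (sqrt (2 * a)) ((x - w) - z) *
      normal_density 0 (sqrt (2 * b)) z) \<partial>lborel)"
    using assms by (simp add: heat_kernel_eq_normal_density algebra_simps)
  also have "\<dots> = ennreal (normal_density 0 (sqrt ((sqrt (2 * a))\<^sup>2 + (sqrt (2 * b))\<^sup>2)) (x - w))"
    using conv_normal_density_zero_mean[of "sqrt (2 * a)" "sqrt (2 * b)"] assms by (simp add: fun_eq_iff)
  also have "\<dots> = ennreal (heat_kernel (a + b) (x - w))"
    using assms by (simp add: heat_kernel_eq_normal_density distrib_left)
  finally show ?thesis .
qed

text \<open>Reversing the sign of r turns the image term into the free kernel on the negative half
  line, so the two terms together fill up the whole Gaussian.\<close>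

lemma nn_integral_heat_kernel_half_line:
  assumes "0 < t"
  shows "(\<integral>\<^sup>+ r\<in>{0..}. ennreal (heat_kernel t (x - r) + heat_kernel t (x + r)) \<partial>lborel) = 1"
proof -
  have "(\<integral>\<^sup>+ r\<in>{0..}. ennreal (heat_kernel t (x + r)) \<partial>lborel) =
      ennreal \<bar>-1\<bar> * (\<integral>\<^sup>+ r. ennreal (heat_kernel t (x + (0 + (-1) * r))) * indicator {0..} (0 + (-1) * r) \<partial>lborel)"
    by (rule nn_integral_real_affine) auto
  also have "\<dots> = (\<integral>\<^sup>+ r\<in>{..<0}. ennreal (heat_kernel t (x - r)) \<partial>lborel)"
    by (auto intro!: nn_integral_cong_AE eventually_mono[OF AE_lborel_singleton[of 0]]
        split: split_indicator)
  finally have "(\<integral>\<^sup>+ r\<in>{0..}. ennreal (heat_kernel t (x - r) + heat_kernel t (x + r)) \<partial>lborel) =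
      (\<integral>\<^sup>+ r\<in>{0..}. ennreal (heat_kernel t (x - r)) \<partial>lborel) +
      (\<integral>\<^sup>+ r\<in>{..<0}. ennreal (heat_kernel t (x - r)) \<partial>lborel)"
    using assms by (subst nn_integral_add[symmetric])
      (auto simp: nn_integral_add distrib_right intro!: nn_integral_cong)
  also have "\<dots> = (\<integral>\<^sup>+ r. ennreal (heat_kernel t (x - r)) \<partial>lborel)"
    by (subst nn_integral_add[symmetric]) (auto intro!: nn_integral_cong split: split_indicator)
  finally show ?thesis
    by (simp add: nn_integral_heat_kernel_shift[OF assms])
qed

text \<open>The heat kernel in the N - 1 tangential variables. It takes points of the full space, so
  that one argument may be an interior point; for N = 1 the empty product gives 1, in accordance
  with the unit mass \<open>boundary_measure k\<close>.\<close>

definition tangential_kernel :: "'n::finite \<Rightarrow> real \<Rightarrow> real ^ 'n \<Rightarrow> real ^ 'n \<Rightarrow> real" where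
  "tangential_kernel k t x y = (\<Prod>i\<in>UNIV - {k}. heat_kernel t (x $ i - y $ i))"

lemma tangential_kernel_nonneg [simp]: "0 \<le> t \<Longrightarrow> 0 \<le> tangential_kernel k t x y"
  by (simp add: tangential_kernel_def prod_nonneg)

lemma measurable_vec_nth [measurable]: "(\<lambda>x::real ^ 'n::finite. x $ i) \<in> borel_measurable borel"
  by (intro borel_measurable_continuous_onI continuous_intros)

lemma tangential_kernel_measurable [measurable (raw)]:
  assumes [measurable]: "t \<in> borel_measurable M" "f \<in> borel_measurable M" "g \<in> borel_measurable M"
  shows "(\<lambda>x. tangential_kernel k (t x) (f x) (g x)) \<in> borel_measurable M"
  unfolding tangential_kernel_def by measurable

lemma prod_heat_kernel:
  fixes x :: "'n::finite \<Rightarrow> real"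
  assumes "0 < t"
  shows "(\<Prod>i\<in>UNIV. heat_kernel t (x i)) =
    (4 * pi * t) powr (- real CARD('n) / 2) * exp (- (\<Sum>i\<in>UNIV. (x i)\<^sup>2) / (4 * t))"
proof -
  have "(\<Prod>i\<in>UNIV. heat_kernel t (x i)) =
      (\<Prod>i\<in>(UNIV :: 'n set). exp (- (x i)\<^sup>2 / (4 * t))) / sqrt (4 * pi * t) ^ CARD('n)"
    by (simp add: heat_kernel_def prod_dividef)
  also have "(\<Prod>i\<in>(UNIV :: 'n set). exp (- (x i)\<^sup>2 / (4 * t))) = exp (- (\<Sum>i\<in>UNIV. (x i)\<^sup>2) / (4 * t))"
    by (simp add: exp_sum[symmetric] sum_divide_distrib sum_negf)
  also have "sqrt (4 * pi * t) ^ CARD('n) = (4 * pi * t) powr (real CARD('n) / 2)"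
    using assms by (simp add: powr_half_sqrt[symmetric] powr_realpow[symmetric] powr_powr)
  finally show ?thesis
    by (simp add: powr_minus field_simps)
qed

text \<open>The reflection changes only the normal coordinate, so both exponentials share the
  tangential factor. All later estimates treat the two factors separately.\<close>

lemma neumann_green_eq:
  fixes k :: "'n::finite"
  assumes "0 < t"
  shows "neumann_green k x y t =
    tangential_kernel k t x y * (heat_kernel t (x $ k - y $ k) + heat_kernel t (x $ k + y $ k))"
proof -
  have n: "(norm v)\<^sup>2 = (\<Sum>i\<in>UNIV. (v $ i)\<^sup>2)" for v :: "real ^ 'n"
    by (simp only: power2_norm_eq_inner inner_vec_def) (simp add: power2_eq_square)
  have P: "(\<Prod>i\<in>UNIV. heat_kernel t (x $ i - z $ i)) =
      (4 * pi * t) powr (- real CARD('n) / 2) * exp (- (norm (x - z))\<^sup>2 / (4 * t))" for z :: "real ^ 'n"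
    by (simp add: prod_heat_kernel[OF assms] n)
  have R: "(\<Prod>i\<in>UNIV. heat_kernel t (x $ i - z $ i)) =
      heat_kernel t (x $ k - z $ k) * tangential_kernel k t x z" for z :: "real ^ 'n"
    unfolding tangential_kernel_def by (subst prod.remove[of _ k]) auto
  have T: "tangential_kernel k t x (reflect k y) = tangential_kernel k t x y"
    unfolding tangential_kernel_def reflect_def by (intro prod.cong) auto
  have "neumann_green k x y t = (\<Prod>i\<in>UNIV. heat_kernel t (x $ i - y $ i)) +
      (\<Prod>i\<in>UNIV. heat_kernel t (x $ i - reflect k y $ i))"
    unfolding P neumann_green_def by (simp add: distrib_left)
  also have "\<dots> = tangential_kernel k t x y * (heat_kernel t (x $ k - y $ k) + heat_kernel t (x $ k + y $ k))"
    unfolding R T by (simp add: reflect_def algebra_simps)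
  finally show ?thesis .
qed

lemma neumann_green_nonneg [simp]: "0 \<le> neumann_green k x y t"
  by (simp add: neumann_green_def)

lemma closure_halfspace: "closure (halfspace k) = {y. 0 \<le> y $ (k :: 'n::finite)}"
proof -
  have "halfspace k = {y::real ^ 'n. axis k 1 \<bullet> y > 0}"
    by (auto simp: halfspace_def inner_commute[of "axis k 1"] inner_axis)
  moreover have "closure {y::real ^ 'n. axis k 1 \<bullet> y > 0} = {y. axis k 1 \<bullet> y \<ge> 0}"
    by (rule closure_halfspace_gt) (simp add: axis_eq_0_iff)
  ultimately show ?thesis
    by (auto simp: inner_commute[of "axis k 1"] inner_axis)
qed

lemma sets_closure_halfspace [measurable]: "closure (halfspace k) \<in> sets borel"
  by simp

lemma reflect_measurable [measurable]: "reflect (k :: 'n::finite) \<in> borel_measurable borel"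
proof -
  have "continuous_on UNIV (\<lambda>y. (\<chi> i. if i = k then - (y $ k) else y $ i) :: real ^ 'n)"
  proof (intro continuous_on_vec_lambda)
    show "continuous_on UNIV (\<lambda>y::real ^ 'n. if i = k then - (y $ k) else y $ i)" for i
      by (cases "i = k") (auto intro!: continuous_intros)
  qed
  then show ?thesis
    unfolding reflect_def[abs_def] by (rule borel_measurable_continuous_onI)
qed

lemma neumann_green_measurable [measurable (raw)]:
  assumes [measurable]: "f \<in> borel_measurable M" "g \<in> borel_measurable M" "t \<in> borel_measurable M"
  shows "(\<lambda>x. neumann_green k (f x) (g x) (t x)) \<in> borel_measurable M"
  unfolding neumann_green_def by measurable

text \<open>Fubini for product integrands; \<open>inv ?ax\<close> translates the indexing by basis
  vectors into an indexing by coordinates.\<close>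

lemma nn_integral_vec_prod:
  fixes f :: "'n::finite \<Rightarrow> real \<Rightarrow> ennreal"
  assumes [measurable]: "\<And>i. f i \<in> borel_measurable borel"
  shows "(\<integral>\<^sup>+ x. (\<Prod>i\<in>UNIV. f i (x $ i)) \<partial>(lborel :: (real ^ 'n) measure)) =
    (\<Prod>i\<in>UNIV. \<integral>\<^sup>+ r. f i r \<partial>lborel)"
proof -
  let ?ax = "\<lambda>i::'n. axis i (1::real)"
  let ?g = "\<lambda>b. f (inv ?ax b)"
  have inj: "inj ?ax"
    by (auto simp: inj_on_def axis_eq_axis)
  have B: "(Basis :: (real ^ 'n) set) = range ?ax"
    by (auto simp: Basis_vec_def)
  have P: "prod h (Basis :: (real ^ 'n) set) = (\<Prod>i\<in>UNIV. h (?ax i))" for h :: "real ^ 'n \<Rightarrow> ennreal"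
    unfolding B using inj by (simp add: prod.reindex)
  have "(\<integral>\<^sup>+ x. (\<Prod>b\<in>Basis. ?g b (x \<bullet> b)) \<partial>(lborel :: (real ^ 'n) measure)) =
      (\<Prod>b\<in>Basis. \<integral>\<^sup>+ r. ?g b r \<partial>lborel)"
    by (rule nn_integral_lborel_prod) auto
  then show ?thesis
    unfolding P by (simp add: inv_f_f[OF inj] inner_axis)
qed

text \<open>No heat leaves through an insulated boundary: the kernel is a probability density on the
  half-space, which later gives Jensen's inequality and the potentials of constants.\<close>

lemma nn_integral_neumann_green:
  fixes x :: "real ^ 'n::finite"
  assumes "0 < t"
  shows "(\<integral>\<^sup>+ y\<in>closure (halfspace k). ennreal (neumann_green k x y t) \<partial>lborel) = 1"
proof -
  \<comment> \<open>Membership in the half-space concerns coordinate k alone, so its indicator can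
    be put into the k-th factor and the integrand stays a product.\<close>
  let ?f = "\<lambda>i r. if i = k then ennreal (heat_kernel t (x $ k - r) + heat_kernel t (x $ k + r)) * indicator {0..} r
    else ennreal (heat_kernel t (x $ i - r))"
  have "(\<integral>\<^sup>+ y\<in>closure (halfspace k). ennreal (neumann_green k x y t) \<partial>lborel) =
      (\<integral>\<^sup>+ y. (\<Prod>i\<in>UNIV. ?f i (y $ i)) \<partial>lborel)"
  proof (intro nn_integral_cong)
    fix y :: "real ^ 'n"
    have "(\<Prod>i\<in>UNIV. ?f i (y $ i)) = ?f k (y $ k) * (\<Prod>i\<in>UNIV - {k}. ?f i (y $ i))"
      by (rule prod.remove) auto
    also have "(\<Prod>i\<in>UNIV - {k}. ?f i (y $ i)) = (\<Prod>i\<in>UNIV - {k}. ennreal (heat_kernel t (x $ i - y $ i)))"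
      by (intro prod.cong) auto
    also have "\<dots> = ennreal (tangential_kernel k t x y)"
      using assms unfolding tangential_kernel_def by (intro prod_ennreal) auto
    finally show "ennreal (neumann_green k x y t) * indicator (closure (halfspace k)) y =
        (\<Prod>i\<in>UNIV. ?f i (y $ i))"
      using assms by (auto simp: neumann_green_eq closure_halfspace ennreal_mult mult_ac split: split_indicator)
  qed
  also have "\<dots> = (\<Prod>i\<in>UNIV. \<integral>\<^sup>+ r. ?f i r \<partial>lborel)"
    by (rule nn_integral_vec_prod) auto
  also have "\<dots> = 1"
  proof (intro prod.neutral ballI)
    show "(\<integral>\<^sup>+ r. ?f i r \<partial>lborel) = 1" for i
      using assms by (cases "i = k") (simp_all add: nn_integral_heat_kernel_half_line nn_integral_heat_kernel_shift del: ennreal_plus)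
  qed
  finally show ?thesis .
qed

lemma boundary_point_nth [simp]: "boundary_point k y $ i = (if i = k then 0 else y i)"
  by (simp add: boundary_point_def)

lemma boundary_point_in [simp]: "boundary_point k y \<in> closure (halfspace k)"
  by (simp add: closure_halfspace)

lemma sigma_finite_boundary_measure: "sigma_finite_measure (boundary_measure (k :: 'n::finite))"
proof -
  interpret finite_product_sigma_finite "\<lambda>_::'n. lborel :: real measure" "UNIV - {k}"
    by unfold_locales auto
  show ?thesis
    unfolding boundary_measure_def by unfold_locales
qed

interpretation boundary: sigma_finite_measure "boundary_measure k"
  by (rule sigma_finite_boundary_measure)

lemma boundary_point_measurable [measurable]: "boundary_point k \<in> borel_measurable (boundary_measure k)"
proof -
  have "(\<lambda>y. boundary_point k y \<bullet> axis i (1::real)) \<in> borel_measurable (boundary_measure k)" for i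
    unfolding boundary_measure_def inner_axis boundary_point_nth
    by (cases "i = k") auto
  then show ?thesis
    by (subst borel_measurable_euclidean_space) (auto simp: Basis_vec_def)
qed

lemma nn_integral_boundary_prod:
  fixes f :: "'n::finite \<Rightarrow> real \<Rightarrow> ennreal"
  assumes [measurable]: "\<And>i. f i \<in> borel_measurable borel"
  shows "(\<integral>\<^sup>+ y. (\<Prod>i\<in>UNIV - {k}. f i (y i)) \<partial>boundary_measure k) =
    (\<Prod>i\<in>UNIV - {k}. \<integral>\<^sup>+ r. f i r \<partial>lborel)"
proof -
  interpret product_sigma_finite "\<lambda>_::'n. lborel :: real measure"
    by unfold_locales
  show ?thesis
    unfolding boundary_measure_def by (rule product_nn_integral_prod) auto
qed

text \<open>A boundary point is its own mirror image, hence the factor 2.\<close>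

lemma neumann_green_boundary:
  assumes "0 < t"
  shows "neumann_green k x (boundary_point k y) t =
    2 * heat_kernel t (x $ k) * tangential_kernel k t x (boundary_point k y)"
  using assms by (simp add: neumann_green_eq)

lemma nn_integral_tangential_kernel:
  assumes "0 < t"
  shows "(\<integral>\<^sup>+ y. ennreal (tangential_kernel k t x (boundary_point k y)) \<partial>boundary_measure k) = 1"
proof -
  have "(\<integral>\<^sup>+ y. ennreal (tangential_kernel k t x (boundary_point k y)) \<partial>boundary_measure k) =
      (\<integral>\<^sup>+ y. (\<Prod>i\<in>UNIV - {k}. ennreal (heat_kernel t (x $ i - y i))) \<partial>boundary_measure k)"
    using assms by (intro nn_integral_cong) (simp add: tangential_kernel_def prod_ennreal)
  also have "\<dots> = 1"
    using assms by (subst nn_integral_boundary_prod) (auto simp: nn_integral_heat_kernel_shift)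
  finally show ?thesis .
qed

text \<open>Coordinatewise semigroup property. The intermediate point runs through the boundary
  only, because the normal coordinates of all points are invisible to the kernel.\<close>

lemma tangential_kernel_convolution:
  assumes "0 < a" "0 < b"
  shows "(\<integral>\<^sup>+ z. ennreal (tangential_kernel k a x (boundary_point k z) *
      tangential_kernel k b (boundary_point k z) y) \<partial>boundary_measure k) =
    ennreal (tangential_kernel k (a + b) x y)"
proof -
  have "(\<integral>\<^sup>+ z. ennreal (tangential_kernel k a x (boundary_point k z) *
        tangential_kernel k b (boundary_point k z) y) \<partial>boundary_measure k) =
      (\<integral>\<^sup>+ z. (\<Prod>i\<in>UNIV - {k}. ennreal (heat_kernel a (x $ i - z i) * heat_kernel b (z i - y $ i)))
        \<partial>boundary_measure k)"
    using assms by (intro nn_integral_cong)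
      (simp add: tangential_kernel_def prod_ennreal prod.distrib[symmetric])
  also have "\<dots> = (\<Prod>i\<in>UNIV - {k}. ennreal (heat_kernel (a + b) (x $ i - y $ i)))"
    using assms by (subst nn_integral_boundary_prod) (auto simp: heat_kernel_convolution)
  also have "\<dots> = ennreal (tangential_kernel k (a + b) x y)"
    using assms by (simp add: tangential_kernel_def prod_ennreal)
  finally show ?thesis .
qed

section \<open>Potentials\<close>

definition heat_potential :: "'n::finite \<Rightarrow> (real ^ 'n \<Rightarrow> ennreal) \<Rightarrow> real ^ 'n \<Rightarrow> real \<Rightarrow> ennreal" where
  "heat_potential k \<phi> x t =
    (\<integral>\<^sup>+ y\<in>closure (halfspace k). (ennreal (neumann_green k x y t) * \<phi> y) \<partial>lborel)"

definition boundary_potential ::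
    "'n::finite \<Rightarrow> (('n \<Rightarrow> real) \<Rightarrow> real \<Rightarrow> ennreal) \<Rightarrow> real ^ 'n \<Rightarrow> real \<Rightarrow> ennreal" where
  "boundary_potential k f x t =
    (\<integral>\<^sup>+ s\<in>{0<..<t}. (\<integral>\<^sup>+ y. ennreal (neumann_green k x (boundary_point k y) (t - s)) * f y s
      \<partial>boundary_measure k) \<partial>lborel)"

text \<open>Completing a measure does not change nonnegative integrals, so \<open>lebesgue\<close>
  can be exchanged for \<open>lborel\<close>, for which joint measurability and Fubini are
  available.\<close>

lemma integral_equation_iff:
  "integral_equation k p \<phi> u x t \<longleftrightarrow>
    ennreal (u x t) = heat_potential k (\<lambda>y. ennreal (\<phi> y)) x t +
      boundary_potential k (\<lambda>y s. ennreal (u (boundary_point k y) s powr p)) x t"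
  unfolding integral_equation_def heat_potential_def boundary_potential_def nn_integral_completion
  by (simp add: ennreal_mult')

lemma heat_potential_mono:
  "(\<And>y. y \<in> closure (halfspace k) \<Longrightarrow> \<phi> y \<le> \<eta> y) \<Longrightarrow> heat_potential k \<phi> x t \<le> heat_potential k \<eta> x t"
  unfolding heat_potential_def
  by (intro nn_integral_mono) (auto split: split_indicator intro!: mult_left_mono)

lemma boundary_potential_mono:
  "(\<And>y s. 0 < s \<Longrightarrow> s < t \<Longrightarrow> f y s \<le> g y s) \<Longrightarrow> boundary_potential k f x t \<le> boundary_potential k g x t"
  unfolding boundary_potential_def
  by (intro nn_integral_mono) (auto split: split_indicator intro!: mult_left_mono nn_integral_mono)

lemma heat_potential_measurable [measurable]:
  assumes [measurable]: "\<phi> \<in> borel_measurable borel"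
  shows "(\<lambda>(x, t). heat_potential k \<phi> x t) \<in> borel_measurable (borel \<Otimes>\<^sub>M borel)"
  unfolding heat_potential_def by measurable

lemma boundary_potential_measurable [measurable]:
  assumes [measurable]: "(\<lambda>(y, s). f y s) \<in> borel_measurable (boundary_measure k \<Otimes>\<^sub>M borel)"
  shows "(\<lambda>(x, t). boundary_potential k f x t) \<in> borel_measurable (borel \<Otimes>\<^sub>M borel)"
proof -
  \<comment> \<open>The end point of the time interval is one of the variables; written as a
    predicate in s and t, the indicator is jointly measurable.\<close>
  have *: "(\<lambda>(x, t). boundary_potential k f x t) = (\<lambda>(x, t). \<integral>\<^sup>+ s.
      (\<integral>\<^sup>+ y. ennreal (neumann_green k x (boundary_point k y) (t - s)) * f y s
      \<partial>boundary_measure k) * of_bool (0 < s \<and> s < t) \<partial>lborel)"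
    unfolding boundary_potential_def by (auto simp: indicator_def fun_eq_iff intro!: nn_integral_cong)
  show ?thesis
    unfolding * by measurable
qed

lemma heat_potential_add:
  assumes [measurable]: "\<phi> \<in> borel_measurable borel" "\<eta> \<in> borel_measurable borel"
  shows "heat_potential k (\<lambda>y. \<phi> y + \<eta> y) x t = heat_potential k \<phi> x t + heat_potential k \<eta> x t"
  unfolding heat_potential_def
  by (subst nn_integral_add[symmetric]) (auto simp: algebra_simps intro!: nn_integral_cong)

lemma boundary_potential_add:
  assumes [measurable]: "(\<lambda>(y, s). f y s) \<in> borel_measurable (boundary_measure k \<Otimes>\<^sub>M borel)"
    "(\<lambda>(y, s). g y s) \<in> borel_measurable (boundary_measure k \<Otimes>\<^sub>M borel)"
  shows "boundary_potential k (\<lambda>y s. f y s + g y s) x t = boundary_potential k f x t + boundary_potential k g x t"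
  unfolding boundary_potential_def
  by (subst nn_integral_add[symmetric])
    (auto simp: distrib_left distrib_right nn_integral_add intro!: nn_integral_cong)

lemma heat_potential_const:
  assumes "0 < t"
  shows "heat_potential k (\<lambda>_. c) x t = c"
proof -
  have "heat_potential k (\<lambda>_. c) x t =
      (\<integral>\<^sup>+ y. c * (ennreal (neumann_green k x y t) * indicator (closure (halfspace k)) y) \<partial>lborel)"
    unfolding heat_potential_def by (intro nn_integral_cong) (simp add: mult_ac)
  also have "\<dots> = c"
    by (subst nn_integral_cmult) (auto simp: nn_integral_neumann_green[OF assms])
  finally show ?thesis .
qed

lemma nn_integral_reflect_interval:
  fixes f :: "real \<Rightarrow> ennreal"
  assumes [measurable]: "f \<in> borel_measurable borel"
  shows "(\<integral>\<^sup>+ s\<in>{0<..<t}. f (t - s) \<partial>lborel) = (\<integral>\<^sup>+ s\<in>{0<..<t}. f s \<partial>lborel)"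
proof -
  have "(\<integral>\<^sup>+ s\<in>{0<..<t}. f s \<partial>lborel) =
      ennreal \<bar>-1\<bar> * (\<integral>\<^sup>+ s. f (t + (-1) * s) * indicator {0<..<t} (t + (-1) * s) \<partial>lborel)"
    by (rule nn_integral_real_affine) auto
  then show ?thesis
    by (auto intro!: nn_integral_cong split: split_indicator)
qed

text \<open>For data constant along the boundary the tangential kernel integrates to 1, and a
  one-dimensional integral in time remains.\<close>

lemma boundary_potential_time:
  assumes [measurable]: "g \<in> borel_measurable borel"
  shows "boundary_potential k (\<lambda>_. g) x t =
    (\<integral>\<^sup>+ s\<in>{0<..<t}. (ennreal (2 * heat_kernel (t - s) (x $ k)) * g s) \<partial>lborel)"
  unfolding boundary_potential_def
proof (intro nn_integral_cong)
  fix s :: real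
  have "(\<integral>\<^sup>+ y. ennreal (neumann_green k x (boundary_point k y) (t - s)) * g s \<partial>boundary_measure k) =
      ennreal (2 * heat_kernel (t - s) (x $ k)) * g s" if "s < t"
  proof -
    have "(\<integral>\<^sup>+ y. ennreal (neumann_green k x (boundary_point k y) (t - s)) * g s \<partial>boundary_measure k) =
        (\<integral>\<^sup>+ y. (ennreal (2 * heat_kernel (t - s) (x $ k)) * g s) *
          ennreal (tangential_kernel k (t - s) x (boundary_point k y)) \<partial>boundary_measure k)"
      using that by (intro nn_integral_cong) (simp add: neumann_green_boundary ennreal_mult' mult_ac)
    then show ?thesis
      using that by (simp add: nn_integral_cmult nn_integral_tangential_kernel)
  qed
  then show "(\<integral>\<^sup>+ y. ennreal (neumann_green k x (boundary_point k y) (t - s)) * g s \<partial>boundary_measure k) *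
      indicator {0<..<t} s = ennreal (2 * heat_kernel (t - s) (x $ k)) * g s * indicator {0<..<t} s"
    by (auto split: split_indicator)
qed

text \<open>The explicit potential used in the complementation argument for continuity. After the
  substitution of t - s for s, the variables x and t enter separately, through the kernel and
  through the length of the interval.\<close>

lemma boundary_potential_const:
  "boundary_potential k (\<lambda>_ _. c) x t = c * (\<integral>\<^sup>+ s\<in>{0<..<t}. ennreal (2 * heat_kernel s (x $ k)) \<partial>lborel)"
proof -
  have "boundary_potential k (\<lambda>_ _. c) x t =
      (\<integral>\<^sup>+ s. c * (ennreal (2 * heat_kernel (t - s) (x $ k)) * indicator {0<..<t} s) \<partial>lborel)"
    by (subst boundary_potential_time) (auto intro!: nn_integral_cong simp: mult_ac)
  also have "\<dots> = c * (\<integral>\<^sup>+ s\<in>{0<..<t}. ennreal (2 * heat_kernel (t - s) (x $ k)) \<partial>lborel)"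
    by (rule nn_integral_cmult) auto
  also have "(\<integral>\<^sup>+ s\<in>{0<..<t}. ennreal (2 * heat_kernel (t - s) (x $ k)) \<partial>lborel) =
      (\<integral>\<^sup>+ s\<in>{0<..<t}. ennreal (2 * heat_kernel s (x $ k)) \<partial>lborel)"
    by (rule nn_integral_reflect_interval) auto
  finally show ?thesis .
qed

lemma nn_integral_powr_from_0:
  assumes "-1 < c" "0 \<le> t"
  shows "(\<integral>\<^sup>+ s\<in>{0<..<t}. ennreal (s powr c) \<partial>lborel) = ennreal (t powr (c + 1) / (c + 1))"
proof -
  have "((\<lambda>s. s powr c) has_integral (t powr (c + 1) / (c + 1))) {0..t}"
    by (rule has_integral_powr_from_0) fact+
  then have "(\<integral>\<^sup>+ s. ennreal (indicator {0..t} s * s powr c) \<partial>lborel) = ennreal (t powr (c + 1) / (c + 1))"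
    by (intro nn_integral_has_integral_lebesgue) auto
  moreover have "(\<integral>\<^sup>+ s. ennreal (indicator {0..t} s * s powr c) \<partial>lborel) =
      (\<integral>\<^sup>+ s\<in>{0<..<t}. ennreal (s powr c) \<partial>lborel)"
    by (intro nn_integral_cong_AE eventually_mono[OF eventually_conj[OF AE_lborel_singleton[of 0] AE_lborel_singleton[of t]]])
      (auto split: split_indicator)
  ultimately show ?thesis
    by simp
qed

lemma heat_kernel_le:
  assumes "0 < t"
  shows "heat_kernel t r \<le> t powr (- 1 / 2)"
proof -
  have "heat_kernel t r \<le> 1 / sqrt (4 * pi * t)"
    using assms unfolding heat_kernel_def by (intro divide_right_mono) auto
  also have "\<dots> \<le> 1 / sqrt t"
    using assms pi_gt3 by (intro divide_left_mono) auto
  also have "\<dots> = t powr (- 1 / 2)"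
    using assms by (simp add: powr_minus powr_half_sqrt divide_simps)
  finally show ?thesis .
qed

lemma boundary_time_integral_finite:
  "(\<integral>\<^sup>+ s\<in>{0<..<t}. ennreal (2 * heat_kernel s r) \<partial>lborel) < \<infinity>"
proof -
  \<comment> \<open>The kernel has only an integrable singularity at time 0. The absolute value
    provides the nonnegative end point that \<open>nn_integral_powr_from_0\<close> asks for.\<close>
  have "(\<integral>\<^sup>+ s\<in>{0<..<t}. ennreal (2 * heat_kernel s r) \<partial>lborel) \<le>
      (\<integral>\<^sup>+ s. ennreal 2 * (ennreal (s powr (- 1 / 2)) * indicator {0<..<\<bar>t\<bar>} s) \<partial>lborel)"
    using heat_kernel_le[of _ r]
    by (intro nn_integral_mono) (auto split: split_indicator simp del: ennreal_numeral simp: ennreal_mult'[symmetric])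
  also have "\<dots> = ennreal 2 * (\<integral>\<^sup>+ s\<in>{0<..<\<bar>t\<bar>}. ennreal (s powr (- 1 / 2)) \<partial>lborel)"
    by (rule nn_integral_cmult) auto
  also have "\<dots> < \<infinity>"
    by (subst nn_integral_powr_from_0) (auto simp del: ennreal_numeral simp: ennreal_mult'[symmetric])
  finally show ?thesis .
qed

section \<open>Joint continuity of potentials in space and time\<close>

lemma neumann_green_tendsto:
  assumes "(\<lambda>n. x n) \<longlonglongrightarrow> a" "(\<lambda>n. t n) \<longlonglongrightarrow> b" "0 < b"
  shows "(\<lambda>n. neumann_green k (x n) y (t n)) \<longlonglongrightarrow> neumann_green k a y b"
  unfolding neumann_green_def using assms by (intro tendsto_intros) auto


text \<open>Fatou's lemma along a sequence. Finiteness of the data is what makes multiplication by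
  \<open>\<phi> y\<close> continuous in \<open>ennreal\<close>.\<close>

lemma heat_potential_lsc:
  fixes x :: "nat \<Rightarrow> real ^ 'n::finite"
  assumes [measurable]: "\<phi> \<in> borel_measurable borel"
    and fin: "\<And>y. \<phi> y < top"
    and lim: "x \<longlonglongrightarrow> a" "t \<longlonglongrightarrow> b" "0 < b"
  shows "heat_potential k \<phi> a b \<le> liminf (\<lambda>n. heat_potential k \<phi> (x n) (t n))"
proof -
  have "heat_potential k \<phi> a b \<le>
      (\<integral>\<^sup>+ y. liminf (\<lambda>n. ennreal (neumann_green k (x n) y (t n)) * \<phi> y * indicator (closure (halfspace k)) y) \<partial>lborel)"
    unfolding heat_potential_def
  proof (intro nn_integral_mono)
    fix y :: "real ^ 'n"
    have "(\<lambda>n. (\<phi> y * indicator (closure (halfspace k)) y) * ennreal (neumann_green k (x n) y (t n)))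
        \<longlonglongrightarrow> (\<phi> y * indicator (closure (halfspace k)) y) * ennreal (neumann_green k a y b)"
      using fin lim by (intro ennreal_tendsto_cmult tendsto_ennrealI neumann_green_tendsto)
        (auto split: split_indicator)
    from lim_imp_Liminf[OF _ this]
    show "ennreal (neumann_green k a y b) * \<phi> y * indicator (closure (halfspace k)) y \<le>
        liminf (\<lambda>n. ennreal (neumann_green k (x n) y (t n)) * \<phi> y * indicator (closure (halfspace k)) y)"
      by (simp add: mult_ac)
  qed
  also have "\<dots> \<le> liminf (\<lambda>n. heat_potential k \<phi> (x n) (t n))"
    unfolding heat_potential_def by (intro nn_integral_liminf) auto
  finally show ?thesis .
qed

text \<open>Fatou's lemma twice, along the boundary and in time. The interval of integration moves
  with \<open>t n\<close>, but only times s between 0 and b count: for these eventually s <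
  \<open>t n\<close>, and for all others the left-hand integrand vanishes.\<close>

lemma boundary_potential_lsc:
  fixes x :: "nat \<Rightarrow> real ^ 'n::finite"
  assumes [measurable]: "(\<lambda>(y, s). f y s) \<in> borel_measurable (boundary_measure k \<Otimes>\<^sub>M borel)"
    and fin: "\<And>y s. f y s < top"
    and lim: "x \<longlonglongrightarrow> a" "t \<longlonglongrightarrow> b"
  shows "boundary_potential k f a b \<le> liminf (\<lambda>n. boundary_potential k f (x n) (t n))"
proof -
  let ?F = "\<lambda>x t y s. ennreal (neumann_green k x (boundary_point k y) (t - s)) * f y s * indicator {0<..<t} s"
  let ?G = "\<lambda>x t s. \<integral>\<^sup>+ y. ?F x t y s \<partial>boundary_measure k"
  have eq: "boundary_potential k f x t = (\<integral>\<^sup>+ s. ?G x t s \<partial>lborel)" for x t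
    unfolding boundary_potential_def by (intro nn_integral_cong) (auto split: split_indicator)
  have meas: "(\<lambda>s. ?G x t s) \<in> borel_measurable lborel" for x t
  proof -
    have "?G x t = (\<lambda>s. \<integral>\<^sup>+ y. ennreal (neumann_green k x (boundary_point k y) (t - s)) * f y s *
        of_bool (0 < s \<and> s < t) \<partial>boundary_measure k)"
      by (auto simp: indicator_def fun_eq_iff intro!: nn_integral_cong)
    also have "\<dots> \<in> borel_measurable lborel"
      by measurable
    finally show ?thesis .
  qed
  have "?F a b y s \<le> liminf (\<lambda>n. ?F (x n) (t n) y s)" for y s
  proof (cases "0 < s \<and> s < b")
    case True
    then have "(\<lambda>n. f y s * ennreal (neumann_green k (x n) (boundary_point k y) (t n - s)))
        \<longlonglongrightarrow> f y s * ennreal (neumann_green k a (boundary_point k y) (b - s))"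
      using fin lim by (intro ennreal_tendsto_cmult tendsto_ennrealI neumann_green_tendsto tendsto_intros) auto
    moreover have "\<forall>\<^sub>F n in sequentially. s < t n"
      using lim True by (auto dest: order_tendstoD)
    then have "\<forall>\<^sub>F n in sequentially. f y s * ennreal (neumann_green k (x n) (boundary_point k y) (t n - s)) = ?F (x n) (t n) y s"
      by eventually_elim (use True in \<open>simp add: mult_ac\<close>)
    ultimately have "(\<lambda>n. ?F (x n) (t n) y s) \<longlonglongrightarrow> f y s * ennreal (neumann_green k a (boundary_point k y) (b - s))"
      by (rule Lim_transform_eventually)
    from lim_imp_Liminf[OF _ this] show ?thesis
      using True by (simp add: mult_ac)
  qed auto
  then have "boundary_potential k f a b \<le>
      (\<integral>\<^sup>+ s. \<integral>\<^sup>+ y. liminf (\<lambda>n. ?F (x n) (t n) y s) \<partial>boundary_measure k \<partial>lborel)"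
    unfolding eq by (intro nn_integral_mono)
  also have "\<dots> \<le> (\<integral>\<^sup>+ s. liminf (\<lambda>n. ?G (x n) (t n) s) \<partial>lborel)"
    by (intro nn_integral_mono nn_integral_liminf) measurable
  also have "\<dots> \<le> liminf (\<lambda>n. boundary_potential k f (x n) (t n))"
    unfolding eq by (intro nn_integral_liminf meas)
  finally show ?thesis .
qed

lemma liminf_add_le:
  fixes a b :: "nat \<Rightarrow> ennreal"
  shows "liminf a + liminf b \<le> liminf (\<lambda>n. a n + b n)"
proof -
  have "liminf a + liminf b = (SUP n. (INF m\<in>{n..}. a m) + (INF m\<in>{n..}. b m))"
    unfolding liminf_SUP_INF
    by (intro ennreal_SUP_add[symmetric]) (auto simp: incseq_def intro!: INF_superset_mono)
  also have "\<dots> \<le> liminf (\<lambda>n. a n + b n)"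
    unfolding liminf_SUP_INF
    by (intro SUP_mono bexI[OF _ UNIV_I] INF_greatest add_mono INF_lower) auto
  finally show ?thesis .
qed

text \<open>If a sum converges to a finite value and neither summand can fall below its value in the
  limit, then neither can rise above it: a rise of one would have to be compensated by a fall of the
  other.\<close>

lemma tendsto_of_lsc_add:
  fixes a b :: "nat \<Rightarrow> ennreal"
  assumes sum: "(\<lambda>n. a n + b n) \<longlonglongrightarrow> A + B" and fin: "A + B < top"
    and A: "A \<le> liminf a" and B: "B \<le> liminf b"
  shows "a \<longlonglongrightarrow> A"
proof (rule order_tendstoI)
  fix c assume "c < A"
  then show "\<forall>\<^sub>F n in sequentially. c < a n"
    using A by (intro less_LiminfD) auto
next
  fix c assume c: "A < c"
  obtain A' where A': "A = ennreal A'" "0 \<le> A'"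
    using fin by (cases A) auto
  obtain B' where B': "B = ennreal B'" "0 \<le> B'"
    using fin by (cases B) (auto simp: add_top)
  obtain c' where c': "A' < c'" "ennreal c' \<le> c"
  proof (cases c)
    case (real r)
    then show ?thesis
      using that[of r] c A' by (auto simp: ennreal_less_iff)
  next
    case top
    then show ?thesis
      using that[of "A' + 1"] by auto
  qed
  \<comment> \<open>Half of the gap: the sum exceeds its limit by less than e and b falls short by
    at most e, so a exceeds A by less than 2e.\<close>
  define e where "e = (c' - A') / 2"
  have e: "0 < e" "A' + e < c'"
    using c' by (auto simp: e_def field_simps)
  have "\<forall>\<^sub>F n in sequentially. a n + b n < ennreal (A' + B' + e)"
    using sum e A' B' by (intro order_tendstoD(2)[OF sum]) (auto simp: ennreal_plus[symmetric] ennreal_less_iff simp del: ennreal_plus)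
  \<comment> \<open>A negative B' - e is sent to 0 by \<open>ennreal\<close>, and 0 <
    \<open>b n\<close> may fail; but then B' - e is below every value of b anyway.\<close>
  moreover have "\<forall>\<^sub>F n in sequentially. B' - e < 0 \<or> ennreal (B' - e) < b n"
  proof (cases "B' - e < 0")
    case False
    then have "ennreal (B' - e) < B"
      using e B' by (auto simp: ennreal_less_iff)
    then show ?thesis
      using B by (intro eventually_mono[OF less_LiminfD[of "ennreal (B' - e)" sequentially b]]) auto
  qed auto
  ultimately show "\<forall>\<^sub>F n in sequentially. a n < c"
  proof eventually_elim
    case (elim n)
    obtain u where u: "a n = ennreal u" "0 \<le> u"
      using elim(1) by (cases "a n") auto
    obtain v where v: "b n = ennreal v" "0 \<le> v"
      using elim(1) by (cases "b n") (auto simp: add_top)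
    have "u + v < A' + B' + e"
      using elim(1) A' B' e by (simp add: u v ennreal_plus[symmetric] ennreal_less_iff del: ennreal_plus)
    moreover have "B' - e \<le> v"
      using elim(2) v by (cases "B' - e < 0") (auto simp: ennreal_less_iff not_less)
    moreover have "2 * e = c' - A'"
      by (simp add: e_def)
    ultimately have "u < c'"
      by linarith
    then show ?case
      using c' u by (metis ennreal_lessI less_le_trans le_less_trans)
  qed
qed

text \<open>Dominated convergence: the kernel is largest at distance 0, and all intervals lie in one
  bounded interval. The indicators may fail to converge only at the single point s = b.\<close>

lemma boundary_time_integral_tendsto:
  assumes "r \<longlonglongrightarrow> a" "t \<longlonglongrightarrow> b"
  shows "(\<lambda>n. \<integral>\<^sup>+ s\<in>{0<..<t n}. ennreal (2 * heat_kernel s (r n)) \<partial>lborel) \<longlonglongrightarrow>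
    (\<integral>\<^sup>+ s\<in>{0<..<b}. ennreal (2 * heat_kernel s a) \<partial>lborel)"
proof -
  obtain T where T: "\<And>n. t n \<le> T"
    using convergent_imp_bounded[OF assms(2)] by (auto simp: bounded_iff abs_le_iff)
  show ?thesis
  proof (rule nn_integral_dominated_convergence)
    let ?w = "\<lambda>s. ennreal (2 * heat_kernel s 0) * indicator {0<..<T} s"
    show "AE s in lborel. ennreal (2 * heat_kernel s (r n)) * indicator {0<..<t n} s \<le> ?w s" for n
      using T[of n] by (intro AE_I2)
        (auto split: split_indicator simp: heat_kernel_def intro!: ennreal_leI divide_right_mono)
    show "(\<integral>\<^sup>+ s. ?w s \<partial>lborel) < \<infinity>"
      by (rule boundary_time_integral_finite)
    show "AE s in lborel. (\<lambda>n. ennreal (2 * heat_kernel s (r n)) * indicator {0<..<t n} s) \<longlonglongrightarrow>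
        ennreal (2 * heat_kernel s a) * indicator {0<..<b} s"
    proof (rule eventually_mono[OF AE_lborel_singleton[of b]])
      fix s assume "s \<noteq> b"
      then consider "s < b" | "b < s"
        by linarith
      then have ev: "\<forall>\<^sub>F n in sequentially. (indicator {0<..<b} s :: ennreal) = indicator {0<..<t n} s"
      proof cases
        case 1
        then have "\<forall>\<^sub>F n in sequentially. s < t n"
          using assms by (auto dest: order_tendstoD)
        then show ?thesis
          by eventually_elim (use 1 in \<open>auto split: split_indicator\<close>)
      next
        case 2
        then have "\<forall>\<^sub>F n in sequentially. t n < s"
          using assms by (auto dest: order_tendstoD)
        then show ?thesis
          by eventually_elim (use 2 in \<open>auto split: split_indicator\<close>)
      qed
      show "(\<lambda>n. ennreal (2 * heat_kernel s (r n)) * indicator {0<..<t n} s) \<longlonglongrightarrow>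
        ennreal (2 * heat_kernel s a) * indicator {0<..<b} s"
      proof (cases "0 < s")
        case True
        have "(\<lambda>n. indicator {0<..<b} s * ennreal (2 * heat_kernel s (r n))) \<longlonglongrightarrow>
            indicator {0<..<b} s * ennreal (2 * heat_kernel s a)"
          unfolding heat_kernel_def using True assms
          by (intro ennreal_tendsto_cmult tendsto_ennrealI tendsto_intros) (auto split: split_indicator)
        then show ?thesis
          by (rule Lim_transform_eventually[where f = "\<lambda>n. indicator {0<..<b} s * ennreal (2 * heat_kernel s (r n))", THEN tendsto_eq_rhs])
            (use ev in \<open>auto elim!: eventually_mono simp: mult_ac\<close>)
      qed auto
    qed
  qed auto
qed

definition potential ::
    "'n::finite \<Rightarrow> (real ^ 'n \<Rightarrow> ennreal) \<Rightarrow> (('n \<Rightarrow> real) \<Rightarrow> real \<Rightarrow> ennreal) \<Rightarrow> real ^ 'n \<Rightarrow> real \<Rightarrow> ennreal" where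
  "potential k \<phi> f x t = heat_potential k \<phi> x t + boundary_potential k f x t"

lemma potential_mono:
  "(\<And>y s. 0 < s \<Longrightarrow> s < t \<Longrightarrow> f y s \<le> g y s) \<Longrightarrow> potential k \<phi> f x t \<le> potential k \<phi> g x t"
  unfolding potential_def by (intro add_left_mono boundary_potential_mono)

lemma potential_cong:
  "(\<And>y s. 0 < s \<Longrightarrow> s < t \<Longrightarrow> f y s = g y s) \<Longrightarrow> potential k \<phi> f x t = potential k \<phi> g x t"
  by (intro antisym potential_mono) auto

lemma potential_measurable [measurable]:
  assumes [measurable]: "\<phi> \<in> borel_measurable borel"
    "(\<lambda>(y, s). f y s) \<in> borel_measurable (boundary_measure k \<Otimes>\<^sub>M borel)"
  shows "(\<lambda>(x, t). potential k \<phi> f x t) \<in> borel_measurable (borel \<Otimes>\<^sub>M borel)"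
  unfolding potential_def
  using borel_measurable_add[OF heat_potential_measurable[OF assms(1)] boundary_potential_measurable[OF assms(2)]]
  by (simp add: case_prod_beta')

lemma potential_finite:
  assumes "\<And>y. y \<in> closure (halfspace k) \<Longrightarrow> \<phi> y \<le> ennreal K" "\<And>y s. 0 < s \<Longrightarrow> s < t \<Longrightarrow> f y s \<le> ennreal M" "0 < t"
  shows "potential k \<phi> f x t < top"
proof -
  have "potential k \<phi> f x t \<le> heat_potential k (\<lambda>_. ennreal K) x t + boundary_potential k (\<lambda>_ _. ennreal M) x t"
    unfolding potential_def by (intro add_mono heat_potential_mono boundary_potential_mono assms)
  also have "\<dots> < top"
    using assms(3) boundary_time_integral_finite
    by (simp add: heat_potential_const boundary_potential_const ennreal_mult_less_top)
  finally show ?thesis .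
qed

text \<open>Both the potential of bounded data and the potential of the complementary data are lower
  semicontinuous by Fatou's lemma, and their sum is the explicit potential of constant data.\<close>

lemma potential_tendsto:
  fixes x :: "nat \<Rightarrow> real ^ 'n::finite"
  assumes [measurable]: "\<phi> \<in> borel_measurable borel"
      "(\<lambda>(y, s). f y s) \<in> borel_measurable (boundary_measure k \<Otimes>\<^sub>M borel)"
    and le: "\<And>y. \<phi> y \<le> ennreal K" "\<And>y s. f y s \<le> ennreal M"
    and lim: "x \<longlonglongrightarrow> a" "t \<longlonglongrightarrow> b" "0 < b"
  shows "(\<lambda>n. potential k \<phi> f (x n) (t n)) \<longlonglongrightarrow> potential k \<phi> f a b"
proof -
  define \<eta> where "\<eta> = (\<lambda>y. ennreal K - \<phi> y)"
  define g where "g = (\<lambda>y s. ennreal M - f y s)"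
  have [measurable]: "\<eta> \<in> borel_measurable borel"
    unfolding \<eta>_def by measurable
  have [measurable]: "(\<lambda>(y, s). g y s) \<in> borel_measurable (boundary_measure k \<Otimes>\<^sub>M borel)"
    unfolding g_def by measurable
  have sum: "\<phi> y + \<eta> y = ennreal K" "f z s + g z s = ennreal M" for y z s
    using le by (auto simp: \<eta>_def g_def)
  have fin: "\<phi> y < top" "\<eta> y < top" "f z s < top" "g z s < top" for y z s
    using le_less_trans[OF le(1) ennreal_less_top] le_less_trans[OF le(2) ennreal_less_top]
    by (auto simp: \<eta>_def g_def diff_less_top_ennreal)
  have total: "potential k \<phi> f x t + potential k \<eta> g x t =
      ennreal K + ennreal M * (\<integral>\<^sup>+ s\<in>{0<..<t}. ennreal (2 * heat_kernel s (x $ k)) \<partial>lborel)" if "0 < t" for x t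
  proof -
    have "potential k \<phi> f x t + potential k \<eta> g x t =
        heat_potential k (\<lambda>y. \<phi> y + \<eta> y) x t + boundary_potential k (\<lambda>y s. f y s + g y s) x t"
      unfolding potential_def by (simp add: heat_potential_add boundary_potential_add add_ac)
    then show ?thesis
      by (simp add: sum heat_potential_const[OF that] boundary_potential_const)
  qed
  have lsc: "potential k \<phi>' f' a b \<le> liminf (\<lambda>n. potential k \<phi>' f' (x n) (t n))"
    if [measurable]: "\<phi>' \<in> borel_measurable borel"
      "(\<lambda>(y, s). f' y s) \<in> borel_measurable (boundary_measure k \<Otimes>\<^sub>M borel)"
      and "\<And>y. \<phi>' y < top" "\<And>y s. f' y s < top" for \<phi>' f'
  proof -
    have "potential k \<phi>' f' a b \<le> liminf (\<lambda>n. heat_potential k \<phi>' (x n) (t n)) +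
        liminf (\<lambda>n. boundary_potential k f' (x n) (t n))"
      unfolding potential_def using that lim
      by (intro add_mono heat_potential_lsc boundary_potential_lsc) auto
    also have "\<dots> \<le> liminf (\<lambda>n. potential k \<phi>' f' (x n) (t n))"
      unfolding potential_def by (rule liminf_add_le)
    finally show ?thesis .
  qed
  show ?thesis
  proof (rule tendsto_of_lsc_add)
    show "potential k \<phi> f a b \<le> liminf (\<lambda>n. potential k \<phi> f (x n) (t n))"
      by (rule lsc) (use fin in auto)
    show "potential k \<eta> g a b \<le> liminf (\<lambda>n. potential k \<eta> g (x n) (t n))"
      by (rule lsc) (use fin in auto)
    show "potential k \<phi> f a b + potential k \<eta> g a b < top"
      using boundary_time_integral_finite by (simp add: total lim ennreal_mult_less_top)
    have "(\<lambda>n. ennreal K + ennreal M * (\<integral>\<^sup>+ s\<in>{0<..<t n}. ennreal (2 * heat_kernel s (x n $ k)) \<partial>lborel)) \<longlonglongrightarrow>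
        ennreal K + ennreal M * (\<integral>\<^sup>+ s\<in>{0<..<b}. ennreal (2 * heat_kernel s (a $ k)) \<partial>lborel)"
      using lim by (intro tendsto_add tendsto_const ennreal_tendsto_cmult boundary_time_integral_tendsto tendsto_vec_nth) auto
    moreover have "\<forall>\<^sub>F n in sequentially. 0 < t n"
      using lim by (auto dest: order_tendstoD)
    then have "\<forall>\<^sub>F n in sequentially. ennreal K + ennreal M * (\<integral>\<^sup>+ s\<in>{0<..<t n}. ennreal (2 * heat_kernel s (x n $ k)) \<partial>lborel) =
        potential k \<phi> f (x n) (t n) + potential k \<eta> g (x n) (t n)"
      by eventually_elim (simp add: total)
    ultimately show "(\<lambda>n. potential k \<phi> f (x n) (t n) + potential k \<eta> g (x n) (t n)) \<longlonglongrightarrow>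
        potential k \<phi> f a b + potential k \<eta> g a b"
      unfolding total[OF lim(3)] by (rule Lim_transform_eventually)
  qed
qed

section \<open>Existence below a supersolution\<close>

lemma solution_on_integral_equation:
  "solution_on J k p \<phi> u \<Longrightarrow> x \<in> closure (halfspace k) \<Longrightarrow> t \<in> J \<Longrightarrow>
    ennreal (u x t) = potential k (\<lambda>y. ennreal (\<phi> y)) (\<lambda>y s. ennreal (u (boundary_point k y) s powr p)) x t"
  by (simp add: solution_on_def integral_equation_iff potential_def)

text \<open>The right-hand side of the equation sees boundary values only, so the iterates live on
  the boundary. They are set to 0 outside J, which makes measurability and the bound by M hold for
  all times.\<close>

fun picard_iterate :: "real set \<Rightarrow> 'n::finite \<Rightarrow> real \<Rightarrow> (real ^ 'n \<Rightarrow> real) \<Rightarrow> nat \<Rightarrow> ('n \<Rightarrow> real) \<Rightarrow> real \<Rightarrow> real" where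
  "picard_iterate J k p \<phi> 0 y t = 0"
| "picard_iterate J k p \<phi> (Suc n) y t =
    indicator J t * enn2real (potential k (\<lambda>y. ennreal (\<phi> y))
      (\<lambda>y s. ennreal (picard_iterate J k p \<phi> n y s powr p)) (boundary_point k y) t)"

declare picard_iterate.simps(2) [simp del]

lemma picard_iterate_nonneg: "0 \<le> picard_iterate J k p \<phi> n y t"
  by (cases n) (auto simp: picard_iterate.simps(2))

lemma picard_iterate_outside: "t \<notin> J \<Longrightarrow> picard_iterate J k p \<phi> n y t = 0"
  by (cases n) (auto simp: picard_iterate.simps(2))

lemma picard_iterate_measurable [measurable]:
  assumes [measurable]: "J \<in> sets borel" "\<phi> \<in> borel_measurable borel"
  shows "(\<lambda>(y, t). picard_iterate J k p \<phi> n y t) \<in> borel_measurable (boundary_measure k \<Otimes>\<^sub>M borel)"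
proof (induction n)
  case (Suc n)
  note [measurable] = Suc
  let ?P = "\<lambda>(x, t). potential k (\<lambda>y. ennreal (\<phi> y)) (\<lambda>y s. ennreal (picard_iterate J k p \<phi> n y s powr p)) x t"
  have [measurable]: "?P \<in> borel_measurable (borel \<Otimes>\<^sub>M borel)"
    by measurable
  have "(\<lambda>z. ?P (boundary_point k (fst z), snd z)) \<in> borel_measurable (boundary_measure k \<Otimes>\<^sub>M borel)"
    by measurable
  then have [measurable]: "(\<lambda>z. potential k (\<lambda>y. ennreal (\<phi> y)) (\<lambda>y s. ennreal (picard_iterate J k p \<phi> n y s powr p))
      (boundary_point k (fst z)) (snd z)) \<in> borel_measurable (boundary_measure k \<Otimes>\<^sub>M borel)"
    by simp
  show ?case
    by (simp add: case_prod_beta' picard_iterate.simps(2))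
qed (simp add: case_prod_beta')

text \<open>Monotone convergence, first along the boundary and then in time.\<close>

lemma potential_SUP:
  assumes [measurable]: "\<And>n. (\<lambda>(y, s). f n y s) \<in> borel_measurable (boundary_measure k \<Otimes>\<^sub>M borel)"
    and mono: "\<And>y s. incseq (\<lambda>n. f n y s)"
  shows "potential k \<phi> (\<lambda>y s. SUP n. f n y s) x t = (SUP n. potential k \<phi> (f n) x t)"
proof -
  let ?g = "\<lambda>n s. \<integral>\<^sup>+ y. ennreal (neumann_green k x (boundary_point k y) (t - s)) * f n y s \<partial>boundary_measure k"
  have 1: "(\<integral>\<^sup>+ y. ennreal (neumann_green k x (boundary_point k y) (t - s)) * (SUP n. f n y s)
      \<partial>boundary_measure k) = (SUP n. ?g n s)" for s
  proof -
    have "(\<integral>\<^sup>+ y. ennreal (neumann_green k x (boundary_point k y) (t - s)) * (SUP n. f n y s) \<partial>boundary_measure k) =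
        (\<integral>\<^sup>+ y. (SUP n. ennreal (neumann_green k x (boundary_point k y) (t - s)) * f n y s) \<partial>boundary_measure k)"
      by (simp add: SUP_mult_left_ennreal)
    also have "\<dots> = (SUP n. ?g n s)"
      using mono by (intro nn_integral_monotone_convergence_SUP)
        (auto simp: incseq_def le_fun_def intro!: mult_left_mono)
    finally show ?thesis .
  qed
  have g_mono: "?g m s \<le> ?g n s" if "m \<le> n" for m n s
    using mono that by (intro nn_integral_mono mult_left_mono) (auto simp: incseq_def)
  have "boundary_potential k (\<lambda>y s. SUP n. f n y s) x t = (\<integral>\<^sup>+ s. (SUP n. ?g n s * indicator {0<..<t} s) \<partial>lborel)"
    unfolding boundary_potential_def 1 by (simp add: SUP_mult_right_ennreal)
  also have "\<dots> = (SUP n. boundary_potential k (f n) x t)"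
    unfolding boundary_potential_def using g_mono
    by (intro nn_integral_monotone_convergence_SUP)
      (auto simp: incseq_def le_fun_def intro!: mult_right_mono)
  finally show ?thesis
    unfolding potential_def by (simp add: ennreal_SUP_add_right)
qed

text \<open>Starting from 0 the iterates increase, and monotonicity of the potential keeps them
  below V. The same induction keeps them below every solution w, so their limit is minimal. V is
  tested at boundary points only; the interior values of u are then defined by the integral equation
  itself.\<close>

theorem minimal_solution_below_supersolution:
  fixes k :: "'n::finite" and \<phi> :: "real ^ 'n \<Rightarrow> real"
  assumes p: "0 < p"
    and J: "J \<in> sets borel" "J \<subseteq> {0<..}" "\<And>s t. t \<in> J \<Longrightarrow> 0 < s \<Longrightarrow> s < t \<Longrightarrow> s \<in> J"
    and \<phi>: "\<phi> \<in> borel_measurable borel" "\<And>y. 0 \<le> \<phi> y" "\<And>y. \<phi> y \<le> K"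
    and V: "\<And>y t. t \<in> J \<Longrightarrow> 0 \<le> V y t" "\<And>y t. t \<in> J \<Longrightarrow> V y t \<le> M"
    and super: "\<And>y t. t \<in> J \<Longrightarrow> potential k (\<lambda>y. ennreal (\<phi> y)) (\<lambda>y s. ennreal (V y s powr p)) (boundary_point k y) t \<le> ennreal (V y t)"
  obtains u where "solution_on J k p \<phi> u"
    "\<And>w x t. solution_on J k p \<phi> w \<Longrightarrow> x \<in> closure (halfspace k) \<Longrightarrow> t \<in> J \<Longrightarrow> u x t \<le> w x t"
proof (cases "J = {}")
  \<comment> \<open>For empty J there is no point at which V could witness that M is nonnegative,
    and nothing is demanded of u.\<close>
  case True
  have "\<phi> \<in> borel_measurable (restrict_space lebesgue (halfspace k))"
    using \<phi>(1) by (intro measurable_restrict_space1 measurable_completion) simp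
  then have "solution_on J k p \<phi> (\<lambda>_ _. 0)"
    using True \<phi>(2) by (simp add: solution_on_def)
  then show ?thesis
    using that True by auto
next
  case False
  note [measurable] = J(1) \<phi>(1)
  let ?\<phi> = "\<lambda>y. ennreal (\<phi> y)"
  let ?f = "picard_iterate J k p \<phi>"
  have M: "0 \<le> M"
    using False V by (metis ex_in_conv order_trans)
  have f0: "0 \<le> ?f n y t" for n y t
    by (rule picard_iterate_nonneg)
  have f_V: "?f n y t \<le> V y t" if "t \<in> J" for n y t
    using that
  proof (induction n arbitrary: y t)
    case 0
    then show ?case using V by simp
  next
    case (Suc n)
    have "potential k ?\<phi> (\<lambda>y s. ennreal (?f n y s powr p)) (boundary_point k y) t \<le>
        potential k ?\<phi> (\<lambda>y s. ennreal (V y s powr p)) (boundary_point k y) t"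
      using Suc J(3) p f0 by (intro potential_mono ennreal_leI powr_mono2) auto
    also have "\<dots> \<le> ennreal (V y t)"
      using super Suc by simp
    finally show ?case
      using Suc.prems V by (simp add: enn2real_leI picard_iterate.simps(2))
  qed
  have f_M: "?f n y t \<le> M" for n y t
    using f_V[of t n y] V M by (cases "t \<in> J") (auto simp: picard_iterate_outside intro: order_trans)
  have fin: "potential k ?\<phi> (\<lambda>y s. ennreal (?f n y s powr p)) x t < top" if "t \<in> J" for n x t
    using that J \<phi> f_M f0 p
    by (intro potential_finite[where K = K and M = "M powr p"] ennreal_leI powr_mono2) auto
  have f_Suc: "ennreal (?f (Suc n) y t) = potential k ?\<phi> (\<lambda>y s. ennreal (?f n y s powr p)) (boundary_point k y) t"
    if "t \<in> J" for n y t
    using fin[OF that] that by (simp add: picard_iterate.simps(2))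
  have f_mono1: "?f n y t \<le> ?f (Suc n) y t" for n y t
  proof (induction n arbitrary: y t)
    case 0
    then show ?case by (simp add: f0)
  next
    case (Suc n)
    show ?case
    proof (cases "t \<in> J")
      case True
      have "ennreal (?f (Suc n) y t) \<le> ennreal (?f (Suc (Suc n)) y t)"
        unfolding f_Suc[OF True] using Suc f0 p
        by (intro potential_mono ennreal_leI powr_mono2) auto
      then show ?thesis
        using f0 by (subst (asm) ennreal_le_iff) auto
    qed (simp add: picard_iterate_outside)
  qed
  then have f_inc: "incseq (\<lambda>n. ?f n y t)" for y t
    by (rule incseq_SucI)
  define F where "F = (\<lambda>y t. SUP n. ?f n y t)"
  have lim: "(\<lambda>n. ?f n y t) \<longlonglongrightarrow> F y t" for y t
    unfolding F_def using f_M f_inc by (intro LIMSEQ_incseq_SUP bdd_aboveI) auto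
  have F0: "0 \<le> F y t" for y t
    by (rule LIMSEQ_le_const[OF lim]) (use f0 in auto)
  have FM: "F y t \<le> M" for y t
    by (rule LIMSEQ_le_const2[OF lim]) (use f_M in auto)
  have lim_p: "(\<lambda>n. ?f n y t powr p) \<longlonglongrightarrow> F y t powr p" for y t
    using lim f0 p by (intro tendsto_powr') auto
  have inc_p: "incseq (\<lambda>n. ennreal (?f n y t powr p))" for y t
    using f_inc[of y t] f0 p by (auto simp: incseq_def intro!: ennreal_leI powr_mono2)
  \<comment> \<open>The limit is formed in the reals, but monotone convergence speaks about suprema
    in \<open>ennreal\<close>; this identifies the two.\<close>
  have F_SUP: "ennreal (F y t powr p) = (SUP n. ennreal (?f n y t powr p))" for y t
    using LIMSEQ_SUP[OF inc_p] lim_p by (intro LIMSEQ_unique[OF tendsto_ennrealI])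
  have meas_p [measurable]: "(\<lambda>(y, s). ennreal (?f n y s powr p)) \<in> borel_measurable (boundary_measure k \<Otimes>\<^sub>M borel)" for n
    by measurable
  have [measurable]: "(\<lambda>(y, s). ennreal (F y s powr p)) \<in> borel_measurable (boundary_measure k \<Otimes>\<^sub>M borel)"
    unfolding F_SUP by measurable
  define P where "P = potential k ?\<phi> (\<lambda>y s. ennreal (F y s powr p))"
  have P_SUP: "P x t = (SUP n. potential k ?\<phi> (\<lambda>y s. ennreal (?f n y s powr p)) x t)" for x t
    unfolding P_def F_SUP using inc_p by (intro potential_SUP) auto
  have P_fin: "P x t < top" if "t \<in> J" for x t
    unfolding P_def using that J \<phi> F0 FM p
    by (intro potential_finite[where K = K and M = "M powr p"] ennreal_leI powr_mono2) auto
  have P_F: "P (boundary_point k y) t = ennreal (F y t)" if "t \<in> J" for y t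
  proof -
    have "(\<lambda>n. potential k ?\<phi> (\<lambda>y s. ennreal (?f n y s powr p)) (boundary_point k y) t) \<longlonglongrightarrow> ennreal (F y t)"
      unfolding f_Suc[OF that, symmetric] using lim by (intro tendsto_ennrealI LIMSEQ_Suc)
    moreover have "(\<lambda>n. potential k ?\<phi> (\<lambda>y s. ennreal (?f n y s powr p)) (boundary_point k y) t) \<longlonglongrightarrow> P (boundary_point k y) t"
      unfolding P_SUP using f_inc[of y t] f0
      by (intro LIMSEQ_SUP) (auto simp: incseq_def f_Suc[OF that, symmetric] intro!: ennreal_leI)
    ultimately show ?thesis
      \<comment> \<open>The same sequence is the shifted sequence of iterates and an increasing
        sequence of potentials, so F solves the equation on the boundary.\<close>
      by (rule LIMSEQ_unique[symmetric])
  qed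
  define u where "u = (\<lambda>x t. enn2real (P x t))"
  have u_P: "ennreal (u x t) = P x t" if "t \<in> J" for x t
    unfolding u_def using P_fin[OF that] by simp
  have u_F: "u (boundary_point k y) t = F y t" if "t \<in> J" for y t
    unfolding u_def using P_F[OF that] F0 by simp
  show ?thesis
  proof
    show "solution_on J k p \<phi> u"
      unfolding solution_on_def
    proof (intro conjI ballI)
      show "\<phi> \<in> borel_measurable (restrict_space lebesgue (halfspace k))"
        by (intro measurable_restrict_space1 measurable_completion) simp
      show "0 \<le> \<phi> y" for y
        by (rule \<phi>)
      show "continuous_on (closure (halfspace k) \<times> J) (\<lambda>(x, t). u x t)"
      proof (rule continuous_on_sequentiallyI)
        fix z :: "nat \<Rightarrow> (real ^ 'n) \<times> real" and a
        assume z: "\<forall>n. z n \<in> closure (halfspace k) \<times> J" "a \<in> closure (halfspace k) \<times> J" "z \<longlonglongrightarrow> a"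
        have "(\<lambda>n. P (fst (z n)) (snd (z n))) \<longlonglongrightarrow> P (fst a) (snd a)"
          unfolding P_def
        proof (rule potential_tendsto)
          show "?\<phi> y \<le> ennreal K" for y
            using \<phi> by (intro ennreal_leI)
          show "ennreal (F y s powr p) \<le> ennreal (M powr p)" for y s
            using F0 FM p by (intro ennreal_leI powr_mono2) auto
          show "0 < snd a"
            using z(2) J(2) by auto
        qed (use z in \<open>auto intro: tendsto_fst tendsto_snd\<close>)
        then have "(\<lambda>n. ennreal (u (fst (z n)) (snd (z n)))) \<longlonglongrightarrow> ennreal (u (fst a) (snd a))"
          using z by (subst (asm) (1 2) u_P[symmetric]) (auto simp: mem_Times_iff)
        then show "(\<lambda>n. case z n of (x, t) \<Rightarrow> u x t) \<longlonglongrightarrow> (case a of (x, t) \<Rightarrow> u x t)"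
          by (simp add: case_prod_beta' u_def)
      qed
      fix x t assume "t \<in> J"
      then show "0 \<le> u x t"
        by (simp add: u_def)
      show "integral_equation k p \<phi> u x t"
        unfolding integral_equation_iff u_P[OF \<open>t \<in> J\<close>] potential_def[symmetric] P_def
        using u_F J(3) \<open>t \<in> J\<close> by (intro potential_cong) auto
    qed
    fix w x t
    assume w: "solution_on J k p \<phi> w" and x: "x \<in> closure (halfspace k)" and t: "t \<in> J"
    have w0: "0 \<le> w x t" if "x \<in> closure (halfspace k)" "t \<in> J" for x t
      using w that by (simp add: solution_on_def)
    have f_w: "?f n y s \<le> w (boundary_point k y) s" if "s \<in> J" for n y s
      using that
    proof (induction n arbitrary: y s)
      case 0
      then show ?case using w0 by simp
    next
      case (Suc n)
      have "ennreal (?f (Suc n) y s) \<le> ennreal (w (boundary_point k y) s)"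
        unfolding f_Suc[OF Suc.prems] solution_on_integral_equation[OF w boundary_point_in Suc.prems]
        using Suc J(3) f0 p by (intro potential_mono ennreal_leI powr_mono2) auto
      then show ?case
        using w0[OF boundary_point_in Suc.prems] by (subst (asm) ennreal_le_iff) auto
    qed
    have "P x t \<le> ennreal (w x t)"
      unfolding solution_on_integral_equation[OF w x t] P_SUP
      using f_w J(3) f0 p t by (intro SUP_least potential_mono ennreal_leI powr_mono2) auto
    then show "u x t \<le> w x t"
      using w0[OF x t] t by (simp add: u_P[symmetric])
  qed
qed

section \<open>Supersolutions from powers of the heat flow\<close>

lemma powr_ge_tangent:
  fixes a b \<alpha> :: real
  assumes "1 \<le> \<alpha>" "0 \<le> a" "0 < b"
  shows "\<alpha> * b powr (\<alpha> - 1) * a \<le> a powr \<alpha> + (\<alpha> - 1) * b powr \<alpha>"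
proof (cases "a = 0")
  case False
  \<comment> \<open>The graph of a convex power lies above its tangent at b. The statement is
    arranged so that all terms are nonnegative and the inequality can be integrated in
    \<open>ennreal\<close>.\<close>
  have "(\<alpha> * b powr (\<alpha> - 1)) * (a - b) \<le> a powr \<alpha> - b powr \<alpha>"
  proof (rule convex_on_imp_above_tangent[OF powr_convex[OF assms(1)]])
    show "((\<lambda>x. x powr \<alpha>) has_field_derivative \<alpha> * b powr (\<alpha> - 1)) (at b within {0<..})"
      using assms by (intro DERIV_subset[OF has_real_derivative_powr]) auto
  qed (use assms False in \<open>auto simp: interior_open\<close>)
  moreover have "b powr (\<alpha> - 1) * b = b powr \<alpha>"
    using assms by (simp add: powr_diff)
  ultimately show ?thesis
    by (simp add: algebra_simps)
qed (use assms in auto)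

text \<open>Jensen's inequality for the probability kernel: the tangent inequality is integrated
  with the point of tangency b equal to the potential itself.\<close>

lemma heat_potential_jensen:
  assumes [measurable]: "\<phi> \<in> borel_measurable borel"
    and \<phi>: "\<And>y. 0 \<le> \<phi> y" "\<And>y. \<phi> y \<le> K" and \<alpha>: "1 \<le> \<alpha>" and t: "0 < t"
  shows "heat_potential k (\<lambda>y. ennreal (\<phi> y)) x t \<le>
    ennreal (enn2real (heat_potential k (\<lambda>y. ennreal (\<phi> y powr \<alpha>)) x t) powr (1 / \<alpha>))"
proof -
  let ?H = "heat_potential k (\<lambda>y. ennreal (\<phi> y)) x t"
  let ?W = "heat_potential k (\<lambda>y. ennreal (\<phi> y powr \<alpha>)) x t"
  have fin: "heat_potential k (\<lambda>y. ennreal (f y)) x t < top" if "\<And>y. f y \<le> C" for f C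
  proof -
    have "heat_potential k (\<lambda>y. ennreal (f y)) x t \<le> heat_potential k (\<lambda>_. ennreal C) x t"
      using that by (intro heat_potential_mono ennreal_leI)
    then show ?thesis
      using t by (auto simp: heat_potential_const intro: le_less_trans)
  qed
  obtain b where b: "?H = ennreal b" "0 \<le> b"
    using fin[of \<phi> K] \<phi> by (cases ?H) auto
  have "\<phi> y powr \<alpha> \<le> K powr \<alpha>" for y
    using \<phi> \<alpha> by (intro powr_mono2) auto
  from fin[of "\<lambda>y. \<phi> y powr \<alpha>", OF this] obtain w where w: "?W = ennreal w" "0 \<le> w"
    by (cases ?W) auto
  have "b \<le> w powr (1 / \<alpha>)"
  proof (cases "b = 0")
    case False
    with b have b0: "0 < b" by simp
    have cmult: "heat_potential k (\<lambda>y. ennreal c * ennreal (\<phi> y)) x t = ennreal c * ?H" for c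
      unfolding heat_potential_def
      by (subst nn_integral_cmult[symmetric]) (auto simp: mult_ac)
    have "ennreal (\<alpha> * b powr (\<alpha> - 1)) * ?H = heat_potential k (\<lambda>y. ennreal (\<alpha> * b powr (\<alpha> - 1)) * ennreal (\<phi> y)) x t"
      by (simp add: cmult)
    also have "\<dots> \<le> heat_potential k (\<lambda>y. ennreal (\<phi> y powr \<alpha>) + ennreal ((\<alpha> - 1) * b powr \<alpha>)) x t"
      using powr_ge_tangent[OF \<alpha> \<phi>(1) b0] \<phi> \<alpha> b0
      by (intro heat_potential_mono) (simp add: ennreal_mult'[symmetric] ennreal_plus[symmetric] ennreal_leI del: ennreal_plus)
    also have "\<dots> = ?W + ennreal ((\<alpha> - 1) * b powr \<alpha>)"
      by (subst heat_potential_add) (auto simp: heat_potential_const[OF t])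
    finally have "\<alpha> * b powr (\<alpha> - 1) * b \<le> w + (\<alpha> - 1) * b powr \<alpha>"
      using w b \<alpha> by (simp add: ennreal_mult'[symmetric] ennreal_plus[symmetric] ennreal_le_iff del: ennreal_plus)
    moreover have "b powr (\<alpha> - 1) * b = b powr \<alpha>"
      using b0 by (simp add: powr_diff)
    ultimately have "b powr \<alpha> \<le> w"
      by (simp add: algebra_simps)
    then have "(b powr \<alpha>) powr (1 / \<alpha>) \<le> w powr (1 / \<alpha>)"
      using \<alpha> by (intro powr_mono2) auto
    then show ?thesis
      using \<alpha> b0 by (simp add: powr_powr)
  qed simp
  then show ?thesis
    using b w by (simp add: ennreal_leI)
qed

text \<open>The tangential factors compose exactly, so that only the normal factors at the times \<open>s\<close> and
  \<open>t\<close> have to be compared.\<close>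

lemma tangential_flow_heat_potential:
  assumes [measurable]: "\<eta> \<in> borel_measurable borel" and st: "0 < s" "s < t"
  shows "(\<integral>\<^sup>+ z. ennreal (tangential_kernel k (t - s) (boundary_point k y) (boundary_point k z)) *
      heat_potential k \<eta> (boundary_point k z) s \<partial>boundary_measure k) \<le>
    ennreal (sqrt (t / s)) * heat_potential k \<eta> (boundary_point k y) t"
proof -
  interpret pair: pair_sigma_finite "boundary_measure k" "lborel :: (real ^ 'a) measure"
    by unfold_locales
  let ?D = "closure (halfspace k)"
  let ?T = "\<lambda>z. tangential_kernel k (t - s) (boundary_point k y) (boundary_point k z)"
  have "(\<integral>\<^sup>+ z. ennreal (?T z) * heat_potential k \<eta> (boundary_point k z) s \<partial>boundary_measure k) =
      (\<integral>\<^sup>+ z. \<integral>\<^sup>+ v. ennreal (?T z) * (ennreal (neumann_green k (boundary_point k z) v s) * \<eta> v * indicator ?D v)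
        \<partial>lborel \<partial>boundary_measure k)"
    unfolding heat_potential_def by (intro nn_integral_cong nn_integral_cmult[symmetric]) auto
  also have "\<dots> = (\<integral>\<^sup>+ v. \<integral>\<^sup>+ z. ennreal (?T z) * (ennreal (neumann_green k (boundary_point k z) v s) * \<eta> v * indicator ?D v)
        \<partial>boundary_measure k \<partial>lborel)"
    by (rule pair.Fubini'[symmetric]) measurable
  also have "\<dots> \<le> (\<integral>\<^sup>+ v. ennreal (sqrt (t / s)) *
      (ennreal (neumann_green k (boundary_point k y) v t) * \<eta> v * indicator ?D v) \<partial>lborel)"
  proof (intro nn_integral_mono)
    fix v :: "real ^ 'a"
    have "(\<integral>\<^sup>+ z. ennreal (?T z) * (ennreal (neumann_green k (boundary_point k z) v s) * \<eta> v * indicator ?D v) \<partial>boundary_measure k) =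
        (\<integral>\<^sup>+ z. (ennreal (2 * heat_kernel s (v $ k)) * \<eta> v * indicator ?D v) *
          ennreal (?T z * tangential_kernel k s (boundary_point k z) v) \<partial>boundary_measure k)"
      using st by (intro nn_integral_cong) (simp add: neumann_green_eq ennreal_mult' mult_ac)
    also have "\<dots> = (ennreal (2 * heat_kernel s (v $ k)) * \<eta> v * indicator ?D v) *
        ennreal (tangential_kernel k t (boundary_point k y) v)"
      using st by (subst nn_integral_cmult) (auto simp: tangential_kernel_convolution)
    also have "\<dots> \<le> (ennreal (2 * (sqrt (t / s) * heat_kernel t (v $ k))) * \<eta> v * indicator ?D v) *
        ennreal (tangential_kernel k t (boundary_point k y) v)"
    proof (intro mult_right_mono ennreal_leI mult_left_mono)
      \<comment> \<open>As s < t, the exponential only grows from time s to time t; the quotient of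
        the prefactors is the factor \<open>sqrt (t / s)\<close>.\<close>
      have "exp (- (v $ k)\<^sup>2 / (4 * s)) \<le> exp (- (v $ k)\<^sup>2 / (4 * t))"
        using st by (simp add: divide_left_mono)
      then have "heat_kernel s (v $ k) \<le> exp (- (v $ k)\<^sup>2 / (4 * t)) / sqrt (4 * pi * s)"
        using st unfolding heat_kernel_def by (intro divide_right_mono) auto
      also have "\<dots> = sqrt (t / s) * heat_kernel t (v $ k)"
        using st by (simp add: heat_kernel_def real_sqrt_mult real_sqrt_divide)
      finally show "heat_kernel s (v $ k) \<le> sqrt (t / s) * heat_kernel t (v $ k)" .
    qed auto
    also have "\<dots> = ennreal (sqrt (t / s)) * (ennreal (neumann_green k (boundary_point k y) v t) * \<eta> v * indicator ?D v)"
      using st by (simp add: neumann_green_eq ennreal_mult' mult_ac)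
    finally show "(\<integral>\<^sup>+ z. ennreal (?T z) * (ennreal (neumann_green k (boundary_point k z) v s) * \<eta> v * indicator ?D v) \<partial>boundary_measure k)
      \<le> ennreal (sqrt (t / s)) * (ennreal (neumann_green k (boundary_point k y) v t) * \<eta> v * indicator ?D v)" .
  qed
  also have "\<dots> = ennreal (sqrt (t / s)) * heat_potential k \<eta> (boundary_point k y) t"
    unfolding heat_potential_def by (intro nn_integral_cmult) auto
  finally show ?thesis .
qed

text \<open>Chebyshev's rearrangement: pairing \<open>s\<close> with \<open>t - s\<close>.\<close>

lemma nn_integral_convolution_antimono:
  fixes f g :: "real \<Rightarrow> real"
  assumes [measurable]: "f \<in> borel_measurable borel" "g \<in> borel_measurable borel"
    and f: "\<And>s s'. 0 < s \<Longrightarrow> s \<le> s' \<Longrightarrow> f s' \<le> f s" "\<And>s. 0 < s \<Longrightarrow> 0 \<le> f s"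
    and g: "\<And>s s'. 0 < s \<Longrightarrow> s \<le> s' \<Longrightarrow> g s' \<le> g s" "\<And>s. 0 < s \<Longrightarrow> 0 \<le> g s"
  shows "(\<integral>\<^sup>+ s\<in>{0<..<t}. ennreal (f (t - s) * g s) \<partial>lborel) \<le> (\<integral>\<^sup>+ s\<in>{0<..<t}. ennreal (f s * g s) \<partial>lborel)"
proof -
  let ?L = "\<integral>\<^sup>+ s\<in>{0<..<t}. ennreal (f (t - s) * g s) \<partial>lborel"
  let ?R = "\<integral>\<^sup>+ s\<in>{0<..<t}. ennreal (f s * g s) \<partial>lborel"
  have L: "?L = (\<integral>\<^sup>+ s\<in>{0<..<t}. ennreal (f s * g (t - s)) \<partial>lborel)"
    using nn_integral_reflect_interval[of "\<lambda>s. ennreal (f s * g (t - s))" t] by simp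
  have R: "?R = (\<integral>\<^sup>+ s\<in>{0<..<t}. ennreal (f (t - s) * g (t - s)) \<partial>lborel)"
    by (rule nn_integral_reflect_interval[symmetric]) auto
  have "?L + ?L = (\<integral>\<^sup>+ s\<in>{0<..<t}. (ennreal (f (t - s) * g s) + ennreal (f s * g (t - s))) \<partial>lborel)"
    by (subst (2) L, subst nn_integral_add[symmetric]) (auto simp: distrib_right)
  also have "\<dots> \<le> (\<integral>\<^sup>+ s\<in>{0<..<t}. (ennreal (f s * g s) + ennreal (f (t - s) * g (t - s))) \<partial>lborel)"
  proof (intro nn_integral_mono)
    fix s
    have "f (t - s) * g s + f s * g (t - s) \<le> f s * g s + f (t - s) * g (t - s)" if "0 < s" "s < t"
    proof -
      \<comment> \<open>Both functions are nonincreasing, so the two differences have the same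
        sign.\<close>
      have "0 \<le> (f s - f (t - s)) * (g s - g (t - s))"
        using f(1)[of s "t - s"] f(1)[of "t - s" s] g(1)[of s "t - s"] g(1)[of "t - s" s] that
        by (cases "s \<le> t - s") (auto intro!: mult_nonneg_nonneg mult_nonpos_nonpos)
      then show ?thesis
        by (simp add: algebra_simps)
    qed
    then show "(ennreal (f (t - s) * g s) + ennreal (f s * g (t - s))) * indicator {0<..<t} s \<le>
        (ennreal (f s * g s) + ennreal (f (t - s) * g (t - s))) * indicator {0<..<t} s"
      using f(2) g(2) by (auto split: split_indicator simp: ennreal_plus[symmetric] simp del: ennreal_plus intro!: ennreal_leI)
  qed
  also have "\<dots> = ?R + ?R"
    by (subst (2) R, subst nn_integral_add[symmetric]) (auto simp: distrib_right)
  finally have "2 * ?L \<le> 2 * ?R"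
    by (simp add: mult_2)
  then show ?thesis
    by (subst (asm) ennreal_mult_le_mult_iff) auto
qed

text \<open>The normal kernel contributes at most \<open>(t - s) powr (- 1 / 2)\<close> and the
  tangential flow \<open>sqrt (t / s)\<close>. Their product is the root of 1/s + 1/(t - s), hence
  at most the sum of the two roots; Chebyshev's inequality bounds the integral with t - s by the one
  with s, which accounts for the factor 2.\<close>

lemma boundary_potential_heat_potential:
  assumes [measurable]: "\<eta> \<in> borel_measurable borel" "g \<in> borel_measurable borel"
    and g: "\<And>s s'. 0 < s \<Longrightarrow> s \<le> s' \<Longrightarrow> g s' \<le> g s" "\<And>s. 0 < s \<Longrightarrow> 0 \<le> g s"
  shows "boundary_potential k (\<lambda>y s. ennreal (g s) * heat_potential k \<eta> (boundary_point k y) s) (boundary_point k y) t \<le>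
    2 * (\<integral>\<^sup>+ s\<in>{0<..<t}. ennreal (s powr (- 1 / 2) * g s) \<partial>lborel) * heat_potential k \<eta> (boundary_point k y) t"
    (is "?B \<le> 2 * ?I * ?H t")
proof -
  let ?f = "\<lambda>s::real. s powr (- 1 / 2)"
  let ?T = "\<lambda>s z. tangential_kernel k (t - s) (boundary_point k y) (boundary_point k z)"
  have "?B \<le> (\<integral>\<^sup>+ s. ?H t * ((ennreal (?f s * g s) + ennreal (?f (t - s) * g s)) * indicator {0<..<t} s) \<partial>lborel)"
    unfolding boundary_potential_def
  proof (intro nn_integral_mono)
    fix s
    have "(\<integral>\<^sup>+ z. ennreal (neumann_green k (boundary_point k y) (boundary_point k z) (t - s)) *
          (ennreal (g s) * heat_potential k \<eta> (boundary_point k z) s) \<partial>boundary_measure k) \<le>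
        ?H t * (ennreal (?f s * g s) + ennreal (?f (t - s) * g s))" if s: "0 < s" "s < t"
    proof -
      have "(\<integral>\<^sup>+ z. ennreal (neumann_green k (boundary_point k y) (boundary_point k z) (t - s)) *
            (ennreal (g s) * heat_potential k \<eta> (boundary_point k z) s) \<partial>boundary_measure k) =
          (\<integral>\<^sup>+ z. (ennreal (2 * heat_kernel (t - s) 0) * ennreal (g s)) *
            (ennreal (?T s z) * heat_potential k \<eta> (boundary_point k z) s) \<partial>boundary_measure k)"
        using s by (intro nn_integral_cong) (simp add: neumann_green_boundary ennreal_mult' mult_ac)
      also have "\<dots> = (ennreal (2 * heat_kernel (t - s) 0) * ennreal (g s)) *
          (\<integral>\<^sup>+ z. ennreal (?T s z) * heat_potential k \<eta> (boundary_point k z) s \<partial>boundary_measure k)"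
        unfolding heat_potential_def by (intro nn_integral_cmult) measurable
      also have "\<dots> \<le> (ennreal (2 * heat_kernel (t - s) 0) * ennreal (g s)) * (ennreal (sqrt (t / s)) * ?H t)"
        by (intro mult_left_mono tangential_flow_heat_potential s) auto
      also have "\<dots> = ?H t * ennreal (2 * heat_kernel (t - s) 0 * sqrt (t / s) * g s)"
        using s g(2)[of s] by (simp add: ennreal_mult' mult_ac)
      also have "\<dots> \<le> ?H t * ennreal (?f s * g s + ?f (t - s) * g s)"
      proof (intro mult_left_mono ennreal_leI)
        have "2 * heat_kernel (t - s) 0 = 1 / sqrt (pi * (t - s))"
          using s by (simp add: heat_kernel_def real_sqrt_mult)
        also have "\<dots> \<le> 1 / sqrt (t - s)"
          using s pi_gt3 by (intro divide_left_mono) auto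
        finally have "2 * heat_kernel (t - s) 0 * sqrt (t / s) \<le> 1 / sqrt (t - s) * sqrt (t / s)"
          using s by (intro mult_right_mono) auto
        also have "\<dots> = sqrt (1 / s + 1 / (t - s))"
          using s by (simp add: real_sqrt_divide[symmetric] real_sqrt_mult[symmetric] divide_simps)
        also have "\<dots> \<le> sqrt (1 / s) + sqrt (1 / (t - s))"
          using s by (intro sqrt_add_le_add_sqrt) auto
        also have "\<dots> = ?f s + ?f (t - s)"
          using s by (simp add: powr_minus powr_half_sqrt real_sqrt_divide divide_simps)
        finally have "2 * heat_kernel (t - s) 0 * sqrt (t / s) * g s \<le> (?f s + ?f (t - s)) * g s"
          using g(2)[of s] s by (intro mult_right_mono) auto
        then show "2 * heat_kernel (t - s) 0 * sqrt (t / s) * g s \<le> ?f s * g s + ?f (t - s) * g s"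
          by (simp add: algebra_simps)
      qed auto
      also have "\<dots> = ?H t * (ennreal (?f s * g s) + ennreal (?f (t - s) * g s))"
        using g(2)[of s] s by simp
      finally show ?thesis .
    qed
    then show "(\<integral>\<^sup>+ z. ennreal (neumann_green k (boundary_point k y) (boundary_point k z) (t - s)) *
          (ennreal (g s) * heat_potential k \<eta> (boundary_point k z) s) \<partial>boundary_measure k) * indicator {0<..<t} s \<le>
        ?H t * ((ennreal (?f s * g s) + ennreal (?f (t - s) * g s)) * indicator {0<..<t} s)"
      by (auto split: split_indicator)
  qed
  also have "\<dots> = ?H t * (\<integral>\<^sup>+ s. (ennreal (?f s * g s) + ennreal (?f (t - s) * g s)) * indicator {0<..<t} s \<partial>lborel)"
    by (intro nn_integral_cmult) auto
  also have "(\<integral>\<^sup>+ s. (ennreal (?f s * g s) + ennreal (?f (t - s) * g s)) * indicator {0<..<t} s \<partial>lborel) =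
      ?I + (\<integral>\<^sup>+ s\<in>{0<..<t}. ennreal (?f (t - s) * g s) \<partial>lborel)"
    by (subst nn_integral_add[symmetric]) (auto simp: distrib_right)
  also have "?H t * \<dots> \<le> ?H t * (?I + ?I)"
    by (intro mult_left_mono add_left_mono nn_integral_convolution_antimono g powr_mono2') auto
  finally show ?thesis
    by (simp add: mult_2 mult_ac)
qed

text \<open>The p-th power of V is \<open>2 powr p\<close> times
  \<open>W powr ((p - \<alpha>) / \<alpha>)\<close> times W. Bounding the middle factor through m
  leaves something linear in the heat flow, to which
  \<open>boundary_potential_heat_potential\<close> applies. The smallness condition turns the
  result, a multiple of W, into at most \<open>W powr (1 / \<alpha>)\<close>. Of the two copies of
  this power in V, one absorbs the boundary term and the other, by Jensen, the initial
  datum.\<close>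

theorem minimal_solution_of_decay:
  fixes k :: "'n::finite" and \<phi> :: "real ^ 'n \<Rightarrow> real"
  assumes \<alpha>: "1 \<le> \<alpha>" "\<alpha> \<le> p"
    and J: "J \<in> sets borel" "J \<subseteq> {0<..}" "\<And>s t. t \<in> J \<Longrightarrow> 0 < s \<Longrightarrow> s < t \<Longrightarrow> s \<in> J"
    and \<phi>: "\<phi> \<in> borel_measurable borel" "\<And>y. 0 \<le> \<phi> y" "\<And>y. \<phi> y \<le> K"
    and m: "\<And>s. 0 < s \<Longrightarrow> 0 < m s" "\<And>s s'. 0 < s \<Longrightarrow> s \<le> s' \<Longrightarrow> m s' \<le> m s" "m \<in> borel_measurable borel"
    and decay: "\<And>y t. t \<in> J \<Longrightarrow> heat_potential k (\<lambda>y. ennreal (\<phi> y powr \<alpha>)) (boundary_point k y) t \<le> ennreal (m t)"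
    and I: "\<And>t. t \<in> J \<Longrightarrow> (\<integral>\<^sup>+ s\<in>{0<..<t}. ennreal (s powr (- 1 / 2) * m s powr ((p - \<alpha>) / \<alpha>)) \<partial>lborel) \<le> ennreal (I t)"
      "\<And>t. t \<in> J \<Longrightarrow> 2 powr (p + 1) * I t * m t powr ((\<alpha> - 1) / \<alpha>) \<le> 1"
  obtains u where "solution_on J k p \<phi> u"
    "\<And>w x t. solution_on J k p \<phi> w \<Longrightarrow> x \<in> closure (halfspace k) \<Longrightarrow> t \<in> J \<Longrightarrow> u x t \<le> w x t"
proof -
  note [measurable] = J(1) \<phi>(1) m(3)
  let ?\<eta> = "\<lambda>y. ennreal (\<phi> y powr \<alpha>)"
  let ?H = "\<lambda>y. heat_potential k ?\<eta> (boundary_point k y)"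
  define W where "W = (\<lambda>y t. enn2real (?H y t))"
  have W: "?H y t = ennreal (W y t)" "W y t \<le> K powr \<alpha>" if "0 < t" for y t
  proof -
    have "?H y t \<le> heat_potential k (\<lambda>_. ennreal (K powr \<alpha>)) (boundary_point k y) t"
      using \<phi> \<alpha> by (intro heat_potential_mono ennreal_leI powr_mono2) auto
    then have *: "?H y t \<le> ennreal (K powr \<alpha>)"
      using that by (simp add: heat_potential_const)
    then show "?H y t = ennreal (W y t)"
      unfolding W_def using le_less_trans[OF * ennreal_less_top] by simp
    show "W y t \<le> K powr \<alpha>"
      unfolding W_def using * by (intro enn2real_leI) auto
  qed
  have W0: "0 \<le> W y t" for y t
    by (simp add: W_def)
  have J0: "0 < t" if "t \<in> J" for t
    using that J by auto
  have Wm: "W y t \<le> m t" if "t \<in> J" for y t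
    using decay[OF that] m(1)[OF J0[OF that]] unfolding W_def by (intro enn2real_leI) auto
  define V where "V = (\<lambda>y t. 2 * W y t powr (1 / \<alpha>))"
  have K: "0 \<le> K"
    using \<phi> by (meson order_trans)
  obtain u where "solution_on J k p \<phi> u"
    "\<And>w x t. solution_on J k p \<phi> w \<Longrightarrow> x \<in> closure (halfspace k) \<Longrightarrow> t \<in> J \<Longrightarrow> u x t \<le> w x t"
  proof (rule minimal_solution_below_supersolution[where k = k and p = p and J = J and \<phi> = \<phi> and K = K and V = V and M = "2 * K"])
    show "0 \<le> V y t" for y t
      by (simp add: V_def)
    show "V y t \<le> 2 * K" if "t \<in> J" for y t
    proof -
      have "W y t powr (1 / \<alpha>) \<le> (K powr \<alpha>) powr (1 / \<alpha>)"
        using W[OF J0[OF that]] W0 \<alpha> by (intro powr_mono2) auto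
      also have "\<dots> = K"
        using \<alpha> K by (simp add: powr_powr)
      finally show ?thesis
        by (simp add: V_def)
    qed
    show "potential k (\<lambda>y. ennreal (\<phi> y)) (\<lambda>y s. ennreal (V y s powr p)) (boundary_point k y) t \<le> ennreal (V y t)"
      if t: "t \<in> J" for y t
    proof -
      let ?g = "\<lambda>s. 2 powr p * m s powr ((p - \<alpha>) / \<alpha>)"
      have "boundary_potential k (\<lambda>y s. ennreal (V y s powr p)) (boundary_point k y) t \<le>
          boundary_potential k (\<lambda>y s. ennreal (?g s) * ?H y s) (boundary_point k y) t"
      proof (rule boundary_potential_mono)
        fix z s assume s: "0 < s" "s < t"
        have "V z s powr p = 2 powr p * (W z s powr ((p - \<alpha>) / \<alpha>) * W z s)"
        proof (cases "W z s = 0")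
          case False
          then have "W z s powr ((p - \<alpha>) / \<alpha>) * W z s = W z s powr ((p - \<alpha>) / \<alpha> + 1)"
            using W0[of z s] by (simp add: powr_add)
          also have "(p - \<alpha>) / \<alpha> + 1 = p / \<alpha>"
            using \<alpha> by (simp add: field_simps)
          finally show ?thesis
            by (simp add: V_def powr_mult powr_powr)
        qed (simp add: V_def)
        also have "\<dots> \<le> 2 powr p * (m s powr ((p - \<alpha>) / \<alpha>) * W z s)"
          using W0[of z s] Wm[OF J(3)[OF t s]] \<alpha> by (intro mult_left_mono mult_right_mono powr_mono2) auto
        finally show "ennreal (V z s powr p) \<le> ennreal (?g s) * ?H z s"
          using W0[of z s] unfolding W[OF s(1)] by (simp add: ennreal_mult'[symmetric] ennreal_leI mult.assoc)
      qed
      also have "\<dots> \<le> 2 * (\<integral>\<^sup>+ s\<in>{0<..<t}. ennreal (s powr (- 1 / 2) * ?g s) \<partial>lborel) * ?H y t"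
        using m \<alpha> by (intro boundary_potential_heat_potential mult_left_mono powr_mono2) (auto intro: less_imp_le)
      also have "(\<integral>\<^sup>+ s\<in>{0<..<t}. ennreal (s powr (- 1 / 2) * ?g s) \<partial>lborel) =
          (\<integral>\<^sup>+ s. ennreal (2 powr p) * (ennreal (s powr (- 1 / 2) * m s powr ((p - \<alpha>) / \<alpha>)) * indicator {0<..<t} s) \<partial>lborel)"
        by (intro nn_integral_cong) (simp add: ennreal_mult' mult_ac)
      also have "\<dots> = ennreal (2 powr p) * (\<integral>\<^sup>+ s\<in>{0<..<t}. ennreal (s powr (- 1 / 2) * m s powr ((p - \<alpha>) / \<alpha>)) \<partial>lborel)"
        by (intro nn_integral_cmult) auto
      also have "2 * \<dots> * ?H y t \<le> 2 * (ennreal (2 powr p) * ennreal (I t)) * ennreal (W y t)"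
        unfolding W[OF J0[OF t]] by (intro mult_left_mono mult_right_mono I t) auto
      also have "\<dots> = ennreal (2 powr (p + 1) * I t * W y t)"
        using W0[of y t] by (simp add: ennreal_mult' ennreal_mult'' powr_add mult_ac)
      also have "\<dots> \<le> ennreal (W y t powr (1 / \<alpha>))"
      proof (intro ennreal_leI, cases "W y t = 0")
        case False
        show "2 powr (p + 1) * I t * W y t \<le> W y t powr (1 / \<alpha>)"
        \<comment> \<open>For negative \<open>I t\<close> the left-hand side is at most 0; otherwise
          W is split into its powers with exponents (\<alpha> - 1)/\<alpha> and 1/\<alpha>, and the
          first is bounded through m.\<close>
        proof (cases "0 \<le> I t")
          case True
          have "W y t = W y t powr ((\<alpha> - 1) / \<alpha> + 1 / \<alpha>)"
            using False W0[of y t] \<alpha> by (simp add: add_divide_distrib[symmetric])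
          also have "\<dots> = W y t powr ((\<alpha> - 1) / \<alpha>) * W y t powr (1 / \<alpha>)"
            by (rule powr_add)
          also have "\<dots> \<le> m t powr ((\<alpha> - 1) / \<alpha>) * W y t powr (1 / \<alpha>)"
            using W0[of y t] Wm[OF t] \<alpha> by (intro mult_right_mono powr_mono2) auto
          finally have "2 powr (p + 1) * I t * W y t \<le> 2 powr (p + 1) * I t * (m t powr ((\<alpha> - 1) / \<alpha>) * W y t powr (1 / \<alpha>))"
            using True by (intro mult_left_mono) auto
          also have "\<dots> \<le> 1 * W y t powr (1 / \<alpha>)"
            using I(2)[OF t] by (subst mult.assoc[symmetric], intro mult_right_mono) (auto simp: mult.assoc)
          finally show ?thesis by simp
        next
          case False
          then have "2 powr (p + 1) * I t * W y t \<le> 0"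
            using W0[of y t] by (intro mult_nonpos_nonneg mult_nonneg_nonpos) auto
          then show ?thesis
            by (rule order_trans) simp
        qed
      qed simp
      finally have "boundary_potential k (\<lambda>y s. ennreal (V y s powr p)) (boundary_point k y) t \<le> ennreal (W y t powr (1 / \<alpha>))" .
      moreover have "heat_potential k (\<lambda>y. ennreal (\<phi> y)) (boundary_point k y) t \<le> ennreal (W y t powr (1 / \<alpha>))"
        unfolding W_def by (rule heat_potential_jensen) (use \<phi> \<alpha> J0[OF t] in auto)
      ultimately have "potential k (\<lambda>y. ennreal (\<phi> y)) (\<lambda>y s. ennreal (V y s powr p)) (boundary_point k y) t \<le>
          ennreal (W y t powr (1 / \<alpha>)) + ennreal (W y t powr (1 / \<alpha>))"
        unfolding potential_def by (rule add_mono[rotated])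
      then show ?thesis
        by (simp add: V_def ennreal_plus[symmetric] del: ennreal_plus)
    qed
  qed (use \<alpha> J \<phi> that in auto)
  then show ?thesis
    using that by blast
qed

section \<open>Decay and mass of the initial data\<close>

lemma has_derivative_one_plus_powr:
  assumes "-1 < x"
  shows "((\<lambda>x. (1 + x) powr c) has_real_derivative c * (1 + x) powr (c - 1)) (at x)"
proof -
  have "((\<lambda>x. 1 + x) has_real_derivative 1) (at x)"
    by (auto intro!: derivative_eq_intros)
  from DERIV_fun_powr[OF this, of c] show ?thesis
    using assms by simp
qed

text \<open>The power is its value at R plus the integral of minus its derivative from r to
  R.\<close>

lemma powr_layer_cake:
  fixes r R b :: real
  assumes "0 \<le> r" "r \<le> R" "0 \<le> b"
  shows "ennreal ((1 + r) powr (- b)) =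
    ennreal ((1 + R) powr (- b)) + (\<integral>\<^sup>+ \<rho>. ennreal (b * (1 + \<rho>) powr (- b - 1)) * indicator {r..R} \<rho> \<partial>lborel)"
proof -
  have "(\<integral>\<^sup>+ \<rho>. ennreal (b * (1 + \<rho>) powr (- b - 1)) * indicator {r..R} \<rho> \<partial>lborel) =
      ennreal (- ((1 + R) powr (- b)) - (- ((1 + r) powr (- b))))"
  proof (rule nn_integral_FTC_Icc)
    show "((\<lambda>x. - ((1 + x) powr (- b))) has_real_derivative b * (1 + \<rho>) powr (- b - 1)) (at \<rho>)"
      if "\<rho> \<in> {r..R}" for \<rho>
      using DERIV_minus[OF has_derivative_one_plus_powr[of \<rho> "- b"]] that assms by simp
  qed (use assms in auto)
  moreover have "(1 + R) powr (- b) \<le> (1 + r) powr (- b)"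
    using assms by (intro powr_mono2') auto
  then have "ennreal ((1 + R) powr (- b)) + ennreal (- ((1 + R) powr (- b)) - (- ((1 + r) powr (- b)))) =
      ennreal ((1 + r) powr (- b))"
    by (subst ennreal_plus[symmetric]) auto
  ultimately show ?thesis
    by (simp only:)
qed

text \<open>Takes the place of polar coordinates: after Fubini the integral of the radial weight
  depends only on the volumes of E within centred balls. E is the full ball for upper bounds and the
  half ball for lower bounds.\<close>

lemma weight_layer_cake:
  fixes E :: "'a::euclidean_space set"
  assumes [measurable]: "E \<in> sets borel" and E: "E \<subseteq> cball 0 R" and b: "0 \<le> b"
  shows "(\<integral>\<^sup>+ y\<in>E. ennreal ((1 + norm y) powr (- b)) \<partial>lborel) =
    ennreal ((1 + R) powr (- b)) * emeasure lborel E +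
    (\<integral>\<^sup>+ \<rho>\<in>{0..R}. (ennreal (b * (1 + \<rho>) powr (- b - 1)) * emeasure lborel (E \<inter> cball 0 \<rho>)) \<partial>lborel)"
proof -
  let ?w = "\<lambda>\<rho>. ennreal (b * (1 + \<rho>) powr (- b - 1))"
  have "(\<integral>\<^sup>+ y\<in>E. ennreal ((1 + norm y) powr (- b)) \<partial>lborel) =
      (\<integral>\<^sup>+ y. ennreal ((1 + R) powr (- b)) * indicator E y +
        (\<integral>\<^sup>+ \<rho>. ?w \<rho> * of_bool (0 \<le> \<rho> \<and> norm y \<le> \<rho> \<and> \<rho> \<le> R \<and> y \<in> E) \<partial>lborel) \<partial>lborel)"
  proof (intro nn_integral_cong)
    fix y :: 'a
    show "ennreal ((1 + norm y) powr (- b)) * indicator E y = ennreal ((1 + R) powr (- b)) * indicator E y +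
        (\<integral>\<^sup>+ \<rho>. ?w \<rho> * of_bool (0 \<le> \<rho> \<and> norm y \<le> \<rho> \<and> \<rho> \<le> R \<and> y \<in> E) \<partial>lborel)"
    proof (cases "y \<in> E")
      case True
      have "(\<integral>\<^sup>+ \<rho>. ?w \<rho> * of_bool (0 \<le> \<rho> \<and> norm y \<le> \<rho> \<and> \<rho> \<le> R \<and> y \<in> E) \<partial>lborel) =
          (\<integral>\<^sup>+ \<rho>. ?w \<rho> * indicator {norm y..R} \<rho> \<partial>lborel)"
        using True norm_ge_zero[of y] by (intro nn_integral_cong) (auto split: split_indicator simp del: norm_ge_zero)
      moreover have "norm y \<le> R"
        using True E by auto
      ultimately show ?thesis
        using True b powr_layer_cake[of "norm y" R b] by simp
    qed simp
  qed
  also have "\<dots> = ennreal ((1 + R) powr (- b)) * emeasure lborel E +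
      (\<integral>\<^sup>+ y. \<integral>\<^sup>+ \<rho>. ?w \<rho> * of_bool (0 \<le> \<rho> \<and> norm y \<le> \<rho> \<and> \<rho> \<le> R \<and> y \<in> E) \<partial>lborel \<partial>lborel)"
    by (subst nn_integral_add) (auto simp: nn_integral_cmult)
  also have "(\<integral>\<^sup>+ y. \<integral>\<^sup>+ \<rho>. ?w \<rho> * of_bool (0 \<le> \<rho> \<and> norm y \<le> \<rho> \<and> \<rho> \<le> R \<and> y \<in> E) \<partial>lborel \<partial>lborel) =
      (\<integral>\<^sup>+ \<rho>. \<integral>\<^sup>+ y. ?w \<rho> * of_bool (0 \<le> \<rho> \<and> norm y \<le> \<rho> \<and> \<rho> \<le> R \<and> y \<in> E) \<partial>lborel \<partial>lborel)"
    by (rule lborel_pair.Fubini'[symmetric]) measurable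
  also have "\<dots> = (\<integral>\<^sup>+ \<rho>\<in>{0..R}. (?w \<rho> * emeasure lborel (E \<inter> cball 0 \<rho>)) \<partial>lborel)"
  proof (intro nn_integral_cong)
    fix \<rho> :: real
    have [measurable]: "E \<inter> cball 0 \<rho> \<in> sets borel"
      using assms(1) by auto
    have "(\<integral>\<^sup>+ y. ?w \<rho> * of_bool (0 \<le> \<rho> \<and> norm y \<le> \<rho> \<and> \<rho> \<le> R \<and> y \<in> E) \<partial>lborel) =
        (\<integral>\<^sup>+ y. (?w \<rho> * indicator {0..R} \<rho>) * indicator (E \<inter> cball 0 \<rho>) y \<partial>lborel)"
      by (intro nn_integral_cong) (auto split: split_indicator)
    also have "\<dots> = ?w \<rho> * emeasure lborel (E \<inter> cball 0 \<rho>) * indicator {0..R} \<rho>"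
      by (subst nn_integral_cmult) (auto simp: mult_ac)
    finally show "(\<integral>\<^sup>+ y. ?w \<rho> * of_bool (0 \<le> \<rho> \<and> norm y \<le> \<rho> \<and> \<rho> \<le> R \<and> y \<in> E) \<partial>lborel) =
      ?w \<rho> * emeasure lborel (E \<inter> cball 0 \<rho>) * indicator {0..R} \<rho>" .
  qed
  finally show ?thesis .
qed

lemma weight_mass_le:
  fixes b R :: real
  assumes "0 \<le> b" "0 \<le> R"
  shows "(\<integral>\<^sup>+ y\<in>cball 0 R. ennreal ((1 + norm (y :: 'a::euclidean_space)) powr (- b)) \<partial>lborel) \<le>
    ennreal (unit_ball_vol DIM('a)) * (ennreal ((1 + R) powr (- b) * R ^ DIM('a)) +
      ennreal b * (\<integral>\<^sup>+ \<rho>\<in>{0..R}. ennreal ((1 + \<rho>) powr (DIM('a) - b - 1)) \<partial>lborel))"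
proof -
  let ?\<omega> = "unit_ball_vol DIM('a)"
  have "(\<integral>\<^sup>+ \<rho>\<in>{0..R}. (ennreal (b * (1 + \<rho>) powr (- b - 1)) * emeasure lborel (cball 0 R \<inter> cball (0::'a) \<rho>)) \<partial>lborel) \<le>
      (\<integral>\<^sup>+ \<rho>. ennreal (?\<omega> * b) * (ennreal ((1 + \<rho>) powr (DIM('a) - b - 1)) * indicator {0..R} \<rho>) \<partial>lborel)"
  proof (intro nn_integral_mono)
    fix \<rho> :: real
    show "ennreal (b * (1 + \<rho>) powr (- b - 1)) * emeasure lborel (cball 0 R \<inter> cball (0::'a) \<rho>) * indicator {0..R} \<rho> \<le>
        ennreal (?\<omega> * b) * (ennreal ((1 + \<rho>) powr (DIM('a) - b - 1)) * indicator {0..R} \<rho>)"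
    proof (cases "0 \<le> \<rho> \<and> \<rho> \<le> R")
      case True
      have "ennreal (b * (1 + \<rho>) powr (- b - 1)) * emeasure lborel (cball 0 R \<inter> cball (0::'a) \<rho>) \<le>
          ennreal (b * (1 + \<rho>) powr (- b - 1)) * ennreal (?\<omega> * \<rho> ^ DIM('a))"
      proof (rule mult_left_mono)
        have "emeasure lborel (cball 0 R \<inter> cball (0::'a) \<rho>) \<le> emeasure lborel (cball (0::'a) \<rho>)"
          by (rule emeasure_mono) auto
        also have "\<dots> = ennreal (?\<omega> * \<rho> ^ DIM('a))"
          using True by (simp add: emeasure_cball)
        finally show "emeasure lborel (cball 0 R \<inter> cball (0::'a) \<rho>) \<le> ennreal (?\<omega> * \<rho> ^ DIM('a))" .
      qed simp
      also have "\<dots> = ennreal (b * (1 + \<rho>) powr (- b - 1) * (?\<omega> * \<rho> ^ DIM('a)))"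
        using assms True by (simp add: ennreal_mult)
      \<comment> \<open>Replacing \<rho> by 1 + \<rho> merges both factors into one power, which has
        an explicit primitive.\<close>
      also have "\<dots> \<le> ennreal (b * (1 + \<rho>) powr (- b - 1) * (?\<omega> * (1 + \<rho>) ^ DIM('a)))"
        using True assms by (intro ennreal_leI mult_left_mono power_mono) auto
      also have "b * (1 + \<rho>) powr (- b - 1) * (?\<omega> * (1 + \<rho>) ^ DIM('a)) =
          ?\<omega> * b * (1 + \<rho>) powr (DIM('a) - b - 1)"
      proof -
        have "(1 + \<rho>) powr (- b - 1) * (1 + \<rho>) powr real DIM('a) = (1 + \<rho>) powr (DIM('a) - b - 1)"
          unfolding powr_add[symmetric] by (rule arg_cong[where f = "\<lambda>c. (1 + \<rho>) powr c"]) simp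
        then have "(1 + \<rho>) powr (- b - 1) * (1 + \<rho>) ^ DIM('a) = (1 + \<rho>) powr (DIM('a) - b - 1)"
          using True by (subst (asm) powr_realpow) auto
        then show ?thesis
          by (simp only: mult_ac)
      qed
      finally show ?thesis
        using True assms by (simp add: ennreal_mult'[symmetric] mult.assoc)
    qed auto
  qed
  also have "\<dots> = ennreal (?\<omega> * b) * (\<integral>\<^sup>+ \<rho>\<in>{0..R}. ennreal ((1 + \<rho>) powr (DIM('a) - b - 1)) \<partial>lborel)"
    by (intro nn_integral_cmult) auto
  finally have *: "(\<integral>\<^sup>+ \<rho>\<in>{0..R}. (ennreal (b * (1 + \<rho>) powr (- b - 1)) * emeasure lborel (cball 0 R \<inter> cball (0::'a) \<rho>)) \<partial>lborel) \<le>
      ennreal (?\<omega> * b) * (\<integral>\<^sup>+ \<rho>\<in>{0..R}. ennreal ((1 + \<rho>) powr (DIM('a) - b - 1)) \<partial>lborel)" .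
  have "(\<integral>\<^sup>+ y\<in>cball 0 R. ennreal ((1 + norm (y :: 'a)) powr (- b)) \<partial>lborel) \<le>
      ennreal ((1 + R) powr (- b)) * ennreal (?\<omega> * R ^ DIM('a)) +
      ennreal (?\<omega> * b) * (\<integral>\<^sup>+ \<rho>\<in>{0..R}. ennreal ((1 + \<rho>) powr (DIM('a) - b - 1)) \<partial>lborel)"
    using assms * by (subst weight_layer_cake[where R = R]) (auto simp: emeasure_cball intro!: add_left_mono)
  also have "\<dots> = ennreal ?\<omega> * (ennreal ((1 + R) powr (- b) * R ^ DIM('a)) +
      ennreal b * (\<integral>\<^sup>+ \<rho>\<in>{0..R}. ennreal ((1 + \<rho>) powr (DIM('a) - b - 1)) \<partial>lborel))"
    using assms by (simp add: ennreal_mult' distrib_left mult.assoc mult.left_commute)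
  finally show ?thesis .
qed

lemma nn_integral_powr_Icc:
  fixes c R :: real
  assumes "c \<noteq> 0" "0 \<le> R"
  shows "(\<integral>\<^sup>+ \<rho>\<in>{0..R}. ennreal ((1 + \<rho>) powr (c - 1)) \<partial>lborel) = ennreal (((1 + R) powr c - 1) / c)"
proof -
  have "(\<integral>\<^sup>+ \<rho>\<in>{0..R}. ennreal ((1 + \<rho>) powr (c - 1)) \<partial>lborel) =
      ennreal ((1 + R) powr c / c - (1 + 0) powr c / c)"
  proof (rule nn_integral_FTC_Icc)
    show "((\<lambda>x. (1 + x) powr c / c) has_real_derivative (1 + \<rho>) powr (c - 1)) (at \<rho>)"
      if "\<rho> \<in> {0..R}" for \<rho>
      using DERIV_cdivide[OF has_derivative_one_plus_powr[of \<rho> c], of c] that assms by simp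
  qed (use assms in auto)
  then show ?thesis
    by (simp add: diff_divide_distrib)
qed

lemma nn_integral_inverse_Icc:
  assumes "0 < a" "a \<le> b"
  shows "(\<integral>\<^sup>+ \<rho>\<in>{a..b}. ennreal (1 / \<rho>) \<partial>lborel) = ennreal (ln (b / a))"
proof -
  have "(\<integral>\<^sup>+ \<rho>\<in>{a..b}. ennreal (1 / \<rho>) \<partial>lborel) = ennreal (ln b - ln a)"
    using assms by (intro nn_integral_FTC_Icc) (auto intro!: derivative_eq_intros simp: field_simps)
  then show ?thesis
    using assms by (simp add: ln_div)
qed

lemma nn_integral_log_Icc:
  fixes R :: real
  assumes "0 \<le> R"
  shows "(\<integral>\<^sup>+ \<rho>\<in>{0..R}. ennreal ((1 + \<rho>) powr (- 1)) \<partial>lborel) = ennreal (ln (1 + R))"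
proof -
  have "(\<integral>\<^sup>+ \<rho>\<in>{0..R}. ennreal ((1 + \<rho>) powr (- 1)) \<partial>lborel) =
      ennreal (ln (1 + R) - ln (1 + 0))"
    using assms by (intro nn_integral_FTC_Icc) (auto intro!: derivative_eq_intros simp: powr_minus field_simps)
  then show ?thesis by simp
qed

definition weight :: "real \<Rightarrow> 'a::real_normed_vector \<Rightarrow> real" where
  "weight b y = (1 + norm y) powr (- b)"

lemma weight_measurable [measurable]: "weight b \<in> borel_measurable (borel :: 'a::euclidean_space measure)"
  unfolding weight_def[abs_def] by measurable

lemma weight_pos: "0 < weight b y"
  using norm_ge_zero[of y] by (simp add: weight_def add_nonneg_eq_0_iff)

lemma weight_le_1: "0 \<le> b \<Longrightarrow> weight b y \<le> 1"
  unfolding weight_def using powr_mono2'[of "-b" 1 "1 + norm y"] by simp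

lemma weight_powr: "weight b y powr c = weight (b * c) y"
  by (simp add: weight_def powr_powr)

abbreviation weight_flow :: "'n::finite \<Rightarrow> real \<Rightarrow> real ^ 'n \<Rightarrow> real \<Rightarrow> ennreal" where
  "weight_flow k b \<equiv> heat_potential k (\<lambda>y. ennreal (weight b y))"

abbreviation half_ball_mass :: "'n::finite \<Rightarrow> real \<Rightarrow> real \<Rightarrow> ennreal" where
  "half_ball_mass k b \<rho> \<equiv> \<integral>\<^sup>+ v\<in>closure (halfspace k) \<inter> cball 0 \<rho>. ennreal (weight b v) \<partial>lborel"

lemma heat_potential_weight_le_1:
  assumes "0 < t" "0 \<le> b"
  shows "weight_flow k b x t \<le> 1"
proof -
  have "weight_flow k b x t \<le> heat_potential k (\<lambda>_. 1) x t"
    using weight_le_1[OF assms(2)] by (intro heat_potential_mono) auto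
  then show ?thesis
    using assms by (simp add: heat_potential_const)
qed

lemma neumann_green_le:
  fixes k :: "'n::finite"
  assumes "0 < t"
  shows "neumann_green k x y t \<le> 2 * t powr (- real CARD('n) / 2)"
proof -
  have "(4 * pi * t) powr (- real CARD('n) / 2) \<le> t powr (- real CARD('n) / 2)"
    using assms pi_gt3 by (intro powr_mono2') auto
  moreover have "exp (- (norm (x - y))\<^sup>2 / (4 * t)) + exp (- (norm (x - reflect k y))\<^sup>2 / (4 * t)) \<le> 1 + 1"
    using assms by (intro add_mono) auto
  ultimately have "neumann_green k x y t \<le> t powr (- real CARD('n) / 2) * (1 + 1)"
    unfolding neumann_green_def by (intro mult_mono) auto
  then show ?thesis by simp
qed

lemma sqrt_powr: "0 < t \<Longrightarrow> sqrt t powr c = t powr (c / 2)"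
  by (subst powr_half_sqrt[symmetric]) (simp_all only: powr_powr, simp_all)

lemma sqrt_pow_powr: "0 < t \<Longrightarrow> sqrt t ^ n = t powr (real n / 2)"
  by (subst powr_realpow[symmetric]) (simp_all add: sqrt_powr)

text \<open>Splitting at |y| = \<open>sqrt t\<close>: outside, the weight is at most
  \<open>t powr (- b / 2)\<close> and the kernel has mass 1; inside, the kernel is at most
  \<open>2 * t powr (- N / 2)\<close> and the mass of the weight remains. The bound is uniform in
  x.\<close>

lemma heat_potential_weight_le:
  fixes k :: "'n::finite"
  assumes t: "0 < t" and b: "0 \<le> b"
  shows "weight_flow k b x t \<le>
    ennreal (t powr (- b / 2)) + ennreal (2 * t powr (- real CARD('n) / 2)) *
      (\<integral>\<^sup>+ y\<in>cball 0 (sqrt t). ennreal ((1 + norm (y :: real ^ 'n)) powr (- b)) \<partial>lborel)"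
proof -
  let ?D = "closure (halfspace k)"
  let ?c = "ennreal (2 * t powr (- real CARD('n) / 2))"
  have [measurable]: "cball (0 :: real ^ 'n) (sqrt t) \<in> sets borel"
    by simp
  have "weight_flow k b x t \<le>
      (\<integral>\<^sup>+ y. ennreal (neumann_green k x y t) * ennreal (t powr (- b / 2)) * indicator ?D y +
        ?c * (ennreal (weight b y) * indicator (cball 0 (sqrt t)) y) \<partial>lborel)"
    unfolding heat_potential_def
  proof (intro nn_integral_mono)
    fix y :: "real ^ 'n"
    show "ennreal (neumann_green k x y t) * ennreal (weight b y) * indicator ?D y \<le>
        ennreal (neumann_green k x y t) * ennreal (t powr (- b / 2)) * indicator ?D y +
        ?c * (ennreal (weight b y) * indicator (cball 0 (sqrt t)) y)"
    proof (cases "norm y \<le> sqrt t")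
      case True
      have "ennreal (neumann_green k x y t) * ennreal (weight b y) * indicator ?D y \<le> ?c * ennreal (weight b y) * 1"
        using neumann_green_le[OF t] by (intro mult_mono ennreal_leI) (auto split: split_indicator)
      also have "\<dots> = 0 + ?c * (ennreal (weight b y) * indicator (cball 0 (sqrt t)) y)"
        using True by simp
      also have "\<dots> \<le> ennreal (neumann_green k x y t) * ennreal (t powr (- b / 2)) * indicator ?D y +
          ?c * (ennreal (weight b y) * indicator (cball 0 (sqrt t)) y)"
        by (rule add_right_mono) simp
      finally show ?thesis .
    next
      case False
      have "weight b y \<le> sqrt t powr (- b)"
        unfolding weight_def using t b False by (intro powr_mono2') auto
      also have "\<dots> = t powr (- b / 2)"
        using t by (simp add: sqrt_powr)
      finally have "ennreal (neumann_green k x y t) * ennreal (weight b y) * indicator ?D y \<le>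
          ennreal (neumann_green k x y t) * ennreal (t powr (- b / 2)) * indicator ?D y + 0"
        unfolding add_0_right by (intro mult_right_mono mult_left_mono ennreal_leI) auto
      also have "\<dots> \<le> ennreal (neumann_green k x y t) * ennreal (t powr (- b / 2)) * indicator ?D y +
          ?c * (ennreal (weight b y) * indicator (cball 0 (sqrt t)) y)"
        by (rule add_left_mono) simp
      finally show ?thesis .
    qed
  qed
  also have "\<dots> = heat_potential k (\<lambda>_. ennreal (t powr (- b / 2))) x t +
      ?c * (\<integral>\<^sup>+ y\<in>cball 0 (sqrt t). ennreal (weight b (y :: real ^ 'n)) \<partial>lborel)"
    unfolding heat_potential_def
  proof (subst nn_integral_add)
    have "(\<integral>\<^sup>+ y. ?c * (ennreal (weight b y) * indicator (cball 0 (sqrt t)) y) \<partial>(lborel :: (real ^ 'n) measure)) =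
        ?c * (\<integral>\<^sup>+ y\<in>cball 0 (sqrt t). ennreal (weight b (y :: real ^ 'n)) \<partial>lborel)"
      by (rule nn_integral_cmult) measurable
    then show "(\<integral>\<^sup>+ y\<in>?D. (ennreal (neumann_green k x y t) * ennreal (t powr (- b / 2))) \<partial>lborel) +
        (\<integral>\<^sup>+ y. ?c * (ennreal (weight b y) * indicator (cball 0 (sqrt t)) y) \<partial>(lborel :: (real ^ 'n) measure)) =
        (\<integral>\<^sup>+ y\<in>?D. (ennreal (neumann_green k x y t) * ennreal (t powr (- b / 2))) \<partial>lborel) +
        ?c * (\<integral>\<^sup>+ y\<in>cball 0 (sqrt t). ennreal (weight b (y :: real ^ 'n)) \<partial>lborel)"
      by (rule arg_cong)
  qed measurable
  finally show ?thesis
    unfolding heat_potential_const[OF t] weight_def .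
qed

text \<open>The radial integral is the only place where b = N differs from b \<noteq> N. Its bound
  enters through D, so that the resonant case can take D = 1 + ln t.\<close>

lemma heat_potential_weight_decay:
  fixes k :: "'n::finite" and t b D :: real
  assumes t: "1 \<le> t" and b: "0 \<le> b" and D: "0 \<le> D"
    and int: "(\<integral>\<^sup>+ \<rho>\<in>{0..sqrt t}. ennreal ((1 + \<rho>) powr (CARD('n) - b - 1)) \<partial>lborel) \<le>
      ennreal (D * t powr ((CARD('n) - min b CARD('n)) / 2))"
  shows "weight_flow k b x t \<le>
    ennreal ((1 + 2 * unit_ball_vol CARD('n) * (1 + b * D)) * t powr (- min b CARD('n) / 2))"
proof -
  let ?N = "real CARD('n)" and ?\<omega> = "unit_ball_vol CARD('n)"
  let ?m = "t powr (- min b ?N / 2)"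
  have "(1 + sqrt t) powr (- b) \<le> sqrt t powr (- b)"
    using t b by (intro powr_mono2') auto
  also have "\<dots> = t powr (- b / 2)"
    using t by (simp add: sqrt_powr)
  also have "\<dots> \<le> ?m"
    using t by (intro powr_mono) auto
  finally have 1: "(1 + sqrt t) powr (- b) * sqrt t ^ CARD('n) \<le> ?m * t powr (?N / 2)"
    using t by (simp add: sqrt_pow_powr mult_right_mono)
  have 2: "t powr ((?N - min b ?N) / 2) = ?m * t powr (?N / 2)"
    by (simp add: powr_add[symmetric] diff_divide_distrib)
  have "(\<integral>\<^sup>+ y\<in>cball 0 (sqrt t). ennreal ((1 + norm (y :: real ^ 'n)) powr (- b)) \<partial>lborel) \<le>
      ennreal ?\<omega> * (ennreal ((1 + sqrt t) powr (- b) * sqrt t ^ CARD('n)) +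
      ennreal b * (\<integral>\<^sup>+ \<rho>\<in>{0..sqrt t}. ennreal ((1 + \<rho>) powr (CARD('n) - b - 1)) \<partial>lborel))"
    using weight_mass_le[of b "sqrt t", where 'a = "real ^ 'n"] b t by simp
  also have "\<dots> \<le> ennreal ?\<omega> * (ennreal (?m * t powr (?N / 2)) + ennreal b * ennreal (D * (?m * t powr (?N / 2))))"
    using int 1 unfolding 2 by (intro mult_left_mono add_mono ennreal_leI) auto
  also have "\<dots> = ennreal (?\<omega> * (1 + b * D) * (?m * t powr (?N / 2)))"
    using b D by (simp add: ennreal_mult[symmetric] ennreal_plus[symmetric] algebra_simps del: ennreal_plus)
  finally have "ennreal (2 * t powr (- ?N / 2)) * (\<integral>\<^sup>+ y\<in>cball 0 (sqrt t). ennreal ((1 + norm (y :: real ^ 'n)) powr (- b)) \<partial>lborel) \<le>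
      ennreal (2 * t powr (- ?N / 2)) * ennreal (?\<omega> * (1 + b * D) * (?m * t powr (?N / 2)))"
    by (intro mult_left_mono) auto
  also have "\<dots> = ennreal (2 * ?\<omega> * (1 + b * D) * ?m * (t powr (- ?N / 2) * t powr (?N / 2)))"
    by (subst ennreal_mult'[symmetric]) (auto simp: mult_ac)
  also have "t powr (- ?N / 2) * t powr (?N / 2) = 1"
    using t by (simp add: powr_add[symmetric])
  finally have 3: "ennreal (2 * t powr (- ?N / 2)) * (\<integral>\<^sup>+ y\<in>cball 0 (sqrt t). ennreal ((1 + norm (y :: real ^ 'n)) powr (- b)) \<partial>lborel) \<le>
      ennreal (2 * ?\<omega> * (1 + b * D) * ?m)"
    by simp
  have "weight_flow k b x t \<le>
      ennreal (t powr (- b / 2)) + ennreal (2 * ?\<omega> * (1 + b * D) * ?m)"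
    by (rule order_trans[OF heat_potential_weight_le add_left_mono[OF 3]]) (use t b in auto)
  also have "\<dots> \<le> ennreal ?m + ennreal (2 * ?\<omega> * (1 + b * D) * ?m)"
    using t by (intro add_right_mono ennreal_leI powr_mono) auto
  also have "\<dots> = ennreal ((1 + 2 * ?\<omega> * (1 + b * D)) * ?m)"
    using b D by (subst ennreal_plus[symmetric]) (auto simp: algebra_simps)
  finally show ?thesis .
qed

lemma heat_potential_weight_decay_neq:
  fixes k :: "'n::finite" and b :: real
  assumes b: "0 < b" "b \<noteq> CARD('n)"
  obtains C where "1 \<le> C" "\<And>x t. 0 < t \<Longrightarrow>
    weight_flow k b x t \<le> ennreal (C * (max 1 t) powr (- min b CARD('n) / 2))"
proof -
  let ?N = "real CARD('n)"
  \<comment> \<open>One constant for both cases: for b < N the radial integral grows like a power of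
    t, at the cost of \<open>2 powr (N - b)\<close> from 1 + \<open>sqrt t\<close> \<le> 2
    \<open>sqrt t\<close>; for b > N it stays bounded.\<close>
  define D where "D = 2 powr ?N / \<bar>?N - b\<bar>"
  define C where "C = 1 + 2 * unit_ball_vol CARD('n) * (1 + b * D)"
  have D: "0 \<le> D" by (simp add: D_def)
  have C1: "1 \<le> C"
    unfolding C_def using b D by simp
  have int: "(\<integral>\<^sup>+ \<rho>\<in>{0..sqrt t}. ennreal ((1 + \<rho>) powr (?N - b - 1)) \<partial>lborel) \<le>
      ennreal (D * t powr ((?N - min b ?N) / 2))" if t: "1 \<le> t" for t
  proof -
    have "((1 + sqrt t) powr (?N - b) - 1) / (?N - b) \<le> D * t powr ((?N - min b ?N) / 2)"
    proof (cases "b < ?N")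
      case True
      have "(1 + sqrt t) powr (?N - b) \<le> (2 * sqrt t) powr (?N - b)"
        using True t by (intro powr_mono2) auto
      also have "\<dots> = 2 powr (?N - b) * t powr ((?N - b) / 2)"
        using t by (simp add: powr_mult sqrt_powr)
      also have "\<dots> \<le> 2 powr ?N * t powr ((?N - b) / 2)"
        using b by (intro mult_right_mono powr_mono) auto
      finally have "(1 + sqrt t) powr (?N - b) - 1 \<le> 2 powr ?N * t powr ((?N - b) / 2)"
        by simp
      then have "((1 + sqrt t) powr (?N - b) - 1) / (?N - b) \<le> 2 powr ?N * t powr ((?N - b) / 2) / (?N - b)"
        using True by (intro divide_right_mono) auto
      then show ?thesis
        using True by (simp add: D_def)
    next
      case False
      have "((1 + sqrt t) powr (?N - b) - 1) / (?N - b) = (1 - (1 + sqrt t) powr (?N - b)) / (b - ?N)"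
        using False b by (simp add: field_simps)
      also have "\<dots> \<le> 2 powr ?N / (b - ?N)"
      proof (rule divide_right_mono)
        have "1 \<le> 2 powr ?N"
          by (rule ge_one_powr_ge_zero) auto
        then show "1 - (1 + sqrt t) powr (?N - b) \<le> 2 powr ?N"
          using powr_ge_zero[of "1 + sqrt t" "?N - b"] by linarith
      qed (use False in simp)
      finally show ?thesis
        using False t by (simp add: D_def)
    qed
    then show ?thesis
      using nn_integral_powr_Icc[of "?N - b" "sqrt t"] b t by (simp add: ennreal_leI)
  qed
  show ?thesis
  proof (rule that[of C])
    fix x :: "real ^ 'n" and t :: real assume t: "0 < t"
    show "weight_flow k b x t \<le> ennreal (C * (max 1 t) powr (- min b ?N / 2))"
    proof (cases "1 \<le> t")
      case True
      then show ?thesis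
        using heat_potential_weight_decay[OF True _ D int[OF True]] b by (simp add: C_def max_absorb2)
    next
      case False
      then show ?thesis
        using order_trans[OF heat_potential_weight_le_1[OF t, of b k x] ennreal_leI[OF C1, unfolded ennreal_1]] b
        by (simp add: max_absorb1)
    qed
  qed (rule C1)
qed

text \<open>The logarithm is taken at the horizon T rather than at t, so that on (0, T) the bound is
  a constant times a pure power and therefore nonincreasing in time. The factor
  \<open>max 1 t\<close> covers small times, where the flow is at most 1.\<close>

lemma heat_potential_weight_decay_eq:
  fixes k :: "'n::finite"
  obtains C where "1 \<le> C" "\<And>x t T. 0 < t \<Longrightarrow> t \<le> T \<Longrightarrow> 1 \<le> T \<Longrightarrow>
    weight_flow k CARD('n) x t \<le> ennreal (C * (1 + ln T) * (max 1 t) powr (- real CARD('n) / 2))"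
proof -
  let ?N = "real CARD('n)"
  define C where "C = 1 + 2 * unit_ball_vol CARD('n) * (1 + ?N)"
  have C1: "1 \<le> C"
    unfolding C_def by simp
  show ?thesis
  proof (rule that[of C])
    fix x :: "real ^ 'n" and t T :: real assume t: "0 < t" "t \<le> T" "1 \<le> T"
    show "weight_flow k ?N x t \<le> ennreal (C * (1 + ln T) * (max 1 t) powr (- ?N / 2))"
    proof (cases "1 \<le> t")
      case True
      have "ln (1 + sqrt t) \<le> ln (2 * sqrt t)"
        using True by (subst ln_le_cancel_iff) (auto simp: add_pos_nonneg)
      also have "\<dots> = ln 2 + ln t / 2"
        using True by (simp add: ln_mult ln_sqrt)
      also have "\<dots> \<le> 1 + ln t"
        using ln_2_less_1 ln_ge_zero[OF True] by linarith
      finally have L: "ln (1 + sqrt t) \<le> 1 + ln t" .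
      have "(\<integral>\<^sup>+ \<rho>\<in>{0..sqrt t}. ennreal ((1 + \<rho>) powr (?N - ?N - 1)) \<partial>lborel) \<le>
          ennreal ((1 + ln t) * t powr ((?N - min ?N ?N) / 2))"
        using ennreal_leI[OF L] True nn_integral_log_Icc[of "sqrt t"] by simp
      then have "weight_flow k ?N x t \<le>
          ennreal ((1 + 2 * unit_ball_vol ?N * (1 + ?N * (1 + ln t))) * t powr (- min ?N ?N / 2))"
        using True by (intro heat_potential_weight_decay) auto
      also have "\<dots> \<le> ennreal (C * (1 + ln T) * t powr (- ?N / 2))"
      proof -
        have "1 + 2 * unit_ball_vol ?N * (1 + ?N * (1 + ln t)) \<le> (1 + 2 * unit_ball_vol ?N * (1 + ?N)) * (1 + ln t)"
          using True by (simp add: algebra_simps)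
        also have "\<dots> \<le> C * (1 + ln T)"
          unfolding C_def using True t by (intro mult_left_mono) (auto simp: add_nonneg_nonneg)
        finally show ?thesis
          by (intro ennreal_leI) (simp add: mult_right_mono)
      qed
      finally show ?thesis
        using True by (simp add: max_absorb2)
    next
      case False
      have "1 * 1 \<le> C * (1 + ln T)"
        using C1 t by (intro mult_mono) auto
      then show ?thesis
        using order_trans[OF heat_potential_weight_le_1[OF t(1), of ?N k x] ennreal_leI[of 1 "C * (1 + ln T)", unfolded ennreal_1]] False
        by (simp add: max_absorb1)
    qed
  qed (rule C1)
qed

section \<open>Lower bounds of the life span\<close>

text \<open>Homogeneity in \<kappa>: the time integral contributes
  \<open>\<kappa> powr (p - \<alpha>)\<close> and the last factor
  \<open>\<kappa> powr (\<alpha> - 1)\<close>, so for every \<alpha> the smallness condition carries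
  \<open>\<kappa> powr (p - 1)\<close>.\<close>

lemma minimal_solution_weight:
  fixes k :: "'n::finite"
  assumes \<kappa>: "0 < \<kappa>" and A: "0 \<le> A" and \<alpha>: "1 \<le> \<alpha>" "\<alpha> \<le> p"
    and J: "J \<in> sets borel" "J \<subseteq> {0<..}" "\<And>s t. t \<in> J \<Longrightarrow> 0 < s \<Longrightarrow> s < t \<Longrightarrow> s \<in> J"
    and m: "\<And>s. 0 < s \<Longrightarrow> 0 < m s" "\<And>s s'. 0 < s \<Longrightarrow> s \<le> s' \<Longrightarrow> m s' \<le> m s" "m \<in> borel_measurable borel"
    and decay: "\<And>x t. t \<in> J \<Longrightarrow> weight_flow k (A * \<alpha>) x t \<le> ennreal (m t)"
    and I: "\<And>t. t \<in> J \<Longrightarrow> (\<integral>\<^sup>+ s\<in>{0<..<t}. ennreal (s powr (- 1 / 2) * m s powr ((p - \<alpha>) / \<alpha>)) \<partial>lborel) \<le> ennreal (I t)"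
      "\<And>t. t \<in> J \<Longrightarrow> 2 powr (p + 1) * \<kappa> powr (p - 1) * I t * m t powr ((\<alpha> - 1) / \<alpha>) \<le> 1"
  obtains u where "solution_on J k p (\<lambda>x. \<kappa> * weight A x) u"
    "\<And>w x t. solution_on J k p (\<lambda>x. \<kappa> * weight A x) w \<Longrightarrow> x \<in> closure (halfspace k) \<Longrightarrow> t \<in> J \<Longrightarrow> u x t \<le> w x t"
proof -
  note [measurable] = m(3) J(1)
  let ?q = "(p - \<alpha>) / \<alpha>"
  have q: "(\<kappa> powr \<alpha>) powr ?q = \<kappa> powr (p - \<alpha>)" "(\<kappa> powr \<alpha>) powr ((\<alpha> - 1) / \<alpha>) = \<kappa> powr (\<alpha> - 1)"
    using \<alpha> by (simp_all add: powr_powr)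
  show ?thesis
  proof (rule minimal_solution_of_decay[where k = k and p = p and J = J and \<alpha> = \<alpha> and K = \<kappa>
        and \<phi> = "\<lambda>x. \<kappa> * weight A x" and m = "\<lambda>s. \<kappa> powr \<alpha> * m s" and I = "\<lambda>t. \<kappa> powr (p - \<alpha>) * I t"])
    show "0 \<le> \<kappa> * weight A y" "\<kappa> * weight A y \<le> \<kappa>" for y :: "real ^ 'n"
      using \<kappa> weight_pos[of A y] weight_le_1[OF A, of y] by auto
    show "0 < \<kappa> powr \<alpha> * m s" if "0 < s" for s
      using m(1)[OF that] \<kappa> by simp
    show "\<kappa> powr \<alpha> * m s' \<le> \<kappa> powr \<alpha> * m s" if "0 < s" "s \<le> s'" for s s'
      using m(2)[OF that] by (intro mult_left_mono) auto
    show "heat_potential k (\<lambda>y. ennreal ((\<kappa> * weight A y) powr \<alpha>)) (boundary_point k y) t \<le> ennreal (\<kappa> powr \<alpha> * m t)"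
      if t: "t \<in> J" for y t
    proof -
      have *: "(\<kappa> * weight A z) powr \<alpha> = \<kappa> powr \<alpha> * weight (A * \<alpha>) z" for z :: "real ^ 'n"
        using \<kappa> weight_pos[of A z] by (simp add: powr_mult weight_powr)
      have "heat_potential k (\<lambda>y. ennreal ((\<kappa> * weight A y) powr \<alpha>)) (boundary_point k y) t =
          ennreal (\<kappa> powr \<alpha>) * weight_flow k (A * \<alpha>) (boundary_point k y) t"
        unfolding heat_potential_def *
        by (subst nn_integral_cmult[symmetric]) (auto simp: ennreal_mult' mult_ac intro!: nn_integral_cong)
      also have "\<dots> \<le> ennreal (\<kappa> powr \<alpha>) * ennreal (m t)"
        by (intro mult_left_mono decay t) auto
      finally show ?thesis
        by (simp add: ennreal_mult')
    qed
    show "(\<integral>\<^sup>+ s\<in>{0<..<t}. ennreal (s powr (- 1 / 2) * (\<kappa> powr \<alpha> * m s) powr ?q) \<partial>lborel) \<le>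
        ennreal (\<kappa> powr (p - \<alpha>) * I t)" if t: "t \<in> J" for t
    proof -
      have "(\<integral>\<^sup>+ s\<in>{0<..<t}. ennreal (s powr (- 1 / 2) * (\<kappa> powr \<alpha> * m s) powr ?q) \<partial>lborel) =
          (\<integral>\<^sup>+ s. ennreal (\<kappa> powr (p - \<alpha>)) * (ennreal (s powr (- 1 / 2) * m s powr ?q) * indicator {0<..<t} s) \<partial>lborel)"
      proof (intro nn_integral_cong)
        fix s
        have "s powr (- 1 / 2) * (\<kappa> powr \<alpha> * m s) powr ?q = \<kappa> powr (p - \<alpha>) * (s powr (- 1 / 2) * m s powr ?q)"
          unfolding powr_mult q by (rule mult.left_commute)
        then have "ennreal (s powr (- 1 / 2) * (\<kappa> powr \<alpha> * m s) powr ?q) =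
            ennreal (\<kappa> powr (p - \<alpha>)) * ennreal (s powr (- 1 / 2) * m s powr ?q)"
          by (simp only: ennreal_mult' powr_ge_zero)
        then show "ennreal (s powr (- 1 / 2) * (\<kappa> powr \<alpha> * m s) powr ?q) * indicator {0<..<t} s =
            ennreal (\<kappa> powr (p - \<alpha>)) * (ennreal (s powr (- 1 / 2) * m s powr ?q) * indicator {0<..<t} s)"
          by (simp only: mult.assoc)
      qed
      also have "\<dots> = ennreal (\<kappa> powr (p - \<alpha>)) * (\<integral>\<^sup>+ s\<in>{0<..<t}. ennreal (s powr (- 1 / 2) * m s powr ?q) \<partial>lborel)"
        by (intro nn_integral_cmult) measurable
      also have "\<dots> \<le> ennreal (\<kappa> powr (p - \<alpha>)) * ennreal (I t)"
        by (intro mult_left_mono I t) auto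
      finally show ?thesis
        by (simp add: ennreal_mult')
    qed
    show "2 powr (p + 1) * (\<kappa> powr (p - \<alpha>) * I t) * (\<kappa> powr \<alpha> * m t) powr ((\<alpha> - 1) / \<alpha>) \<le> 1" if t: "t \<in> J" for t
    proof -
      have "\<kappa> powr (p - \<alpha>) * \<kappa> powr (\<alpha> - 1) = \<kappa> powr (p - 1)"
        unfolding powr_add[symmetric] by simp
      then have "2 powr (p + 1) * (\<kappa> powr (p - \<alpha>) * I t) * (\<kappa> powr \<alpha> * m t) powr ((\<alpha> - 1) / \<alpha>) =
          2 powr (p + 1) * \<kappa> powr (p - 1) * I t * m t powr ((\<alpha> - 1) / \<alpha>)"
        unfolding powr_mult q by (simp add: mult_ac flip: \<open>\<kappa> powr (p - \<alpha>) * \<kappa> powr (\<alpha> - 1) = \<kappa> powr (p - 1)\<close>)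
      from this I(2)[OF t] show ?thesis
        by (rule ord_eq_le_trans)
    qed
  qed (use \<alpha> J that in auto)
qed

lemma life_span_geI:
  assumes "0 < T" "solution_on {0<..<T} k p \<phi> u"
    "\<And>w x t. solution_on {0<..<T} k p \<phi> w \<Longrightarrow> x \<in> closure (halfspace k) \<Longrightarrow> t \<in> {0<..<T} \<Longrightarrow> u x t \<le> w x t"
  shows "ereal T \<le> life_span k p \<phi>"
proof -
  have "is_minimal_solution k p \<phi> T u"
    using assms by (auto simp: is_minimal_solution_def is_solution_def)
  then show ?thesis
    unfolding life_span_def using assms(1) by (intro Sup_upper) auto
qed

text \<open>A minimal solution is in particular a solution, so upper bounds may work with any
  solution.\<close>

lemma life_span_leI:
  assumes "0 \<le> C" "\<And>T u. 0 < T \<Longrightarrow> solution_on {0<..<T} k p \<phi> u \<Longrightarrow> T \<le> C"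
  shows "life_span k p \<phi> \<le> ereal C"
  unfolding life_span_def using assms
  by (intro Sup_least) (auto simp: is_minimal_solution_def is_solution_def)

lemma powr_mult_mult_powr: "x powr a * (c * x powr b) powr q = c powr q * x powr (a + b * q)" for a b c q x :: real
  by (simp add: powr_mult powr_powr powr_add)

text \<open>Case \<alpha> = 1, where the factor with exponent (\<alpha> - 1)/\<alpha> disappears.
  The integrand in time is s to the power c - 1 with c = (1 - a (p - 1))/2, integrable at 0 because
  c > 0.\<close>

lemma life_span_ge_subcritical:
  fixes k :: "'n::finite"
  assumes \<kappa>: "0 < \<kappa>" and A: "0 \<le> A" and p: "1 < p" and T: "0 < T"
    and a: "0 \<le> a" "a * (p - 1) < 1" and \<Lambda>: "0 < \<Lambda>"
    and decay: "\<And>x t. 0 < t \<Longrightarrow> t < T \<Longrightarrow>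
      weight_flow k A x t \<le> ennreal (\<Lambda> * t powr (- a / 2))"
    and small: "2 powr (p + 1) * (\<kappa> * \<Lambda>) powr (p - 1) * T powr ((1 - a * (p - 1)) / 2) \<le> (1 - a * (p - 1)) / 2"
  shows "ereal T \<le> life_span k p (\<lambda>x. \<kappa> * weight A x)"
proof -
  define c where "c = (1 - a * (p - 1)) / 2"
  have c: "0 < c"
    using a by (simp add: c_def)
  obtain u where "solution_on {0<..<T} k p (\<lambda>x. \<kappa> * weight A x) u"
    "\<And>w x t. solution_on {0<..<T} k p (\<lambda>x. \<kappa> * weight A x) w \<Longrightarrow> x \<in> closure (halfspace k) \<Longrightarrow> t \<in> {0<..<T} \<Longrightarrow> u x t \<le> w x t"
  proof (rule minimal_solution_weight[where \<alpha> = 1 and k = k and p = p and A = A and \<kappa> = \<kappa> and J = "{0<..<T}" and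
        m = "\<lambda>s. \<Lambda> * s powr (- a / 2)" and I = "\<lambda>t. \<Lambda> powr (p - 1) * (t powr c / c)"])
    show "\<Lambda> * s' powr (- a / 2) \<le> \<Lambda> * s powr (- a / 2)" if "0 < s" "s \<le> s'" for s s'
      using that a \<Lambda> by (intro mult_left_mono powr_mono2') auto
    show "(\<integral>\<^sup>+ s\<in>{0<..<t}. ennreal (s powr (- 1 / 2) * (\<Lambda> * s powr (- a / 2)) powr ((p - 1) / 1)) \<partial>lborel) \<le>
        ennreal (\<Lambda> powr (p - 1) * (t powr c / c))" if "t \<in> {0<..<T}" for t
    proof -
      have e: "- 1 / 2 + - a / 2 * ((p - 1) / 1) = c - 1"
        by (simp add: c_def field_simps)
      have eq: "ennreal (s powr (- 1 / 2) * (\<Lambda> * s powr (- a / 2)) powr ((p - 1) / 1)) =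
          ennreal (\<Lambda> powr (p - 1)) * ennreal (s powr (c - 1))" for s
        unfolding powr_mult_mult_powr e by (simp add: ennreal_mult')
      have "(\<integral>\<^sup>+ s\<in>{0<..<t}. ennreal (s powr (- 1 / 2) * (\<Lambda> * s powr (- a / 2)) powr ((p - 1) / 1)) \<partial>lborel) =
          (\<integral>\<^sup>+ s. ennreal (\<Lambda> powr (p - 1)) * (ennreal (s powr (c - 1)) * indicator {0<..<t} s) \<partial>lborel)"
        unfolding eq mult.assoc ..
      also have "\<dots> = ennreal (\<Lambda> powr (p - 1)) * ennreal (t powr c / c)"
        using that c by (subst nn_integral_cmult) (auto simp: nn_integral_powr_from_0)
      also have "\<dots> = ennreal (\<Lambda> powr (p - 1) * (t powr c / c))"
        by (rule ennreal_mult'[symmetric]) simp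
      finally show ?thesis by simp
    qed
    show "2 powr (p + 1) * \<kappa> powr (p - 1) * (\<Lambda> powr (p - 1) * (t powr c / c)) * (\<Lambda> * t powr (- a / 2)) powr ((1 - 1) / 1) \<le> 1"
      if t: "t \<in> {0<..<T}" for t
    proof -
      have "2 powr (p + 1) * (\<kappa> * \<Lambda>) powr (p - 1) * t powr c \<le> 2 powr (p + 1) * (\<kappa> * \<Lambda>) powr (p - 1) * T powr c"
        using t c by (intro mult_left_mono powr_mono2) auto
      also have "\<dots> \<le> c"
        using small by (simp add: c_def)
      finally have "2 powr (p + 1) * (\<kappa> * \<Lambda>) powr (p - 1) * t powr c / c \<le> 1"
        using c by simp
      then show ?thesis
        using \<Lambda> t \<kappa> by (simp add: powr_mult mult_ac)
    qed
    show "weight_flow k (A * 1) x t \<le> ennreal (\<Lambda> * t powr (- a / 2))"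
      if "t \<in> {0<..<T}" for x t
      using decay[of t x] that by simp
  qed (use \<kappa> A p \<Lambda> in auto)
  then show ?thesis
    by (intro life_span_geI T) blast+
qed

text \<open>Beyond time 1 the integrand is 1/s and yields the logarithm; \<open>max 1 s\<close>
  keeps it integrable at 0, where the unit interval contributes 2.\<close>

lemma critical_time_integral:
  assumes "0 < t" "t \<le> T" "1 \<le> T"
  shows "(\<integral>\<^sup>+ s\<in>{0<..<t}. ennreal (s powr (- 1 / 2) * (max 1 s) powr (- 1 / 2)) \<partial>lborel) \<le> ennreal (2 + ln T)"
proof -
  have "(\<integral>\<^sup>+ s\<in>{0<..<t}. ennreal (s powr (- 1 / 2) * (max 1 s) powr (- 1 / 2)) \<partial>lborel) \<le>
      (\<integral>\<^sup>+ s. ennreal (s powr (- 1 / 2)) * indicator {0<..<1} s + ennreal (1 / s) * indicator {1..T} s \<partial>lborel)"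
  proof (intro nn_integral_mono)
    fix s :: real
    have "s powr (- 1 / 2) * s powr (- 1 / 2) = 1 / s" if "0 < s"
      unfolding powr_add[symmetric] using that by (simp add: powr_minus_divide)
    then show "ennreal (s powr (- 1 / 2) * (max 1 s) powr (- 1 / 2)) * indicator {0<..<t} s \<le>
        ennreal (s powr (- 1 / 2)) * indicator {0<..<1} s + ennreal (1 / s) * indicator {1..T} s"
      using assms by (auto split: split_indicator simp: max_absorb1 max_absorb2)
  qed
  also have "\<dots> = (\<integral>\<^sup>+ s\<in>{0<..<1}. ennreal (s powr (- 1 / 2)) \<partial>lborel) + (\<integral>\<^sup>+ s\<in>{1..T}. ennreal (1 / s) \<partial>lborel)"
    by (subst nn_integral_add) auto
  also have "\<dots> = ennreal 2 + ennreal (ln T)"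
    using nn_integral_inverse_Icc[of 1 T] assms by (subst nn_integral_powr_from_0) auto
  also have "\<dots> = ennreal (2 + ln T)"
    using assms by (subst ennreal_plus) auto
  finally show ?thesis .
qed

text \<open>For a (p - 1) = 1 the power \<open>t powr c\<close> of the subcritical case degenerates
  into 2 + ln T, so smallness of the data now limits ln T.\<close>

lemma life_span_ge_critical:
  fixes k :: "'n::finite"
  assumes \<kappa>: "0 < \<kappa>" and A: "0 \<le> A" and p: "1 < p" and T: "1 \<le> T"
    and a: "0 \<le> a" "a * (p - 1) = 1" and \<Lambda>: "0 < \<Lambda>"
    and decay: "\<And>x t. 0 < t \<Longrightarrow> t < T \<Longrightarrow>
      weight_flow k A x t \<le> ennreal (\<Lambda> * (max 1 t) powr (- a / 2))"
    and small: "2 powr (p + 1) * (\<kappa> * \<Lambda>) powr (p - 1) * (2 + ln T) \<le> 1"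
  shows "ereal T \<le> life_span k p (\<lambda>x. \<kappa> * weight A x)"
proof -
  obtain u where "solution_on {0<..<T} k p (\<lambda>x. \<kappa> * weight A x) u"
    "\<And>w x t. solution_on {0<..<T} k p (\<lambda>x. \<kappa> * weight A x) w \<Longrightarrow> x \<in> closure (halfspace k) \<Longrightarrow> t \<in> {0<..<T} \<Longrightarrow> u x t \<le> w x t"
  proof (rule minimal_solution_weight[where \<alpha> = 1 and k = k and p = p and A = A and \<kappa> = \<kappa> and J = "{0<..<T}" and
        m = "\<lambda>s. \<Lambda> * (max 1 s) powr (- a / 2)" and I = "\<lambda>t. \<Lambda> powr (p - 1) * (2 + ln T)"])
    show "\<Lambda> * (max 1 s') powr (- a / 2) \<le> \<Lambda> * (max 1 s) powr (- a / 2)" if "0 < s" "s \<le> s'" for s s'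
      using that a \<Lambda> by (intro mult_left_mono powr_mono2') auto
    show "(\<integral>\<^sup>+ s\<in>{0<..<t}. ennreal (s powr (- 1 / 2) * (\<Lambda> * (max 1 s) powr (- a / 2)) powr ((p - 1) / 1)) \<partial>lborel) \<le>
        ennreal (\<Lambda> powr (p - 1) * (2 + ln T))" if "t \<in> {0<..<T}" for t
    proof -
      have e: "- a / 2 * ((p - 1) / 1) = - 1 / 2"
        using a by simp
      have "s powr (- 1 / 2) * (\<Lambda> * (max 1 s) powr (- a / 2)) powr ((p - 1) / 1) =
          \<Lambda> powr (p - 1) * (s powr (- 1 / 2) * (max 1 s) powr (- 1 / 2))" for s
        unfolding powr_mult powr_powr e by simp
      then have eq: "ennreal (s powr (- 1 / 2) * (\<Lambda> * (max 1 s) powr (- a / 2)) powr ((p - 1) / 1)) =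
          ennreal (\<Lambda> powr (p - 1)) * ennreal (s powr (- 1 / 2) * (max 1 s) powr (- 1 / 2))" for s
        by (simp only: ennreal_mult' powr_ge_zero)
      have "(\<integral>\<^sup>+ s\<in>{0<..<t}. ennreal (s powr (- 1 / 2) * (\<Lambda> * (max 1 s) powr (- a / 2)) powr ((p - 1) / 1)) \<partial>lborel) =
          (\<integral>\<^sup>+ s. ennreal (\<Lambda> powr (p - 1)) * (ennreal (s powr (- 1 / 2) * (max 1 s) powr (- 1 / 2)) * indicator {0<..<t} s) \<partial>lborel)"
        unfolding eq mult.assoc ..
      also have "\<dots> = ennreal (\<Lambda> powr (p - 1)) * (\<integral>\<^sup>+ s\<in>{0<..<t}. ennreal (s powr (- 1 / 2) * (max 1 s) powr (- 1 / 2)) \<partial>lborel)"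
        by (intro nn_integral_cmult) measurable
      also have "\<dots> \<le> ennreal (\<Lambda> powr (p - 1)) * ennreal (2 + ln T)"
        using that T by (intro mult_left_mono critical_time_integral) auto
      finally show ?thesis
        by (simp add: ennreal_mult')
    qed
    show "2 powr (p + 1) * \<kappa> powr (p - 1) * (\<Lambda> powr (p - 1) * (2 + ln T)) * (\<Lambda> * (max 1 t) powr (- a / 2)) powr ((1 - 1) / 1) \<le> 1" for t
      using \<Lambda> small \<kappa> by (simp add: powr_mult mult_ac)
    show "weight_flow k (A * 1) x t \<le> ennreal (\<Lambda> * (max 1 t) powr (- a / 2))"
      if "t \<in> {0<..<T}" for x t
      using decay[of t x] that by simp
  qed (use \<kappa> A p \<Lambda> in auto)
  then show ?thesis
    using T by (intro life_span_geI) auto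
qed

lemma max_1_powr_le: "0 < t \<Longrightarrow> 0 \<le> c \<Longrightarrow> max 1 t powr (- c) \<le> t powr (- c)" for t c :: real
  by (intro powr_mono2') auto

lemma weight_antimono: "a \<le> b \<Longrightarrow> weight b y \<le> weight a y"
  unfolding weight_def by (intro powr_mono) auto

text \<open>At the scaling-critical decay \<open>A = 1 / (p - 1)\<close> the choice \<open>\<alpha> = 1\<close> produces a logarithm, while
  for \<open>\<alpha> > 1\<close> the powers of \<open>t\<close> cancel.\<close>

lemma global_solution_supercritical:
  fixes k :: "'n::finite"
  assumes p: "1 < p" "1 / (p - 1) < CARD('n)"
  obtains \<kappa>\<^sub>0 where "0 < \<kappa>\<^sub>0" "\<And>\<kappa> A. 0 < \<kappa> \<Longrightarrow> \<kappa> \<le> \<kappa>\<^sub>0 \<Longrightarrow> 1 / (p - 1) \<le> A \<Longrightarrow>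
    \<exists>u. is_global_solution k p (\<lambda>x. \<kappa> * weight A x) u"
proof -
  define A\<^sub>0 where "A\<^sub>0 = 1 / (p - 1)"
  have A0: "0 < A\<^sub>0" "A\<^sub>0 * (p - 1) = 1" "A\<^sub>0 < CARD('n)"
    using p by (auto simp: A\<^sub>0_def)
  \<comment> \<open>\<alpha> > 1 makes the exponent c below positive, \<alpha> < p is required of
    the supersolution, and \<open>A\<^sub>0 * \<alpha>\<close> < N keeps the decay rate of the flow
    equal to the exponent of the weight.\<close>
  obtain \<alpha> where \<alpha>: "1 < \<alpha>" "\<alpha> < min p (CARD('n) / A\<^sub>0)"
    using dense[of 1 "min p (CARD('n) / A\<^sub>0)"] p A0 by (auto simp: pos_less_divide_eq)
  define b where "b = A\<^sub>0 * \<alpha>"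
  have b: "0 < b" "b < CARD('n)"
    using \<alpha> A0 by (auto simp: b_def field_simps)
  obtain C where C: "1 \<le> C" "\<And>x t. 0 < t \<Longrightarrow>
      weight_flow k b x t \<le> ennreal (C * (max 1 t) powr (- min b CARD('n) / 2))"
    using heat_potential_weight_decay_neq[of b k] b by auto
  \<comment> \<open>The time integral equals a constant times \<open>t powr c / c\<close>, while
    \<open>m t powr ((\<alpha> - 1) / \<alpha>)\<close> is a constant times
    \<open>t powr (- c)\<close>; the product does not depend on t, so one \<kappa> serves all
    times.\<close>
  define c where "c = A\<^sub>0 * (\<alpha> - 1) / 2"
  have c: "0 < c"
    using \<alpha> A0 by (simp add: c_def)
  let ?q = "(p - \<alpha>) / \<alpha>" and ?r = "(\<alpha> - 1) / \<alpha>"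
  define D where "D = 2 powr (p + 1) * (C powr ?q / c) * C powr ?r"
  have D: "0 < D"
    using C c by (simp add: D_def)
  define \<kappa>\<^sub>0 where "\<kappa>\<^sub>0 = (1 / D) powr (1 / (p - 1))"
  show ?thesis
  proof (rule that[of \<kappa>\<^sub>0])
    show "0 < \<kappa>\<^sub>0"
      using D by (simp add: \<kappa>\<^sub>0_def)
    fix \<kappa> A :: real assume \<kappa>: "0 < \<kappa>" "\<kappa> \<le> \<kappa>\<^sub>0" and A: "1 / (p - 1) \<le> A"
    have "\<kappa> powr (p - 1) \<le> \<kappa>\<^sub>0 powr (p - 1)"
      using \<kappa> p by (intro powr_mono2) auto
    also have "\<dots> = 1 / D"
      using p D by (simp add: \<kappa>\<^sub>0_def powr_powr)
    finally have \<kappa>D: "\<kappa> powr (p - 1) * D \<le> 1"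
      using D by (simp add: field_simps)
    obtain u where "solution_on {0<..} k p (\<lambda>x. \<kappa> * weight A x) u"
    proof (rule minimal_solution_weight[where \<alpha> = \<alpha> and k = k and p = p and A = A and \<kappa> = \<kappa> and J = "{0<..}" and
          m = "\<lambda>s. C * s powr (- b / 2)" and I = "\<lambda>t. C powr ?q * (t powr c / c)"])
      show "C * s' powr (- b / 2) \<le> C * s powr (- b / 2)" if "0 < s" "s \<le> s'" for s s'
        using that b C by (intro mult_left_mono powr_mono2') auto
      show "(\<integral>\<^sup>+ s\<in>{0<..<t}. ennreal (s powr (- 1 / 2) * (C * s powr (- b / 2)) powr ?q) \<partial>lborel) \<le>
          ennreal (C powr ?q * (t powr c / c))" if "t \<in> {0<..}" for t
      proof -
        have "b * ?q = A\<^sub>0 * (p - \<alpha>)"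
          using \<alpha> by (simp add: b_def)
        also have "\<dots> = A\<^sub>0 * (p - 1) - 2 * c"
          by (simp add: c_def) (simp add: algebra_simps)
        finally have bq: "b * ?q = 1 - 2 * c"
          unfolding A0(2) .
        have "- 1 / 2 + - (b * ?q) / 2 = c - 1"
          unfolding bq by (simp add: field_simps)
        then have e: "- 1 / 2 + - b / 2 * ?q = c - 1"
          by (simp only: times_divide_eq_left mult_minus_left)
        have eq: "ennreal (s powr (- 1 / 2) * (C * s powr (- b / 2)) powr ?q) =
            ennreal (C powr ?q) * ennreal (s powr (c - 1))" for s
          unfolding powr_mult_mult_powr e by (rule ennreal_mult') simp
        have "(\<integral>\<^sup>+ s\<in>{0<..<t}. ennreal (s powr (- 1 / 2) * (C * s powr (- b / 2)) powr ?q) \<partial>lborel) =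
            (\<integral>\<^sup>+ s. ennreal (C powr ?q) * (ennreal (s powr (c - 1)) * indicator {0<..<t} s) \<partial>lborel)"
          unfolding eq mult.assoc ..
        also have "\<dots> = ennreal (C powr ?q) * ennreal (t powr c / c)"
          using that c by (subst nn_integral_cmult) (auto simp: nn_integral_powr_from_0)
        also have "\<dots> = ennreal (C powr ?q * (t powr c / c))"
          by (rule ennreal_mult'[symmetric]) simp
        finally show ?thesis by simp
      qed
      show "2 powr (p + 1) * \<kappa> powr (p - 1) * (C powr ?q * (t powr c / c)) * (C * t powr (- b / 2)) powr ?r \<le> 1"
        if t: "t \<in> {0<..}" for t
      proof -
        have e: "b / 2 * ?r = c"
          using \<alpha> by (simp add: b_def c_def)
        have "(C * t powr (- b / 2)) powr ?r = C powr ?r * t powr (- (b / 2 * ?r))"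
          using C by (simp add: powr_mult powr_powr)
        also have "\<dots> = C powr ?r * t powr (- c)"
          unfolding e ..
        finally have "2 powr (p + 1) * \<kappa> powr (p - 1) * (C powr ?q * (t powr c / c)) * (C * t powr (- b / 2)) powr ?r =
            \<kappa> powr (p - 1) * D * (t powr c * t powr (- c))"
          by (simp add: D_def)
        also have "t powr c * t powr (- c) = 1"
          using t by (simp add: powr_add[symmetric])
        finally show ?thesis
          using \<kappa>D by simp
      qed
      show "weight_flow k (A * \<alpha>) x t \<le> ennreal (C * t powr (- b / 2))"
        if t: "t \<in> {0<..}" for x t
      proof -
        \<comment> \<open>Faster decaying data lie below the borderline weight, so the estimate for
          \<open>A\<^sub>0\<close> covers all larger A with the same
          \<open>\<kappa>\<^sub>0\<close>.\<close>
        have "b \<le> A * \<alpha>"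
          using mult_right_mono[OF A, of \<alpha>] \<alpha> by (simp add: b_def A\<^sub>0_def)
        then have "weight_flow k (A * \<alpha>) x t \<le> weight_flow k b x t"
          by (intro heat_potential_mono ennreal_leI weight_antimono)
        also have "\<dots> \<le> ennreal (C * (max 1 t) powr (- min b CARD('n) / 2))"
          using t by (intro C) auto
        also have "\<dots> \<le> ennreal (C * t powr (- b / 2))"
          using max_1_powr_le[of t "b / 2"] t b C by (intro ennreal_leI mult_left_mono) auto
        finally show ?thesis .
      qed
      show "0 \<le> A"
        using A A0(1) unfolding A\<^sub>0_def by linarith
    qed (use \<kappa> \<alpha> C in auto)
    then show "\<exists>u. is_global_solution k p (\<lambda>x. \<kappa> * weight A x) u"
      unfolding is_global_solution_def by blast
  qed
qed

section \<open>Upper bounds of the life span\<close>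

text \<open>Cubes instead of balls, because their indicator is a product over the coordinates and
  the integral of the kernel over them factorises. For N = 1 the condition is void.\<close>

definition boundary_box :: "'n::finite \<Rightarrow> real \<Rightarrow> ('n \<Rightarrow> real) set" where
  "boundary_box k \<rho> = {y. \<forall>i\<in>UNIV - {k}. y i \<in> {-\<rho>..\<rho>}}"

lemma indicator_boundary_box:
  "(indicator (boundary_box k \<rho>) y :: ennreal) = (\<Prod>i\<in>UNIV - {k}. indicator {-\<rho>..\<rho>} (y i))"
proof (cases "y \<in> boundary_box k \<rho>")
  case True
  then have "(\<Prod>i\<in>UNIV - {k}. indicator {-\<rho>..\<rho>} (y i) :: ennreal) = 1"
    unfolding boundary_box_def by (intro prod.neutral) auto
  then show ?thesis
    using True by simp
next
  case False
  then obtain i where "i \<in> UNIV - {k}" "y i \<notin> {-\<rho>..\<rho>}"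
    unfolding boundary_box_def by blast
  then have "(\<Prod>i\<in>UNIV - {k}. indicator {-\<rho>..\<rho>} (y i) :: ennreal) = 0"
    by (intro prod_zero) (auto intro!: bexI[of _ i])
  then show ?thesis
    using False by simp
qed

lemma boundary_boxD: "y \<in> boundary_box k \<rho> \<Longrightarrow> i \<noteq> k \<Longrightarrow> \<bar>y i\<bar> \<le> \<rho>"
  by (force simp: boundary_box_def abs_le_iff)

lemma boundary_box_mono: "\<rho> \<le> \<rho>' \<Longrightarrow> boundary_box k \<rho> \<subseteq> boundary_box k \<rho>'"
  by (force simp: boundary_box_def)

lemma tangential_kernel_box_ge:
  fixes k :: "'n::finite"
  assumes t: "0 < t" and c: "0 \<le> c"
    and le: "\<And>i. i \<noteq> k \<Longrightarrow> ennreal c \<le> (\<integral>\<^sup>+ r\<in>{-\<rho>..\<rho>}. ennreal (heat_kernel t (x $ i - r)) \<partial>lborel)"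
  shows "ennreal (c ^ (CARD('n) - 1)) \<le>
    (\<integral>\<^sup>+ z\<in>boundary_box k \<rho>. ennreal (tangential_kernel k t x (boundary_point k z)) \<partial>boundary_measure k)"
proof -
  have "ennreal (c ^ (CARD('n) - 1)) = (\<Prod>i\<in>UNIV - {k}. ennreal c)"
    using c by (simp add: ennreal_power card_Diff_singleton)
  also have "\<dots> \<le> (\<Prod>i\<in>UNIV - {k}. \<integral>\<^sup>+ r\<in>{-\<rho>..\<rho>}. ennreal (heat_kernel t (x $ i - r)) \<partial>lborel)"
  proof -
    have "(\<Prod>i\<in>I. ennreal c) \<le> (\<Prod>i\<in>I. \<integral>\<^sup>+ r\<in>{-\<rho>..\<rho>}. ennreal (heat_kernel t (x $ i - r)) \<partial>lborel)"
      if "finite I" "I \<subseteq> UNIV - {k}" for I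
      using that by (induction I rule: finite_induct) (auto intro!: mult_mono le simp del: prod_constant)
    from this[OF _ order_refl] show ?thesis by simp
  qed
  also have "\<dots> = (\<integral>\<^sup>+ z. (\<Prod>i\<in>UNIV - {k}. ennreal (heat_kernel t (x $ i - z i)) * indicator {-\<rho>..\<rho>} (z i))
      \<partial>boundary_measure k)"
    by (rule nn_integral_boundary_prod[symmetric]) measurable
  also have "\<dots> = (\<integral>\<^sup>+ z\<in>boundary_box k \<rho>. ennreal (tangential_kernel k t x (boundary_point k z)) \<partial>boundary_measure k)"
    using t by (intro nn_integral_cong)
      (simp add: indicator_boundary_box prod.distrib tangential_kernel_def prod_ennreal)
  finally show ?thesis .
qed

lemma nn_integral_Icc_ge:
  fixes f :: "real \<Rightarrow> ennreal"
  assumes "a \<le> b" "\<And>r. a \<le> r \<Longrightarrow> r \<le> b \<Longrightarrow> ennreal c \<le> f r" "{a..b} \<subseteq> S" "0 \<le> c"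
  shows "ennreal (c * (b - a)) \<le> (\<integral>\<^sup>+ r\<in>S. f r \<partial>lborel)"
proof -
  have "ennreal (c * (b - a)) = (\<integral>\<^sup>+ r. ennreal c * indicator {a..b} r \<partial>lborel)"
    using assms by (simp add: nn_integral_cmult_indicator ennreal_mult)
  also have "\<dots> \<le> (\<integral>\<^sup>+ r\<in>S. f r \<partial>lborel)"
    using assms by (intro nn_integral_mono) (auto split: split_indicator)
  finally show ?thesis .
qed

text \<open>This is the interior cone condition: the bound does not deteriorate at the end points of the
  interval, so the boxes need not shrink in the iteration of \<open>blow_up_bound\<close>.\<close>

lemma heat_kernel_interval_ge:
  assumes t: "0 < t" "t \<le> \<rho>\<^sup>2" "0 \<le> \<rho>" and x: "\<bar>x\<bar> \<le> \<rho>"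
  shows "ennreal (exp (- 1 / 4) / sqrt (4 * pi)) \<le> (\<integral>\<^sup>+ r\<in>{-\<rho>..\<rho>}. ennreal (heat_kernel t (x - r)) \<partial>lborel)"
proof -
  have st: "sqrt t \<le> \<rho>"
    using t by (intro real_le_lsqrt) auto
  \<comment> \<open>The interval of length \<open>sqrt t\<close> that starts at x and points towards
    the origin; it stays inside [-\<rho>, \<rho>] because \<open>sqrt t\<close> \<le>
    \<rho>.\<close>
  define a where "a = (if 0 \<le> x then x - sqrt t else x)"
  have "exp (- 1 / 4) / sqrt (4 * pi * t) \<le> heat_kernel t (x - r)" if "a \<le> r" "r \<le> a + sqrt t" for r
  proof -
    have "\<bar>x - r\<bar> \<le> sqrt t"
      using that by (auto simp: a_def split: if_splits)
    then have "(x - r)\<^sup>2 \<le> t"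
      using t by (metis abs_le_square_iff real_sqrt_abs2 abs_of_nonneg real_sqrt_ge_zero less_imp_le real_sqrt_pow2)
    then have "exp (- 1 / 4) \<le> exp (- (x - r)\<^sup>2 / (4 * t))"
      using t by (simp add: field_simps)
    then show ?thesis
      unfolding heat_kernel_def using t by (intro divide_right_mono) auto
  qed
  then have "ennreal (exp (- 1 / 4) / sqrt (4 * pi * t) * (a + sqrt t - a)) \<le>
      (\<integral>\<^sup>+ r\<in>{-\<rho>..\<rho>}. ennreal (heat_kernel t (x - r)) \<partial>lborel)"
    using t x st by (intro nn_integral_Icc_ge ennreal_leI) (auto simp: a_def)
  also have "exp (- 1 / 4) / sqrt (4 * pi * t) * (a + sqrt t - a) = exp (- 1 / 4) / sqrt (4 * pi)"
    using t by (simp add: real_sqrt_mult)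
  finally show ?thesis .
qed

text \<open>Drops the initial datum and all boundary values outside a space-time region. Box and
  lower bound may vary with s, and S' may stay below t: the blow-up argument integrates up to t on a
  fixed box, the doubling argument up to t/2 on boxes of size \<open>sqrt s\<close>.\<close>

lemma solution_boundary_ge:
  assumes w: "solution_on {0<..<T} k p \<phi> w" and t: "0 < t" "t < T" and p: "0 \<le> p"
    and S: "0 \<le> S" "S' \<le> t"
    and a: "\<And>s z. S < s \<Longrightarrow> s < S' \<Longrightarrow> z \<in> boundary_box k (\<rho> s) \<Longrightarrow> a s \<le> w (boundary_point k z) s"
      "\<And>s. S < s \<Longrightarrow> s < S' \<Longrightarrow> 0 \<le> a s"
    and c: "\<And>s. S < s \<Longrightarrow> s < S' \<Longrightarrow> ennreal (c s) \<le>
      (\<integral>\<^sup>+ z\<in>boundary_box k (\<rho> s). ennreal (tangential_kernel k (t - s) (boundary_point k y) (boundary_point k z)) \<partial>boundary_measure k)"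
  shows "(\<integral>\<^sup>+ s\<in>{S<..<S'}. ennreal (2 * heat_kernel (t - s) 0 * c s * a s powr p) \<partial>lborel) \<le> ennreal (w (boundary_point k y) t)"
proof -
  let ?x = "boundary_point k y"
  have "(\<integral>\<^sup>+ s\<in>{S<..<S'}. ennreal (2 * heat_kernel (t - s) 0 * c s * a s powr p) \<partial>lborel) \<le>
      boundary_potential k (\<lambda>y s. ennreal (w (boundary_point k y) s powr p)) ?x t"
    unfolding boundary_potential_def
  proof (intro nn_integral_mono)
    fix s
    have "ennreal (2 * heat_kernel (t - s) 0 * c s * a s powr p) \<le>
        (\<integral>\<^sup>+ z. ennreal (neumann_green k ?x (boundary_point k z) (t - s)) * ennreal (w (boundary_point k z) s powr p) \<partial>boundary_measure k)"
      if s: "S < s" "s < S'"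
    proof -
      let ?g = "\<lambda>z. ennreal (tangential_kernel k (t - s) ?x (boundary_point k z)) * indicator (boundary_box k (\<rho> s)) z"
      let ?d = "ennreal (2 * heat_kernel (t - s) 0 * a s powr p)"
      have [measurable]: "(indicator (boundary_box k (\<rho> s)) :: _ \<Rightarrow> ennreal) \<in> borel_measurable (boundary_measure k)"
        unfolding indicator_boundary_box[abs_def] boundary_measure_def by measurable
      have st: "s < t"
        using s S by simp
      have "ennreal (2 * heat_kernel (t - s) 0 * c s * a s powr p) = ?d * ennreal (c s)"
        using st by (subst ennreal_mult'[symmetric]) (auto simp: mult_ac)
      also have "\<dots> \<le> ?d * (\<integral>\<^sup>+ z. ?g z \<partial>boundary_measure k)"
        by (intro mult_left_mono c s) auto
      also have "\<dots> = (\<integral>\<^sup>+ z. ?d * ?g z \<partial>boundary_measure k)"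
        by (rule nn_integral_cmult[symmetric]) measurable
      also have "\<dots> \<le> (\<integral>\<^sup>+ z. ennreal (neumann_green k ?x (boundary_point k z) (t - s)) * ennreal (w (boundary_point k z) s powr p) \<partial>boundary_measure k)"
      proof (intro nn_integral_mono)
        fix z
        show "?d * ?g z \<le> ennreal (neumann_green k ?x (boundary_point k z) (t - s)) * ennreal (w (boundary_point k z) s powr p)"
        proof (cases "z \<in> boundary_box k (\<rho> s)")
          case True
          have "?d * ?g z = ennreal (neumann_green k ?x (boundary_point k z) (t - s)) * ennreal (a s powr p)"
            using True st by (simp add: neumann_green_boundary ennreal_mult' mult_ac)
          also have "\<dots> \<le> ennreal (neumann_green k ?x (boundary_point k z) (t - s)) * ennreal (w (boundary_point k z) s powr p)"
            using a[OF s] True p by (intro mult_left_mono ennreal_leI powr_mono2) auto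
          finally show ?thesis .
        qed simp
      qed
      finally show ?thesis .
    qed
    then show "ennreal (2 * heat_kernel (t - s) 0 * c s * a s powr p) * indicator {S<..<S'} s \<le>
        (\<integral>\<^sup>+ z. ennreal (neumann_green k ?x (boundary_point k z) (t - s)) * ennreal (w (boundary_point k z) s powr p) \<partial>boundary_measure k)
          * indicator {0<..<t} s"
      using S by (auto split: split_indicator)
  qed
  also have "\<dots> \<le> ennreal (w ?x t)"
    using t by (subst solution_on_integral_equation[OF w]) (auto simp: potential_def)
  finally show ?thesis .
qed

lemma solution_nonneg: "solution_on J k p \<phi> w \<Longrightarrow> x \<in> closure (halfspace k) \<Longrightarrow> t \<in> J \<Longrightarrow> 0 \<le> w x t"
  by (simp add: solution_on_def)

text \<open>From step to step the lower bound is multiplied by \<open>2 powr m\<close> with m = 1/(p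
  - 1), while the available time is halved. Since m p = m + 1, raising \<open>2 powr (m * n)\<close>
  to the power p produces a surplus of 2 to the n, which pays for the shrinking step. The solution
  would therefore be unbounded at time 2R, where it is still defined.\<close>

lemma blow_up_bound:
  fixes k :: "'n::finite"
  assumes p: "1 < p"
  obtains K where "0 < K" "\<And>T \<phi> w R a. solution_on {0<..<T} k p \<phi> w \<Longrightarrow> 0 < R \<Longrightarrow> 2 * R < T \<Longrightarrow> 0 < a \<Longrightarrow>
    (\<And>s z. R \<le> s \<Longrightarrow> s \<le> 2 * R \<Longrightarrow> z \<in> boundary_box k (sqrt R) \<Longrightarrow> a \<le> w (boundary_point k z) s) \<Longrightarrow>
    K * sqrt R * a powr (p - 1) \<le> 1"
proof -
  define c\<^sub>1 where "c\<^sub>1 = exp (- 1 / 4) / sqrt (4 * pi)"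
  define c\<^sub>2 where "c\<^sub>2 = c\<^sub>1 ^ (CARD('n) - 1) / sqrt pi"
  define m where "m = 1 / (p - 1)"
  have c1: "0 < c\<^sub>1" by (simp add: c\<^sub>1_def)
  have c2: "0 < c\<^sub>2" using c1 by (simp add: c\<^sub>2_def)
  have m: "0 < m" "m * p = m + 1"
    using p by (auto simp: m_def field_simps)
  show ?thesis
  proof (rule that[of "c\<^sub>2 / 2 powr (m + 1)"])
    show "0 < c\<^sub>2 / 2 powr (m + 1)"
      using c2 by simp
    fix T \<phi> w R a
    assume w: "solution_on {0<..<T} k p \<phi> w" and R: "0 < R" "2 * R < T" and a: "0 < (a::real)"
      and le: "\<And>s z. R \<le> s \<Longrightarrow> s \<le> 2 * R \<Longrightarrow> z \<in> boundary_box k (sqrt R) \<Longrightarrow> a \<le> w (boundary_point k z) s"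
    show "c\<^sub>2 / 2 powr (m + 1) * sqrt R * a powr (p - 1) \<le> 1"
    proof (rule ccontr)
      assume "\<not> ?thesis"
      then have big: "2 powr (m + 1) \<le> c\<^sub>2 * sqrt R * a powr (p - 1)"
        by (simp add: field_simps)
      \<comment> \<open>Starting times increasing from R to 2R with step lengths R/2, R/4, and so
        on.\<close>
      define \<tau> where "\<tau> = (\<lambda>n. 2 * R - R / 2 ^ n)"
      have \<tau>: "R \<le> \<tau> n" "\<tau> n < 2 * R" "\<tau> (Suc n) - \<tau> n = R / 2 ^ Suc n" for n
        using R one_le_power[of "2::real" n] by (auto simp: \<tau>_def field_simps)
      have step: "a * 2 powr (m * n) \<le> w (boundary_point k y) t"
        if "\<tau> n \<le> t" "t \<le> 2 * R" "y \<in> boundary_box k (sqrt R)" for n y t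
        using that
      proof (induction n arbitrary: t y)
        case 0
        then show ?case
          using le by (simp add: \<tau>_def)
      next
        case (Suc n)
        let ?b = "a * 2 powr (m * n)"
        let ?c = "\<lambda>s::real. c\<^sub>1 ^ (CARD('n) - 1)"
        have t: "\<tau> n < t" "0 < t" "t < T"
        proof -
          have "0 < R / 2 ^ Suc n"
            using R by simp
          then show "\<tau> n < t"
            using \<tau>(3)[of n] Suc.prems(1) by linarith
          then show "0 < t" "t < T"
            using \<tau>(1)[of n] Suc.prems(2) R by linarith+
        qed
        have b: "0 \<le> ?b"
          using a by simp
        \<comment> \<open>A bound for the integrand uniform in s: the times in play differ by at
          most R, so the normal kernel is at least \<open>1 / sqrt (pi * R)\<close>.\<close>
        define d where "d = 1 / sqrt (pi * R) * c\<^sub>1 ^ (CARD('n) - 1) * ?b powr p"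
        have d: "0 \<le> d"
          using c1 R by (simp add: d_def)
        have "ennreal (d * (t - \<tau> n)) = (\<integral>\<^sup>+ s. ennreal d * indicator {\<tau> n<..<t} s \<partial>lborel)"
          using t d by (simp add: nn_integral_cmult_indicator ennreal_mult)
        also have "\<dots> \<le> (\<integral>\<^sup>+ s\<in>{\<tau> n<..<t}. ennreal (2 * heat_kernel (t - s) 0 * ?c s * ?b powr p) \<partial>lborel)"
        proof (intro nn_integral_mono)
          fix s
          have "d \<le> 2 * heat_kernel (t - s) 0 * ?c s * ?b powr p" if s: "\<tau> n < s" "s < t"
          proof -
            have "2 * heat_kernel (t - s) 0 = 1 / sqrt (pi * (t - s))"
              using s by (simp add: heat_kernel_def real_sqrt_mult)
            moreover have "1 / sqrt (pi * R) \<le> 1 / sqrt (pi * (t - s))"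
              using s \<tau>(1)[of n] Suc.prems R by (intro divide_left_mono) auto
            ultimately show ?thesis
              unfolding d_def using c1 by (intro mult_right_mono) auto
          qed
          then show "ennreal d * indicator {\<tau> n<..<t} s \<le> ennreal (2 * heat_kernel (t - s) 0 * ?c s * ?b powr p) * indicator {\<tau> n<..<t} s"
            by (auto split: split_indicator intro: ennreal_leI)
        qed
        also have "\<dots> \<le> ennreal (w (boundary_point k y) t)"
        proof (rule solution_boundary_ge[OF w t(2,3), where \<rho> = "\<lambda>_. sqrt R"])
          show "?b \<le> w (boundary_point k z) s" if "\<tau> n < s" "s < t" "z \<in> boundary_box k (sqrt R)" for s z
            using that Suc.prems by (intro Suc.IH) auto
          show "ennreal (?c s) \<le> (\<integral>\<^sup>+ z\<in>boundary_box k (sqrt R).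
              ennreal (tangential_kernel k (t - s) (boundary_point k y) (boundary_point k z)) \<partial>boundary_measure k)"
            if "\<tau> n < s" "s < t" for s
          proof (rule tangential_kernel_box_ge)
            fix i assume "i \<noteq> k"
            then have "\<bar>y i\<bar> \<le> sqrt R"
              using boundary_boxD[OF Suc.prems(3)] by simp
            then show "ennreal c\<^sub>1 \<le> (\<integral>\<^sup>+ r\<in>{- sqrt R..sqrt R}. ennreal (heat_kernel (t - s) (boundary_point k y $ i - r)) \<partial>lborel)"
              unfolding c\<^sub>1_def using \<open>i \<noteq> k\<close> that \<tau>(1)[of n] Suc.prems(2) R
              by (simp only: boundary_point_nth if_False) (intro heat_kernel_interval_ge, auto)
          qed (use that c1 in auto)
        qed (use p b \<tau>(1)[of n] R in auto)
        finally have "d * (t - \<tau> n) \<le> w (boundary_point k y) t"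
          using solution_nonneg[OF w boundary_point_in, of t] t by (subst (asm) ennreal_le_iff) auto
        moreover have "a * 2 powr (m * Suc n) \<le> d * (t - \<tau> n)"
        proof -
          have e1: "?b powr p = a * 2 powr (m * n) * (a powr (p - 1) * 2 ^ n)"
          proof -
            have "?b powr p = a powr p * 2 powr (m * p * n)"
              by (simp add: powr_mult powr_powr mult_ac)
            also have "\<dots> = a powr (1 + (p - 1)) * 2 powr (m * n + n)"
              unfolding m(2) by (simp add: distrib_right)
            also have "\<dots> = a * 2 powr (m * n) * (a powr (p - 1) * 2 ^ n)"
              using a unfolding powr_add by (simp add: powr_realpow)
            finally show ?thesis .
          qed
          have e2: "1 / sqrt (pi * R) * R = sqrt R / sqrt pi"
            using R by (simp add: real_sqrt_mult field_simps)
          have "2 powr (m * Suc n) = 2 powr (m * n) * 2 powr m"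
            by (simp add: powr_add[symmetric] distrib_left add_ac)
          then have "a * 2 powr (m * Suc n) = a * 2 powr (m * n) * (2 powr (m + 1) / 2)"
            by (simp add: powr_add)
          also have "\<dots> \<le> a * 2 powr (m * n) * (c\<^sub>2 * sqrt R * a powr (p - 1) / 2)"
            using big a by (intro mult_left_mono divide_right_mono) auto
          also have "\<dots> = (1 / sqrt (pi * R) * R) * c\<^sub>1 ^ (CARD('n) - 1) * ?b powr p / 2 ^ Suc n"
            unfolding e1 e2 c\<^sub>2_def by (simp add: field_simps)
          also have "\<dots> = d * (R / 2 ^ Suc n)"
            unfolding d_def by simp
          also have "\<dots> \<le> d * (t - \<tau> n)"
            using \<tau>(3)[of n] Suc.prems(1) d by (intro mult_left_mono) auto
          finally show ?thesis .
        qed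
        ultimately show ?case by linarith
      qed
      \<comment> \<open>The value at the origin at time 2R is a real number, yet it dominates a
        geometric progression.\<close>
      obtain n where n: "w (boundary_point k (\<lambda>_. 0)) (2 * R) / a < (2 powr m) ^ n"
        using real_arch_pow[of "2 powr m"] m by (auto simp: gr_one_powr)
      have "(2 powr m) ^ n = 2 powr (m * n)"
        by (simp add: powr_realpow[symmetric] powr_powr)
      moreover have "a * 2 powr (m * n) \<le> w (boundary_point k (\<lambda>_. 0)) (2 * R)"
        using \<tau>(2)[of n] R by (intro step) (auto simp: boundary_box_def)
      ultimately show False
        using n a by (simp add: field_simps)
    qed
  qed
qed

text \<open>Only the datum in the half ball is kept, and the mirror term of the kernel is dropped.
  The squared distance of the two points is at most 2 (N + 1) R and t \<ge> R, which bounds the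
  exponent by (N + 1)/2; t \<le> 2R gives the prefactor with 8 pi.\<close>

lemma solution_initial_ge:
  fixes k :: "'n::finite"
  defines "c\<^sub>3 \<equiv> (8 * pi) powr (- real CARD('n) / 2) * exp (- (real CARD('n) + 1) / 2)"
  assumes w: "solution_on {0<..<T} k p (\<lambda>x. \<kappa> * weight A x) w" and \<kappa>: "0 < \<kappa>"
    and R: "0 < R" "R \<le> t" "t \<le> 2 * R" "t < T" and y: "y \<in> boundary_box k (sqrt R)"
    and M: "0 \<le> M" "ennreal M \<le> half_ball_mass k A (sqrt R)"
  shows "c\<^sub>3 * \<kappa> * M * R powr (- real CARD('n) / 2) \<le> w (boundary_point k y) t"
proof -
  let ?x = "boundary_point k y" and ?N = "real CARD('n)"
  let ?D = "closure (halfspace k)"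
  have [measurable]: "cball (0 :: real ^ 'n) (sqrt R) \<in> sets borel"
    by simp
  have c3: "0 \<le> c\<^sub>3"
    by (simp add: c\<^sub>3_def)
  have x: "(norm ?x)\<^sup>2 \<le> ?N * R"
  proof -
    have "(norm ?x)\<^sup>2 = (\<Sum>i\<in>UNIV. (?x $ i)\<^sup>2)"
      by (simp only: power2_norm_eq_inner inner_vec_def) (simp add: power2_eq_square)
    also have "\<dots> \<le> (\<Sum>i\<in>(UNIV :: 'n set). R)"
    proof (intro sum_mono)
      fix i
      have "\<bar>?x $ i\<bar> \<le> sqrt R"
        using boundary_boxD[OF y, of i] R by simp
      then have "(?x $ i)\<^sup>2 \<le> (sqrt R)\<^sup>2"
        by (simp add: abs_le_square_iff[symmetric] R)
      then show "(?x $ i)\<^sup>2 \<le> R"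
        using R by simp
    qed
    finally show ?thesis by simp
  qed
  have G: "c\<^sub>3 * R powr (- ?N / 2) \<le> neumann_green k ?x v t" if "norm v \<le> sqrt R" for v
  proof -
    have v: "(norm v)\<^sup>2 \<le> R"
      using power_mono[OF that norm_ge_zero, of 2] R by simp
    have "(norm (?x - v))\<^sup>2 \<le> (norm ?x + norm v)\<^sup>2"
      by (intro power_mono norm_triangle_ineq4) auto
    also have "\<dots> \<le> 2 * (norm ?x)\<^sup>2 + 2 * (norm v)\<^sup>2"
      using sum_squares_bound[of "norm ?x" "norm v"] by (simp add: power2_sum)
    also have "\<dots> \<le> 2 * (?N + 1) * R"
      using x v by (simp add: algebra_simps)
    also have "\<dots> \<le> 2 * (?N + 1) * t"
      using R by (intro mult_left_mono) auto
    finally have "(norm (?x - v))\<^sup>2 / (4 * t) \<le> (?N + 1) / 2"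
      using R by (simp add: field_simps)
    then have e: "exp (- (?N + 1) / 2) \<le> exp (- (norm (?x - v))\<^sup>2 / (4 * t))"
      by simp
    have "(8 * pi * R) powr (- ?N / 2) \<le> (4 * pi * t) powr (- ?N / 2)"
      using R by (intro powr_mono2') auto
    then have "(8 * pi * R) powr (- ?N / 2) * exp (- (?N + 1) / 2) \<le>
        (4 * pi * t) powr (- ?N / 2) * (exp (- (norm (?x - v))\<^sup>2 / (4 * t)) + exp (- (norm (?x - reflect k v))\<^sup>2 / (4 * t)))"
      using e by (intro mult_mono) (auto intro: add_increasing2)
    then show ?thesis
      by (simp add: neumann_green_def c\<^sub>3_def powr_mult mult_ac)
  qed
  have "ennreal (c\<^sub>3 * \<kappa> * M * R powr (- ?N / 2)) = ennreal (c\<^sub>3 * R powr (- ?N / 2) * \<kappa>) * ennreal M"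
    using M \<kappa> c3 by (simp add: ennreal_mult'[symmetric] mult_ac)
  also have "\<dots> \<le> ennreal (c\<^sub>3 * R powr (- ?N / 2) * \<kappa>) * (\<integral>\<^sup>+ v\<in>?D \<inter> cball 0 (sqrt R). ennreal (weight A v) \<partial>lborel)"
    by (intro mult_left_mono M) auto
  also have "\<dots> = (\<integral>\<^sup>+ v. ennreal (c\<^sub>3 * R powr (- ?N / 2) * \<kappa>) * (ennreal (weight A v) * indicator (?D \<inter> cball 0 (sqrt R)) v) \<partial>lborel)"
    by (rule nn_integral_cmult[symmetric]) measurable
  also have "\<dots> \<le> heat_potential k (\<lambda>v. ennreal (\<kappa> * weight A v)) ?x t"
    unfolding heat_potential_def
  proof (intro nn_integral_mono)
    fix v
    show "ennreal (c\<^sub>3 * R powr (- ?N / 2) * \<kappa>) * (ennreal (weight A v) * indicator (?D \<inter> cball 0 (sqrt R)) v) \<le>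
        ennreal (neumann_green k ?x v t) * ennreal (\<kappa> * weight A v) * indicator ?D v"
    proof (cases "v \<in> ?D \<inter> cball 0 (sqrt R)")
      case True
      have "c\<^sub>3 * R powr (- ?N / 2) * \<kappa> * weight A v \<le> neumann_green k ?x v t * \<kappa> * weight A v"
        using True \<kappa> weight_pos[of A v] G[of v] by (intro mult_right_mono) auto
      then show ?thesis
        using True \<kappa> c3 by (simp add: ennreal_mult'[symmetric] ennreal_leI mult.assoc)
    qed auto
  qed
  also have "\<dots> \<le> ennreal (w ?x t)"
    using R by (subst solution_on_integral_equation[OF w]) (auto simp: potential_def)
  finally show ?thesis
    using solution_nonneg[OF w boundary_point_in, of t] R by (subst (asm) ennreal_le_iff) auto
qed

text \<open>The kernel from time s to t integrates over the box of size \<open>sqrt s\<close> to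
  about \<open>s powr ((N - 1) / 2) * t powr (- N / 2)\<close>, and the nonlinearity is
  \<open>\<mu> powr p * s powr (- (N + 1) / 2)\<close> because N p = N + 1. Their product is
  \<open>\<mu> powr p * t powr (- N / 2)\<close> times 1/s, so integration over [S, t/2] gains ln (t
  / (2 S)). This reaches 2 \<mu> as soon as the logarithm is a multiple of
  \<open>\<mu> powr (1 - p)\<close>.\<close>

lemma critical_doubling:
  fixes k :: "'n::finite"
  assumes p: "p = 1 + 1 / real CARD('n)"
  obtains K where "0 < K" "\<And>T \<phi> w S \<mu> t y. solution_on {0<..<T} k p \<phi> w \<Longrightarrow> 0 < S \<Longrightarrow> 0 < \<mu> \<Longrightarrow>
    (\<And>s z. S \<le> s \<Longrightarrow> s < T \<Longrightarrow> z \<in> boundary_box k (sqrt s) \<Longrightarrow>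
      \<mu> * s powr (- real CARD('n) / 2) \<le> w (boundary_point k z) s) \<Longrightarrow>
    2 * S * exp (K * \<mu> powr (1 - p)) \<le> t \<Longrightarrow> t < T \<Longrightarrow> y \<in> boundary_box k (sqrt t) \<Longrightarrow>
      2 * \<mu> * t powr (- real CARD('n) / 2) \<le> w (boundary_point k y) t"
proof -
  let ?N = "real CARD('n)"
  have N: "1 \<le> CARD('n)" "1 \<le> ?N"
    by (simp_all add: Suc_leI)
  have p1: "1 < p" "?N * p = ?N + 1"
    using N by (auto simp: p field_simps)
  \<comment> \<open>Collects \<open>2 / sqrt (4 * pi * t)\<close> from the normal direction and, for
    each tangential direction, the length \<open>2 * sqrt s\<close> of the interval times the
    minimum \<open>exp (- 2) / sqrt (4 * pi * t)\<close> of the kernel; the powers of s and t are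
    split off.\<close>
  define c\<^sub>4 where "c\<^sub>4 = 2 * (4 * pi) powr (- ?N / 2) * (2 * exp (- 2)) ^ (CARD('n) - 1)"
  have c4: "0 < c\<^sub>4"
    by (simp add: c\<^sub>4_def)
  show ?thesis
  proof (rule that[of "2 / c\<^sub>4"])
    show "0 < 2 / c\<^sub>4"
      using c4 by simp
    fix T \<phi> w S \<mu> t y
    assume w: "solution_on {0<..<T} k p \<phi> w" and S: "0 < S" and \<mu>: "0 < (\<mu>::real)"
      and le: "\<And>s z. S \<le> s \<Longrightarrow> s < T \<Longrightarrow> z \<in> boundary_box k (sqrt s) \<Longrightarrow> \<mu> * s powr (- ?N / 2) \<le> w (boundary_point k z) s"
      and t: "2 * S * exp (2 / c\<^sub>4 * \<mu> powr (1 - p)) \<le> t" "t < T" and y: "y \<in> boundary_box k (sqrt t)"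
    have "2 * S * 1 \<le> 2 * S * exp (2 / c\<^sub>4 * \<mu> powr (1 - p))"
      using S c4 by (intro mult_left_mono) auto
    then have "2 * S \<le> t"
      using t by linarith
    then have tS: "S \<le> t / 2" "0 < t"
      using S by auto
    let ?c = "\<lambda>s. (exp (- 2) / sqrt (4 * pi * t) * (2 * sqrt s)) ^ (CARD('n) - 1)"
    let ?a = "\<lambda>s. \<mu> * s powr (- ?N / 2)"
    define d where "d = c\<^sub>4 * t powr (- ?N / 2) * \<mu> powr p"
    have d: "0 \<le> d"
      using c4 by (simp add: d_def)
    have "ennreal (d * ln (t / 2 / S)) = (\<integral>\<^sup>+ s. ennreal d * (ennreal (1 / s) * indicator {S..t / 2} s) \<partial>lborel)"
      using nn_integral_inverse_Icc[OF S tS(1)] d by (subst nn_integral_cmult) (auto simp: ennreal_mult')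
    also have "\<dots> \<le> (\<integral>\<^sup>+ s\<in>{S<..<t / 2}. ennreal (2 * heat_kernel (t - s) 0 * ?c s * ?a s powr p) \<partial>lborel)"
    proof (intro nn_integral_mono_AE eventually_mono[OF eventually_conj[OF AE_lborel_singleton[of S] AE_lborel_singleton[of "t / 2"]]])
      fix s assume s': "s \<noteq> S \<and> s \<noteq> t / 2"
      have "d * (1 / s) \<le> 2 * heat_kernel (t - s) 0 * ?c s * ?a s powr p" if s: "S < s" "s < t / 2"
      proof -
        have s0: "0 < s"
          using s S by simp
        have "2 / sqrt (4 * pi * t) \<le> 2 / sqrt (4 * pi * (t - s))"
          using s s0 by (intro divide_left_mono) auto
        also have "\<dots> = 2 * heat_kernel (t - s) 0"
          by (simp add: heat_kernel_def)
        finally have h: "2 / sqrt (4 * pi * t) \<le> 2 * heat_kernel (t - s) 0" .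
        have tp: "sqrt (4 * pi * t) = (4 * pi * t) powr (1 / 2)"
          using tS by (simp add: powr_half_sqrt)
        have e1: "2 / sqrt (4 * pi * t) * ?c s = c\<^sub>4 * t powr (- ?N / 2) * s powr ((?N - 1) / 2)"
        proof -
          have "2 / sqrt (4 * pi * t) * ?c s = 2 * (2 * exp (- 2)) ^ (CARD('n) - 1) * sqrt s ^ (CARD('n) - 1) /
              (sqrt (4 * pi * t) * sqrt (4 * pi * t) ^ (CARD('n) - 1))"
            by (simp add: power_mult_distrib power_divide)
          also have "sqrt (4 * pi * t) * sqrt (4 * pi * t) ^ (CARD('n) - 1) = sqrt (4 * pi * t) ^ CARD('n)"
            using N by (simp add: power_Suc[symmetric] del: power_Suc)
          also have "\<dots> = (4 * pi * t) powr (?N / 2)"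
            using tS by (intro sqrt_pow_powr) simp
          also have "sqrt s ^ (CARD('n) - 1) = s powr ((?N - 1) / 2)"
            using s0 N by (subst sqrt_pow_powr) (auto simp: of_nat_diff)
          finally show ?thesis
            by (simp add: c\<^sub>4_def powr_mult powr_minus field_simps)
        qed
        have e2: "?a s powr p = \<mu> powr p * s powr (- (?N + 1) / 2)"
        proof -
          have "- ?N / 2 * p = - (?N + 1) / 2"
            using p1(2) by (simp add: field_simps)
          then show ?thesis
            by (simp only: powr_mult powr_powr)
        qed
        have "s powr ((?N - 1) / 2) * s powr (- (?N + 1) / 2) = s powr (- 1)"
          unfolding powr_add[symmetric] by (rule arg_cong[where f = "\<lambda>c. s powr c"]) (simp add: field_simps)
        also have "\<dots> = 1 / s"
          using s0 by (simp add: powr_minus_divide)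
        finally have e3: "s powr ((?N - 1) / 2) * s powr (- (?N + 1) / 2) = 1 / s" .
        have "d * (1 / s) = 2 / sqrt (4 * pi * t) * ?c s * ?a s powr p"
          unfolding e1 e2 e3[symmetric] d_def by (simp only: mult_ac)
        also have "\<dots> \<le> 2 * heat_kernel (t - s) 0 * ?c s * ?a s powr p"
          using h s0 tS by (intro mult_right_mono) auto
        finally show ?thesis .
      qed
      then show "ennreal d * (ennreal (1 / s) * indicator {S..t / 2} s) \<le>
          ennreal (2 * heat_kernel (t - s) 0 * ?c s * ?a s powr p) * indicator {S<..<t / 2} s"
        using s' d by (auto split: split_indicator simp: ennreal_mult'[symmetric] intro!: ennreal_leI)
    qed
    also have "\<dots> \<le> ennreal (w (boundary_point k y) t)"
    proof (rule solution_boundary_ge[OF w tS(2) t(2), where \<rho> = sqrt])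
      show "?a s \<le> w (boundary_point k z) s" if "S < s" "s < t / 2" "z \<in> boundary_box k (sqrt s)" for s z
        using that t tS by (intro le) auto
      show "0 \<le> ?a s" for s
        using \<mu> by simp
      show "ennreal (?c s) \<le> (\<integral>\<^sup>+ z\<in>boundary_box k (sqrt s).
          ennreal (tangential_kernel k (t - s) (boundary_point k y) (boundary_point k z)) \<partial>boundary_measure k)"
        if s: "S < s" "s < t / 2" for s
      proof (rule tangential_kernel_box_ge)
        fix i assume i: "i \<noteq> k"
        have yi: "\<bar>y i\<bar> \<le> sqrt t"
          using boundary_boxD[OF y i] .
        \<comment> \<open>Both points lie within \<open>sqrt t\<close> of the origin and t - s >
          t/2, so the squared distance is at most 4t \<le> 8 (t - s).\<close>
        have "exp (- 2) / sqrt (4 * pi * t) \<le> heat_kernel (t - s) (y i - r)" if r: "- sqrt s \<le> r" "r \<le> sqrt s" for r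
        proof -
          have "sqrt s \<le> sqrt t"
            using s tS by simp
          then have "\<bar>y i - r\<bar> \<le> 2 * sqrt t"
            using r yi by linarith
          then have "(y i - r)\<^sup>2 \<le> (2 * sqrt t)\<^sup>2"
            by (subst abs_le_square_iff[symmetric]) (use tS in auto)
          also have "\<dots> = 4 * t"
            using tS by (simp add: power_mult_distrib)
          also have "\<dots> \<le> 8 * (t - s)"
            using s by simp
          finally have "(y i - r)\<^sup>2 / (4 * (t - s)) \<le> 2"
            using s tS S by (simp add: field_simps)
          then have e: "exp (- 2) \<le> exp (- (y i - r)\<^sup>2 / (4 * (t - s)))"
            by simp
          have "1 / sqrt (4 * pi * t) \<le> 1 / sqrt (4 * pi * (t - s))"
            using s S tS by (intro divide_left_mono) auto
          then have "exp (- 2) * (1 / sqrt (4 * pi * t)) \<le> exp (- (y i - r)\<^sup>2 / (4 * (t - s))) * (1 / sqrt (4 * pi * (t - s)))"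
            using e tS by (intro mult_mono) auto
          then show ?thesis
            by (simp add: heat_kernel_def)
        qed
        then have "ennreal (exp (- 2) / sqrt (4 * pi * t) * (sqrt s - - sqrt s)) \<le>
            (\<integral>\<^sup>+ r\<in>{- sqrt s..sqrt s}. ennreal (heat_kernel (t - s) (y i - r)) \<partial>lborel)"
          using s S tS by (intro nn_integral_Icc_ge ennreal_leI) auto
        then show "ennreal (exp (- 2) / sqrt (4 * pi * t) * (2 * sqrt s)) \<le>
            (\<integral>\<^sup>+ r\<in>{- sqrt s..sqrt s}. ennreal (heat_kernel (t - s) (boundary_point k y $ i - r)) \<partial>lborel)"
          using i by simp
      qed (use s S tS in auto)
    qed (use p1 S tS in auto)
    finally have ge: "d * ln (t / 2 / S) \<le> w (boundary_point k y) t"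
      using solution_nonneg[OF w boundary_point_in, of t] t tS by (subst (asm) ennreal_le_iff) auto
    have "2 / c\<^sub>4 * \<mu> powr (1 - p) = ln (exp (2 / c\<^sub>4 * \<mu> powr (1 - p)))"
      by simp
    also have "\<dots> \<le> ln (t / 2 / S)"
      using t S tS by (subst ln_le_cancel_iff) (auto simp: field_simps)
    finally have "d * (2 / c\<^sub>4 * \<mu> powr (1 - p)) \<le> d * ln (t / 2 / S)"
      using d by (intro mult_left_mono)
    moreover have "d * (2 / c\<^sub>4 * \<mu> powr (1 - p)) = 2 * \<mu> * t powr (- ?N / 2)"
    proof -
      have "\<mu> powr p * \<mu> powr (1 - p) = \<mu>"
        using \<mu> by (simp add: powr_add[symmetric])
      moreover have "d * (2 / c\<^sub>4 * \<mu> powr (1 - p)) = 2 * t powr (- ?N / 2) * (\<mu> powr p * \<mu> powr (1 - p))"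
        using c4 by (simp add: d_def)
      ultimately show ?thesis
        by simp
    qed
    ultimately show "2 * \<mu> * t powr (- ?N / 2) \<le> w (boundary_point k y) t"
      using ge by linarith
  qed
qed

text \<open>Since N (p - 1) = 1, the blow-up criterion applied to
  \<open>\<mu> * t powr (- N / 2)\<close> does not involve t: existence ends soon after \<mu> has
  passed a fixed threshold B. It remains to add up the logarithmic time of the doublings needed to
  get from \<mu> to B.\<close>

lemma critical_bound:
  fixes k :: "'n::finite"
  assumes p: "p = 1 + 1 / real CARD('n)"
  obtains C where "0 < C" "\<And>T \<phi> w S \<mu>. solution_on {0<..<T} k p \<phi> w \<Longrightarrow> 0 < S \<Longrightarrow> 0 < \<mu> \<Longrightarrow>
    (\<And>s z. S \<le> s \<Longrightarrow> s < T \<Longrightarrow> z \<in> boundary_box k (sqrt s) \<Longrightarrow>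
      \<mu> * s powr (- real CARD('n) / 2) \<le> w (boundary_point k z) s) \<Longrightarrow>
    T \<le> 2 * S * exp (C * \<mu> powr (1 - p))"
proof -
  let ?N = "real CARD('n)"
  have N: "1 \<le> CARD('n)" "1 \<le> ?N"
    by (simp_all add: Suc_leI)
  have p1: "1 < p" "?N * (p - 1) = 1"
    using N by (auto simp: p field_simps)
  obtain K where K: "0 < K" and doubling: "\<And>T \<phi> w S \<mu> t y. solution_on {0<..<T} k p \<phi> w \<Longrightarrow> 0 < S \<Longrightarrow> 0 < \<mu> \<Longrightarrow>
    (\<And>s z. S \<le> s \<Longrightarrow> s < T \<Longrightarrow> z \<in> boundary_box k (sqrt s) \<Longrightarrow> \<mu> * s powr (- ?N / 2) \<le> w (boundary_point k z) s) \<Longrightarrow>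
    2 * S * exp (K * \<mu> powr (1 - p)) \<le> t \<Longrightarrow> t < T \<Longrightarrow> y \<in> boundary_box k (sqrt t) \<Longrightarrow>
      2 * \<mu> * t powr (- ?N / 2) \<le> w (boundary_point k y) t"
    using critical_doubling[OF p, of k] by blast
  obtain L where L: "0 < L" and blow: "\<And>T \<phi> w R a. solution_on {0<..<T} k p \<phi> w \<Longrightarrow> 0 < R \<Longrightarrow> 2 * R < T \<Longrightarrow> 0 < a \<Longrightarrow>
    (\<And>s z. R \<le> s \<Longrightarrow> s \<le> 2 * R \<Longrightarrow> z \<in> boundary_box k (sqrt R) \<Longrightarrow> a \<le> w (boundary_point k z) s) \<Longrightarrow>
    L * sqrt R * a powr (p - 1) \<le> 1"
    using blow_up_bound[OF p1(1), of k] by blast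
  \<comment> \<open>Doubling \<mu> multiplies the waiting time \<open>\<mu> powr (1 - p)\<close> by
    q < 1.\<close>
  define q where "q = 2 powr (1 - p)"
  have q: "0 < q" "q < 1"
    using p1 by (auto simp: q_def powr_less_one)
  \<comment> \<open>For \<mu> > B one has L \<open>\<mu> powr (p - 1)\<close> > 2, while the blow-up
    bound allows only \<open>sqrt 2\<close>.\<close>
  define B where "B = (2 / L) powr ?N"
  have B: "0 < B"
    using L by (simp add: B_def)
  \<comment> \<open>The first summand is the geometric series of waiting times, the second pays for
    the factor 2 in time lost at each doubling.\<close>
  define C where "C = K / (1 - q) + (2 * B) powr (p - 1) / (p - 1)"
  have C: "0 < C"
    using K q p1 by (auto simp: C_def intro!: add_pos_nonneg)
  show ?thesis
  proof (rule that[OF C])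
    fix T \<phi> w S \<mu>
    assume w: "solution_on {0<..<T} k p \<phi> w" and S: "0 < S" and \<mu>: "0 < (\<mu>::real)"
      and le: "\<And>s z. S \<le> s \<Longrightarrow> s < T \<Longrightarrow> z \<in> boundary_box k (sqrt s) \<Longrightarrow> \<mu> * s powr (- ?N / 2) \<le> w (boundary_point k z) s"
    define E where "E = (\<lambda>n. \<Sum>j<n. K * \<mu> powr (1 - p) * q ^ j)"
    \<comment> \<open>The time from which on n doublings have taken effect.\<close>
    define \<sigma> where "\<sigma> = (\<lambda>n. S * 2 ^ n * exp (E n))"
    have \<sigma>0: "0 < \<sigma> n" for n
      using S by (simp add: \<sigma>_def)
    have iter: "\<mu> * 2 ^ n * s powr (- ?N / 2) \<le> w (boundary_point k z) s"
      if "\<sigma> n \<le> s" "s < T" "z \<in> boundary_box k (sqrt s)" for n s z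
      using that
    proof (induction n arbitrary: s z)
      case 0
      then show ?case
        using le by (simp add: \<sigma>_def E_def)
    next
      case (Suc n)
      have "(\<mu> * 2 ^ n) powr (1 - p) = \<mu> powr (1 - p) * q ^ n"
        using \<mu> by (simp add: powr_mult q_def powr_realpow[symmetric] powr_powr mult.commute)
      then have "2 * \<sigma> n * exp (K * (\<mu> * 2 ^ n) powr (1 - p)) = \<sigma> (Suc n)"
        by (simp add: \<sigma>_def E_def exp_add mult_ac)
      then have "2 * (\<mu> * 2 ^ n) * s powr (- ?N / 2) \<le> w (boundary_point k z) s"
        using doubling[OF w \<sigma>0[of n], of "\<mu> * 2 ^ n" s z] Suc \<mu> by simp
      then show ?case
        by (simp add: mult_ac)
    qed
    have E: "E n \<le> K / (1 - q) * \<mu> powr (1 - p)" for n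
    proof -
      have "(\<Sum>j<n. q ^ j) \<le> 1 / (1 - q)"
        using q sum_gp_strict[of q n] by (auto simp: divide_right_mono)
      then have "K * \<mu> powr (1 - p) * (\<Sum>j<n. q ^ j) \<le> K * \<mu> powr (1 - p) * (1 / (1 - q))"
        using K by (intro mult_left_mono) auto
      then show ?thesis
        unfolding E_def sum_distrib_left[symmetric] by simp
    qed
    have stop: "T \<le> 2 * \<sigma> n" if n: "B < \<mu> * 2 ^ n" for n
    proof (rule ccontr)
      assume T: "\<not> T \<le> 2 * \<sigma> n"
      let ?\<mu> = "\<mu> * 2 ^ n"
      let ?a = "?\<mu> * (2 * \<sigma> n) powr (- ?N / 2)"
      have m0: "0 < ?\<mu>"
        using \<mu> by simp
      have "L * sqrt (\<sigma> n) * ?a powr (p - 1) \<le> 1"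
      proof (rule blow[OF w \<sigma>0])
        show "0 < ?a"
          using m0 \<sigma>0[of n] by simp
        fix s z assume s: "\<sigma> n \<le> s" "s \<le> 2 * \<sigma> n" and z: "z \<in> boundary_box k (sqrt (\<sigma> n))"
        have "?a \<le> ?\<mu> * s powr (- ?N / 2)"
          using m0 s \<sigma>0[of n] by (intro mult_left_mono powr_mono2') auto
        also have "\<dots> \<le> w (boundary_point k z) s"
          using s T z boundary_box_mono[of "sqrt (\<sigma> n)" "sqrt s" k] by (intro iter) auto
        finally show "?a \<le> w (boundary_point k z) s" .
      qed (use T in auto)
      also have "?a powr (p - 1) = ?\<mu> powr (p - 1) * (2 * \<sigma> n) powr (- 1 / 2)"
      proof -
        have "- ?N / 2 * (p - 1) = - 1 / 2"
          using p1(2) by (simp add: field_simps)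
        then show ?thesis
          by (simp only: powr_mult powr_powr)
      qed
      also have "(2 * \<sigma> n) powr (- 1 / 2) = 1 / (sqrt 2 * sqrt (\<sigma> n))"
        using \<sigma>0[of n] by (simp add: powr_minus_divide powr_half_sqrt real_sqrt_mult)
      also have "L * sqrt (\<sigma> n) * (?\<mu> powr (p - 1) * (1 / (sqrt 2 * sqrt (\<sigma> n)))) = L * ?\<mu> powr (p - 1) / sqrt 2"
        using \<sigma>0[of n] by simp
      finally have "L * ?\<mu> powr (p - 1) \<le> sqrt 2"
        by (simp add: field_simps)
      moreover have "2 / L = B powr (p - 1)"
        using L p1(2) by (simp add: B_def powr_powr)
      moreover have "L * B powr (p - 1) < L * ?\<mu> powr (p - 1)"
        using n B p1 L by (intro mult_strict_left_mono powr_less_mono2) auto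
      moreover have "sqrt 2 < (2::real)"
        using sqrt2_less_2 by simp
      ultimately show False
        using L by (simp add: field_simps)
    qed
    define n where "n = (LEAST n. B < \<mu> * 2 ^ n)"
    have "\<exists>n. B < \<mu> * 2 ^ n"
      using real_arch_pow[of 2 "B / \<mu>"] \<mu> by (auto simp: field_simps)
    then have n: "B < \<mu> * 2 ^ n"
      unfolding n_def by (rule LeastI_ex)
    \<comment> \<open>By minimality of n, \<open>2 ^ n\<close> is at most 2B/\<mu> unless n = 0; its
      logarithm is then bounded by a power through ln x \<le> \<open>x powr c / c\<close> with c = p
      - 1, so that it has the same form as the series.\<close>
    have n_ln: "real n * ln 2 \<le> (2 * B) powr (p - 1) / (p - 1) * \<mu> powr (1 - p)"
    proof (cases n)
      case (Suc m)
      have "\<not> B < \<mu> * 2 ^ m"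
        using not_less_Least[of m "\<lambda>n. B < \<mu> * 2 ^ n"] Suc unfolding n_def by simp
      then have ge: "2 ^ n \<le> 2 * B / \<mu>"
        using \<mu> Suc by (simp add: field_simps)
      then have "ln (2 ^ n) \<le> ln (2 * B / \<mu>)"
        using B \<mu> by (subst ln_le_cancel_iff) auto
      also have "\<dots> \<le> (2 * B / \<mu>) powr (p - 1) / (p - 1)"
        using order_trans[OF two_realpow_ge_one ge] p1 by (intro ln_powr_bound) auto
      also have "(2 * B / \<mu>) powr (p - 1) = (2 * B) powr (p - 1) * \<mu> powr (1 - p)"
        using B \<mu> by (simp add: powr_divide powr_diff field_simps)
      finally show ?thesis
        by (simp add: ln_realpow)
    qed (use p1 in auto)
    have "T \<le> 2 * \<sigma> n"
      by (rule stop) fact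
    also have "\<sigma> n = S * exp (real n * ln 2 + E n)"
      by (simp add: \<sigma>_def exp_add exp_of_nat_mult)
    also have "\<dots> \<le> S * exp (C * \<mu> powr (1 - p))"
      using n_ln E[of n] S by (intro mult_left_mono) (auto simp: C_def algebra_simps)
    finally show "T \<le> 2 * S * exp (C * \<mu> powr (1 - p))"
      by simp
  qed
qed

section \<open>Lower bounds for the mass of the datum in half balls\<close>

lemma half_ball_measure_ge:
  fixes k :: "'n::finite"
  assumes "0 \<le> \<rho>"
  shows "ennreal (unit_ball_vol CARD('n) * (\<rho> / 2) ^ CARD('n)) \<le> emeasure lborel (closure (halfspace k) \<inter> cball 0 \<rho>)"
proof -
  let ?c = "(\<rho> / 2) *\<^sub>R axis k 1 :: real ^ 'n"
  \<comment> \<open>The half ball contains the ball of half the radius that touches the boundary at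
    the origin.\<close>
  have "cball ?c (\<rho> / 2) \<subseteq> closure (halfspace k) \<inter> cball 0 \<rho>"
  proof
    fix v assume v: "v \<in> cball ?c (\<rho> / 2)"
    then have d: "norm (?c - v) \<le> \<rho> / 2"
      by (simp add: dist_norm)
    have "\<bar>(?c - v) $ k\<bar> \<le> \<rho> / 2"
      using component_le_norm_cart[of "?c - v" k] d by linarith
    moreover have "(?c - v) $ k = \<rho> / 2 - v $ k"
      by (simp add: axis_def)
    ultimately have "0 \<le> v $ k"
      by linarith
    have "norm v \<le> norm ?c + norm (?c - v)"
      using norm_triangle_ineq4[of ?c "?c - v"] by simp
    moreover have "norm ?c = \<rho> / 2"
      using assms by simp
    ultimately have "norm v \<le> \<rho>"
      using d by linarith
    with \<open>0 \<le> v $ k\<close> show "v \<in> closure (halfspace k) \<inter> cball 0 \<rho>"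
      by (simp add: closure_halfspace)
  qed
  moreover have "emeasure lborel (cball ?c (\<rho> / 2)) = ennreal (unit_ball_vol CARD('n) * (\<rho> / 2) ^ CARD('n))"
    using assms by (subst emeasure_cball) auto
  ultimately show ?thesis
    by (metis emeasure_mono sets_closure_halfspace sets.Int borel_closed closed_cball sets_lborel)
qed

text \<open>For A \<le> N the minimum of the weight times the volume already has the right order;
  for A > N the mass is of order 1 and the unit half ball suffices.\<close>

lemma weight_mass_ge:
  fixes k :: "'n::finite" and A :: real
  assumes A: "0 \<le> A"
  obtains c where "0 < c" "\<And>\<rho>. 1 \<le> \<rho> \<Longrightarrow>
    ennreal (c * \<rho> powr (CARD('n) - min A CARD('n))) \<le> half_ball_mass k A \<rho>"
proof -
  let ?N = "real CARD('n)"
  define c where "c = unit_ball_vol ?N * 2 powr (- A) * (1 / 2) ^ CARD('n)"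
  have c: "0 < c"
    by (simp add: c_def)
  have E [measurable]: "closure (halfspace k) \<inter> cball 0 \<rho> \<in> sets borel" for \<rho>
    by (intro sets.Int) auto
  have 1: "ennreal (c * \<rho> powr (?N - A)) \<le> half_ball_mass k A \<rho>"
    if \<rho>: "1 \<le> \<rho>" for \<rho>
  proof -
    have "c * \<rho> powr (?N - A) = (2 * \<rho>) powr (- A) * (unit_ball_vol ?N * (\<rho> / 2) ^ CARD('n))"
      using \<rho> by (simp add: c_def powr_mult powr_diff powr_minus powr_realpow power_divide field_simps)
    then have "ennreal (c * \<rho> powr (?N - A)) = ennreal ((2 * \<rho>) powr (- A)) * ennreal (unit_ball_vol ?N * (\<rho> / 2) ^ CARD('n))"
      by (simp add: ennreal_mult')
    also have "\<dots> \<le> ennreal ((2 * \<rho>) powr (- A)) * emeasure lborel (closure (halfspace k) \<inter> cball 0 \<rho>)"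
      using \<rho> by (intro mult_left_mono half_ball_measure_ge) auto
    also have "\<dots> = (\<integral>\<^sup>+ v. ennreal ((2 * \<rho>) powr (- A)) * indicator (closure (halfspace k) \<inter> cball 0 \<rho>) v \<partial>lborel)"
      using E[of \<rho>] by (subst nn_integral_cmult_indicator) auto
    also have "\<dots> \<le> half_ball_mass k A \<rho>"
    proof (intro nn_integral_mono)
      fix v :: "real ^ 'n"
      have "(2 * \<rho>) powr (- A) \<le> weight A v" if "norm v \<le> \<rho>"
        unfolding weight_def using that \<rho> A by (intro powr_mono2') (auto simp: add_pos_nonneg)
      then show "ennreal ((2 * \<rho>) powr (- A)) * indicator (closure (halfspace k) \<inter> cball 0 \<rho>) v \<le>
          ennreal (weight A v) * indicator (closure (halfspace k) \<inter> cball 0 \<rho>) v"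
        by (auto split: split_indicator intro: ennreal_leI)
    qed
    finally show ?thesis .
  qed
  show ?thesis
  proof (rule that[OF c])
    fix \<rho> :: real assume \<rho>: "1 \<le> \<rho>"
    show "ennreal (c * \<rho> powr (?N - min A ?N)) \<le> half_ball_mass k A \<rho>"
    proof (cases "A \<le> ?N")
      case True
      then show ?thesis
        using 1[OF \<rho>] by simp
    next
      case False
      have "ennreal (c * \<rho> powr (?N - min A ?N)) = ennreal (c * 1 powr (?N - A))"
        using False \<rho> by simp
      also have "\<dots> \<le> half_ball_mass k A 1"
        by (rule 1) simp
      also have "\<dots> \<le> half_ball_mass k A \<rho>"
        using \<rho> by (intro nn_integral_mono) (auto split: split_indicator)
      finally show ?thesis .
    qed
  qed
qed

text \<open>For A = N the minimum times the volume would lose the logarithm. The layer-cake formula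
  keeps it: the shell at radius r contributes about 1/r.\<close>

lemma weight_mass_critical_ge:
  fixes k :: "'n::finite"
  obtains c where "0 < c" "\<And>\<rho>. 1 \<le> \<rho> \<Longrightarrow>
    ennreal (c * ln \<rho>) \<le> half_ball_mass k CARD('n) \<rho>"
proof -
  let ?N = "real CARD('n)" and ?D = "closure (halfspace k)"
  define c where "c = ?N * unit_ball_vol ?N * 2 powr (- ?N - 1) * (1 / 2) ^ CARD('n)"
  have c: "0 < c"
    by (simp add: c_def)
  show ?thesis
  proof (rule that[OF c])
    fix \<rho> :: real assume \<rho>: "1 \<le> \<rho>"
    let ?f = "\<lambda>r. ennreal (?N * (1 + r) powr (- ?N - 1)) * emeasure lborel ((?D \<inter> cball 0 \<rho>) \<inter> cball 0 r)"
    have [measurable]: "?D \<inter> cball 0 \<rho> \<in> sets borel"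
      by (intro sets.Int) auto
    have "ennreal (c * ln \<rho>) = (\<integral>\<^sup>+ r. ennreal c * (ennreal (1 / r) * indicator {1..\<rho>} r) \<partial>lborel)"
      using nn_integral_inverse_Icc[of 1 \<rho>] \<rho> c by (subst nn_integral_cmult) (auto simp: ennreal_mult')
    also have "\<dots> \<le> (\<integral>\<^sup>+ r\<in>{0..\<rho>}. ?f r \<partial>lborel)"
    proof (intro nn_integral_mono)
      fix r
      have "ennreal (c * (1 / r)) \<le> ?f r" if r: "1 \<le> r" "r \<le> \<rho>"
      proof -
        have "c * (1 / r) = ?N * (2 * r) powr (- ?N - 1) * (unit_ball_vol ?N * (r / 2) ^ CARD('n))"
          using r by (simp add: c_def powr_mult powr_diff powr_minus powr_realpow power_divide field_simps)
        also have "\<dots> \<le> ?N * (1 + r) powr (- ?N - 1) * (unit_ball_vol ?N * (r / 2) ^ CARD('n))"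
          using r by (intro mult_right_mono mult_left_mono powr_mono2') auto
        finally have "ennreal (c * (1 / r)) \<le> ennreal (?N * (1 + r) powr (- ?N - 1)) * ennreal (unit_ball_vol ?N * (r / 2) ^ CARD('n))"
          by (simp add: ennreal_mult'[symmetric] ennreal_leI)
        also have "\<dots> \<le> ennreal (?N * (1 + r) powr (- ?N - 1)) * emeasure lborel (?D \<inter> cball 0 r)"
          using r by (intro mult_left_mono half_ball_measure_ge) auto
        also have "?D \<inter> cball 0 r = (?D \<inter> cball 0 \<rho>) \<inter> cball 0 r"
          using r by auto
        finally show ?thesis .
      qed
      then show "ennreal c * (ennreal (1 / r) * indicator {1..\<rho>} r) \<le> ?f r * indicator {0..\<rho>} r"
        using c by (auto split: split_indicator simp: ennreal_mult'[symmetric])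
    qed
    also have "\<dots> \<le> (\<integral>\<^sup>+ v\<in>?D \<inter> cball 0 \<rho>. ennreal ((1 + norm v) powr (- ?N)) \<partial>lborel)"
      by (subst weight_layer_cake[where R = \<rho>]) auto
    finally show "ennreal (c * ln \<rho>) \<le> (\<integral>\<^sup>+ v\<in>?D \<inter> cball 0 \<rho>. ennreal (weight ?N v) \<partial>lborel)"
      by (simp add: weight_def)
  qed
qed

section \<open>Asymptotics of the life span\<close>

lemma sim_at_0I:
  assumes "0 < c" "0 < C"
    and "\<forall>\<^sub>F \<tau> in at_right 0. 0 \<le> g \<tau>"
    and "\<forall>\<^sub>F \<tau> in at_right 0. ereal (c * g \<tau>) \<le> f \<tau>"
    and "\<forall>\<^sub>F \<tau> in at_right 0. f \<tau> \<le> ereal (C * g \<tau>)"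
  shows "sim_at_0 f g"
  unfolding sim_at_0_def
proof (intro exI[of _ "max (inverse c) C"] conjI)
  show "0 < max (inverse c) C"
    using assms by simp
  have le: "inverse (max (inverse c) C) \<le> c"
    using assms by (metis inverse_inverse_eq le_imp_inverse_le max.cobounded1 positive_imp_inverse_positive)
  show "\<forall>\<^sub>F \<tau> in at_right 0. ereal (inverse (max (inverse c) C) * g \<tau>) \<le> f \<tau> \<and> f \<tau> \<le> ereal (max (inverse c) C * g \<tau>)"
    using assms(3-5)
  proof eventually_elim
    case (elim \<tau>)
    have "ereal (inverse (max (inverse c) C) * g \<tau>) \<le> ereal (c * g \<tau>)"
      using le elim(1) by (simp add: mult_right_mono)
    moreover have "ereal (C * g \<tau>) \<le> ereal (max (inverse c) C * g \<tau>)"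
      using elim(1) by (simp add: mult_right_mono)
    ultimately show ?case
      using elim(2,3) by (blast intro: order_trans)
  qed
qed

lemma eventually_at_right_0_le: "0 < c \<Longrightarrow> \<forall>\<^sub>F \<kappa> in at_right 0. 0 < \<kappa> \<and> \<kappa> \<le> c" for c :: real
  by (rule eventually_mono[OF eventually_at_right_real[of 0 c]]) auto

lemma ln_extended_ge: "ereal (exp a) \<le> x \<Longrightarrow> ereal a \<le> ln_extended x"
proof (cases x)
  case (real r)
  moreover assume "ereal (exp a) \<le> x"
  ultimately have "exp a \<le> r"
    by simp
  moreover have "0 < r"
    using exp_gt_zero[of a] \<open>exp a \<le> r\<close> by linarith
  ultimately show ?thesis
    using real by (simp add: ln_extended_def ln_ge_iff)
qed (auto simp: ln_extended_def)

lemma ln_extended_le: "x \<le> ereal (exp b) \<Longrightarrow> ln_extended x \<le> ereal b"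
proof (cases x)
  case (real r)
  moreover assume "x \<le> ereal (exp b)"
  ultimately show ?thesis
    by (cases "r \<le> 0") (auto simp: ln_extended_def ln_le_cancel_iff[of r "exp b", simplified])
qed (auto simp: ln_extended_def)

text \<open>The smallness condition of the subcritical bound raised to the power 1/(p - 1), where (1
  - a (p - 1))/2 = (p - 1) \<theta>. The constant \<delta> is independent of the amplitude
  \<Lambda>, which for A = N depends on T.\<close>

lemma life_span_ge_scaled:
  fixes k :: "'n::finite"
  assumes p: "1 < p" and a: "0 \<le> a"
  defines "\<theta> \<equiv> 1 / (2 * (p - 1)) - a / 2"
  assumes \<theta>: "0 < \<theta>"
  obtains \<delta> where "0 < \<delta>" "\<And>\<kappa> \<Lambda> T A. 0 < \<kappa> \<Longrightarrow> 0 \<le> A \<Longrightarrow> 0 < \<Lambda> \<Longrightarrow> 0 < T \<Longrightarrow>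
    (\<And>x t. 0 < t \<Longrightarrow> t < T \<Longrightarrow> weight_flow k A x t \<le> ennreal (\<Lambda> * t powr (- a / 2))) \<Longrightarrow>
    \<kappa> * \<Lambda> * T powr \<theta> \<le> \<delta> \<Longrightarrow> ereal T \<le> life_span k p (\<lambda>x. \<kappa> * weight A x)"
proof -
  define \<delta> where "\<delta> = ((p - 1) * \<theta> / 2 powr (p + 1)) powr (1 / (p - 1))"
  have c: "(1 - a * (p - 1)) / 2 = (p - 1) * \<theta>"
    using p by (simp add: \<theta>_def right_diff_distrib) (simp add: field_simps)
  show ?thesis
  proof (rule that[of \<delta>])
    show "0 < \<delta>"
      using p \<theta> by (simp add: \<delta>_def)
    fix \<kappa> \<Lambda> T A :: real
    assume *: "0 < \<kappa>" "0 \<le> A" "0 < \<Lambda>" "0 < T"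
      and decay: "\<And>x t. 0 < t \<Longrightarrow> t < T \<Longrightarrow> weight_flow k A x t \<le> ennreal (\<Lambda> * t powr (- a / 2))"
      and le: "\<kappa> * \<Lambda> * T powr \<theta> \<le> \<delta>"
    have "(\<kappa> * \<Lambda> * T powr \<theta>) powr (p - 1) \<le> \<delta> powr (p - 1)"
      using le * p by (intro powr_mono2) auto
    also have "\<dots> = (p - 1) * \<theta> / 2 powr (p + 1)"
      using p \<theta> by (simp add: \<delta>_def powr_powr)
    also have "(\<kappa> * \<Lambda> * T powr \<theta>) powr (p - 1) = (\<kappa> * \<Lambda>) powr (p - 1) * T powr ((p - 1) * \<theta>)"
      by (simp only: powr_mult powr_powr mult.commute[of \<theta>])
    finally have "2 powr (p + 1) * (\<kappa> * \<Lambda>) powr (p - 1) * T powr ((p - 1) * \<theta>) \<le> (p - 1) * \<theta>"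
      by (simp add: field_simps)
    then have small: "2 powr (p + 1) * (\<kappa> * \<Lambda>) powr (p - 1) * T powr ((1 - a * (p - 1)) / 2) \<le> (1 - a * (p - 1)) / 2"
      unfolding c .
    have "0 < (1 - a * (p - 1)) / 2"
      unfolding c using p \<theta> by simp
    then have "a * (p - 1) < 1"
      by simp
    from life_span_ge_subcritical[OF *(1,2) p *(4) a this *(3) decay small]
    show "ereal T \<le> life_span k p (\<lambda>x. \<kappa> * weight A x)" .
  qed
qed

text \<open>Counterpart of \<open>life_span_ge_scaled\<close>: the blow-up criterion, applied to the
  lower bound from the initial mass and raised to the power 1/(p - 1). The solution may be arbitrary
  and M is any lower bound of the mass in the half ball.\<close>

lemma solution_scaled_bound:
  fixes k :: "'n::finite"
  assumes p: "1 < p"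
  obtains C where "0 < C" "\<And>\<kappa> A T w R M. 0 < \<kappa> \<Longrightarrow> solution_on {0<..<T} k p (\<lambda>x. \<kappa> * weight A x) w \<Longrightarrow>
    0 < R \<Longrightarrow> 2 * R < T \<Longrightarrow> 0 \<le> M \<Longrightarrow>
    ennreal M \<le> half_ball_mass k A (sqrt R) \<Longrightarrow>
    \<kappa> * M * R powr (1 / (2 * (p - 1)) - real CARD('n) / 2) \<le> C"
proof -
  let ?N = "real CARD('n)"
  define c\<^sub>3 where "c\<^sub>3 = (8 * pi) powr (- ?N / 2) * exp (- (?N + 1) / 2)"
  have c3: "0 < c\<^sub>3" by (simp add: c\<^sub>3_def)
  obtain K where K: "0 < K" and blow: "\<And>T \<phi> w R a. solution_on {0<..<T} k p \<phi> w \<Longrightarrow> 0 < R \<Longrightarrow> 2 * R < T \<Longrightarrow> 0 < a \<Longrightarrow>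
    (\<And>s z. R \<le> s \<Longrightarrow> s \<le> 2 * R \<Longrightarrow> z \<in> boundary_box k (sqrt R) \<Longrightarrow> a \<le> w (boundary_point k z) s) \<Longrightarrow>
    K * sqrt R * a powr (p - 1) \<le> 1"
    using blow_up_bound[OF p, of k] by blast
  let ?m = "1 / (p - 1)"
  define C where "C = 1 / (K powr ?m * c\<^sub>3)"
  have C: "0 < C"
    using K c3 by (simp add: C_def)
  show ?thesis
  proof (rule that[OF C])
    fix \<kappa> A T w R M
    assume \<kappa>: "0 < (\<kappa>::real)" and w: "solution_on {0<..<T} k p (\<lambda>x. \<kappa> * weight A x) w"
      and R: "0 < R" "2 * R < T" and M: "0 \<le> M"
      "ennreal M \<le> half_ball_mass k A (sqrt R)"
    show "\<kappa> * M * R powr (1 / (2 * (p - 1)) - ?N / 2) \<le> C"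
    proof (cases "M = 0")
      case False
      let ?a = "c\<^sub>3 * \<kappa> * M * R powr (- ?N / 2)"
      have a: "0 < ?a"
        using False M c3 \<kappa> R by simp
      have "K * sqrt R * ?a powr (p - 1) \<le> 1"
      proof (rule blow[OF w R a])
        show "?a \<le> w (boundary_point k z) s" if "R \<le> s" "s \<le> 2 * R" "z \<in> boundary_box k (sqrt R)" for s z
          unfolding c\<^sub>3_def using that R by (intro solution_initial_ge[OF w \<kappa> R(1) _ _ _ _ M]) auto
      qed
      then have "(K * sqrt R * ?a powr (p - 1)) powr ?m \<le> 1 powr ?m"
        using K R p by (intro powr_mono2) auto
      also have "(K * sqrt R * ?a powr (p - 1)) powr ?m = K powr ?m * sqrt R powr ?m * ?a"
        using a p by (subst powr_mult, subst powr_mult, subst powr_powr) simp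
      also have "sqrt R powr ?m = R powr (1 / (2 * (p - 1)))"
        unfolding sqrt_powr[OF R(1)] by (simp only: divide_divide_eq_left mult.commute)
      also have "K powr ?m * R powr (1 / (2 * (p - 1))) * ?a =
          (K powr ?m * c\<^sub>3) * (\<kappa> * M * (R powr (1 / (2 * (p - 1))) * R powr (- ?N / 2)))"
        by (simp only: mult_ac)
      also have "R powr (1 / (2 * (p - 1))) * R powr (- ?N / 2) = R powr (1 / (2 * (p - 1)) - ?N / 2)"
        unfolding powr_add[symmetric] by simp
      finally show ?thesis
        using K c3 by (simp add: C_def field_simps)
    qed (use C in simp)
  qed
qed

text \<open>The radius \<sigma> is left free: the mass is read off in the half ball of radius
  \<sigma>, and the doubling starts at time \<sigma> squared. A large \<sigma> gains mass and loses
  time.\<close>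

lemma life_span_bound_critical:
  fixes k :: "'n::finite"
  assumes p: "p = 1 + 1 / real CARD('n)"
  obtains C where "0 < C" "\<And>\<kappa> A \<sigma> M. 0 < \<kappa> \<Longrightarrow> 0 < \<sigma> \<Longrightarrow> 0 < M \<Longrightarrow>
    ennreal M \<le> half_ball_mass k A \<sigma> \<Longrightarrow>
    life_span k p (\<lambda>x. \<kappa> * weight A x) \<le> ereal (2 * \<sigma>\<^sup>2 * exp (C * (\<kappa> * M) powr (1 - p)))"
proof -
  let ?N = "real CARD('n)"
  define c\<^sub>3 where "c\<^sub>3 = (8 * pi) powr (- ?N / 2) * exp (- (?N + 1) / 2)"
  have c3: "0 < c\<^sub>3" by (simp add: c\<^sub>3_def)
  obtain K where K: "0 < K" and bound: "\<And>T \<phi> w S \<mu>. solution_on {0<..<T} k p \<phi> w \<Longrightarrow> 0 < S \<Longrightarrow> 0 < \<mu> \<Longrightarrow>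
    (\<And>s z. S \<le> s \<Longrightarrow> s < T \<Longrightarrow> z \<in> boundary_box k (sqrt s) \<Longrightarrow>
      \<mu> * s powr (- real CARD('n) / 2) \<le> w (boundary_point k z) s) \<Longrightarrow>
    T \<le> 2 * S * exp (K * \<mu> powr (1 - p))"
    using critical_bound[OF p, of k] by blast
  define C where "C = K * c\<^sub>3 powr (1 - p)"
  have C: "0 < C"
    using K c3 by (simp add: C_def)
  show ?thesis
  proof (rule that[OF C])
    fix \<kappa> A \<sigma> M :: real
    assume \<kappa>: "0 < \<kappa>" and \<sigma>: "0 < \<sigma>" and M: "0 < M"
      "ennreal M \<le> half_ball_mass k A \<sigma>"
    show "life_span k p (\<lambda>x. \<kappa> * weight A x) \<le> ereal (2 * \<sigma>\<^sup>2 * exp (C * (\<kappa> * M) powr (1 - p)))"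
    proof (rule life_span_leI)
      fix T w assume w: "solution_on {0<..<T} k p (\<lambda>x. \<kappa> * weight A x) w"
      have "T \<le> 2 * \<sigma>\<^sup>2 * exp (K * (c\<^sub>3 * \<kappa> * M) powr (1 - p))"
      proof (rule bound[OF w])
        fix s z assume s: "\<sigma>\<^sup>2 \<le> s" "s < T" and z: "z \<in> boundary_box k (sqrt s)"
        have s0: "0 < s"
          using s(1) \<sigma> by (meson less_le_trans zero_less_power)
        have "\<sigma> \<le> sqrt s"
          using s(1) \<sigma> by (intro real_le_rsqrt)
        then have "half_ball_mass k A \<sigma> \<le>
            half_ball_mass k A (sqrt s)"
          by (intro nn_integral_mono) (auto split: split_indicator)
        then show "c\<^sub>3 * \<kappa> * M * s powr (- ?N / 2) \<le> w (boundary_point k z) s"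
          unfolding c\<^sub>3_def using s s0 M(1) by (intro solution_initial_ge[OF w \<kappa> s0 _ _ _ z] order_trans[OF M(2)]) auto
      qed (use \<sigma> c3 \<kappa> M in auto)
      also have "K * (c\<^sub>3 * \<kappa> * M) powr (1 - p) = C * (\<kappa> * M) powr (1 - p)"
        by (simp only: C_def powr_mult mult_ac)
      finally show "T \<le> 2 * \<sigma>\<^sup>2 * exp (C * (\<kappa> * M) powr (1 - p))" .
    qed simp
  qed
qed

text \<open>The case a = 0 of the scaled bound: the flow of the weight is at most 1 and the exponent
  1/(2 (p - 1)) is always positive, so no distinction of cases in p and A arises.\<close>

lemma life_span_tendsto_infinity:
  fixes k :: "'n::finite"
  assumes p: "1 < p" and A: "0 \<le> A"
  shows "((\<lambda>\<kappa>. life_span k p (\<lambda>x. \<kappa> * weight A x)) \<longlongrightarrow> \<infinity>) (at_right 0)"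
proof -
  let ?\<theta> = "1 / (2 * (p - 1)) - 0 / 2"
  obtain \<delta> where \<delta>: "0 < \<delta>" and ge: "\<And>\<kappa> \<Lambda> T A. 0 < \<kappa> \<Longrightarrow> 0 \<le> A \<Longrightarrow> 0 < \<Lambda> \<Longrightarrow> 0 < T \<Longrightarrow>
    (\<And>x t. 0 < t \<Longrightarrow> t < T \<Longrightarrow> weight_flow k A x t \<le> ennreal (\<Lambda> * t powr (- 0 / 2))) \<Longrightarrow>
    \<kappa> * \<Lambda> * T powr ?\<theta> \<le> \<delta> \<Longrightarrow> ereal T \<le> life_span k p (\<lambda>x. \<kappa> * weight A x)"
    using life_span_ge_scaled[of p 0 k] p by auto
  show ?thesis
    unfolding tendsto_PInfty
  proof
    fix r :: real
    define T where "T = \<bar>r\<bar> + 1"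
    have T: "0 < T" "r < T"
      by (auto simp: T_def)
    have "0 < \<delta> / T powr ?\<theta>"
      using \<delta> T by simp
    from eventually_at_right_0_le[OF this]
    show "\<forall>\<^sub>F \<kappa> in at_right 0. ereal r < life_span k p (\<lambda>x. \<kappa> * weight A x)"
    proof eventually_elim
      case (elim \<kappa>)
      have "ereal T \<le> life_span k p (\<lambda>x. \<kappa> * weight A x)"
      proof (rule ge[where \<Lambda> = 1])
        show "weight_flow k A x t \<le> ennreal (1 * t powr (- 0 / 2))" if "0 < t" for x t
          using heat_potential_weight_le_1[OF that A] that by simp
        show "\<kappa> * 1 * T powr ?\<theta> \<le> \<delta>"
          using elim T by (simp add: field_simps)
      qed (use elim A T in auto)
      then show ?case
        by (rule less_le_trans[rotated]) (simp add: T)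
    qed
  qed
qed

lemma sim_subcritical_neq:
  fixes k :: "'n::finite" and A :: real
  assumes p: "1 < p" and A: "0 < A" "A \<noteq> CARD('n)"
  defines "\<theta> \<equiv> 1 / (2 * (p - 1)) - min A CARD('n) / 2"
  assumes \<theta>: "0 < \<theta>"
  shows "sim_at_0 (\<lambda>\<kappa>. life_span k p (\<lambda>x. \<kappa> * weight A x)) (\<lambda>\<kappa>. \<kappa> powr (- inverse \<theta>))"
proof -
  let ?N = "real CARD('n)" and ?a = "min A (real CARD('n))"
  have a: "0 \<le> ?a"
    using A by simp
  obtain \<Lambda> where \<Lambda>: "1 \<le> \<Lambda>" and decay: "\<And>x t. 0 < t \<Longrightarrow>
      weight_flow k A x t \<le> ennreal (\<Lambda> * (max 1 t) powr (- ?a / 2))"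
    using heat_potential_weight_decay_neq[OF A, of k] by blast
  obtain \<delta> where \<delta>: "0 < \<delta>" and ge: "\<And>\<kappa> \<Lambda> T A. 0 < \<kappa> \<Longrightarrow> 0 \<le> A \<Longrightarrow> 0 < \<Lambda> \<Longrightarrow> 0 < T \<Longrightarrow>
    (\<And>x t. 0 < t \<Longrightarrow> t < T \<Longrightarrow> weight_flow k A x t \<le> ennreal (\<Lambda> * t powr (- ?a / 2))) \<Longrightarrow>
    \<kappa> * \<Lambda> * T powr \<theta> \<le> \<delta> \<Longrightarrow> ereal T \<le> life_span k p (\<lambda>x. \<kappa> * weight A x)"
    using life_span_ge_scaled[OF p a \<theta>[unfolded \<theta>_def], of k] unfolding \<theta>_def by blast
  obtain C where C: "0 < C" and bound: "\<And>\<kappa> A T w R M. 0 < \<kappa> \<Longrightarrow> solution_on {0<..<T} k p (\<lambda>x. \<kappa> * weight A x) w \<Longrightarrow>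
    0 < R \<Longrightarrow> 2 * R < T \<Longrightarrow> 0 \<le> M \<Longrightarrow>
    ennreal M \<le> half_ball_mass k A (sqrt R) \<Longrightarrow>
    \<kappa> * M * R powr (1 / (2 * (p - 1)) - ?N / 2) \<le> C"
    using solution_scaled_bound[OF p, of k] by blast
  obtain c where c: "0 < c" and mass: "\<And>\<rho>. 1 \<le> \<rho> \<Longrightarrow>
    ennreal (c * \<rho> powr (?N - ?a)) \<le> half_ball_mass k A \<rho>"
    using weight_mass_ge[of A k] A by auto
  \<comment> \<open>The second entry makes the bound contradict
    \<open>solution_scaled_bound\<close>; the first ensures R \<ge> 1, as required by the lower
    bound of the mass.\<close>
  define D where "D = max 1 ((C / c) powr (1 / \<theta>))"
  have D: "1 \<le> D"
    by (simp add: D_def)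
  show ?thesis
  proof (rule sim_at_0I)
    show "0 < (\<delta> / \<Lambda>) powr (1 / \<theta>)" "0 < 2 * D"
      using \<delta> \<Lambda> D by auto
    show "\<forall>\<^sub>F \<tau> in at_right 0. ereal ((\<delta> / \<Lambda>) powr (1 / \<theta>) * \<tau> powr - inverse \<theta>) \<le> life_span k p (\<lambda>x. \<tau> * weight A x)"
      using eventually_at_right_0_le[OF zero_less_one]
    proof eventually_elim
      case (elim \<kappa>)
      let ?T = "(\<delta> / \<Lambda>) powr (1 / \<theta>) * \<kappa> powr - inverse \<theta>"
      show ?case
      proof (rule ge[where \<Lambda> = \<Lambda>])
        have "?T powr \<theta> = (\<delta> / \<Lambda>) * \<kappa> powr (- 1)"
          using \<theta> \<delta> \<Lambda> by (simp add: powr_mult powr_powr)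
        then show "\<kappa> * \<Lambda> * ?T powr \<theta> \<le> \<delta>"
          using elim \<Lambda> by (simp add: powr_minus_divide)
        show "weight_flow k A x t \<le> ennreal (\<Lambda> * t powr (- ?a / 2))" if "0 < t" for x t
          using max_1_powr_le[of t "?a / 2"] that A \<Lambda>
          by (intro order_trans[OF decay[OF that]] ennreal_leI mult_left_mono) auto
      qed (use elim A \<Lambda> \<delta> in auto)
    qed
    show "\<forall>\<^sub>F \<tau> in at_right 0. life_span k p (\<lambda>x. \<tau> * weight A x) \<le> ereal (2 * D * \<tau> powr - inverse \<theta>)"
      using eventually_at_right_0_le[OF zero_less_one]
    proof eventually_elim
      case (elim \<kappa>)
      let ?B = "D * \<kappa> powr - inverse \<theta>"
      have "1 powr (- inverse \<theta>) \<le> \<kappa> powr (- inverse \<theta>)"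
        using elim \<theta> by (intro powr_mono2') auto
      then have B: "1 \<le> ?B"
        using D mult_mono[of 1 D 1 "\<kappa> powr - inverse \<theta>"] by simp
      show ?case
      proof (rule life_span_leI)
        fix T w assume T: "0 < T" and w: "solution_on {0<..<T} k p (\<lambda>x. \<kappa> * weight A x) w"
        show "T \<le> 2 * D * \<kappa> powr - inverse \<theta>"
        proof (rule ccontr)
          assume "\<not> ?thesis"
          \<comment> \<open>Any R strictly between the claimed bound and T/2 contradicts
            \<open>solution_scaled_bound\<close>: the exponents of mass and time add up to
            \<theta>.\<close>
          then obtain R where R: "?B < R" "2 * R < T"
            using dense[of ?B "T / 2"] by auto
          have R1: "1 \<le> R"
            using R B by simp
          have "\<kappa> * (c * sqrt R powr (?N - ?a)) * R powr (1 / (2 * (p - 1)) - ?N / 2) \<le> C"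
            using elim R R1 c by (intro bound[OF _ w] mass) auto
          also have "\<kappa> * (c * sqrt R powr (?N - ?a)) * R powr (1 / (2 * (p - 1)) - ?N / 2) =
              \<kappa> * c * (R powr ((?N - ?a) / 2) * R powr (1 / (2 * (p - 1)) - ?N / 2))"
            using R1 by (simp add: sqrt_powr)
          also have "R powr ((?N - ?a) / 2) * R powr (1 / (2 * (p - 1)) - ?N / 2) = R powr \<theta>"
            unfolding powr_add[symmetric] \<theta>_def by (simp add: diff_divide_distrib)
          finally have le: "R powr \<theta> \<le> C / c / \<kappa>"
            using c elim by (simp add: field_simps)
          have "?B powr \<theta> < R powr \<theta>"
            using R B \<theta> by (intro powr_less_mono2) auto
          moreover have "?B powr \<theta> = D powr \<theta> / \<kappa>"
          proof -
            have "?B powr \<theta> = D powr \<theta> * \<kappa> powr (- 1)"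
              unfolding powr_mult powr_powr using \<theta> by simp
            then show ?thesis
              using elim by (simp add: powr_minus_divide)
          qed
          moreover have "((C / c) powr (1 / \<theta>)) powr \<theta> \<le> D powr \<theta>"
            using \<theta> by (intro powr_mono2) (auto simp: D_def)
          then have "C / c / \<kappa> \<le> D powr \<theta> / \<kappa>"
            using \<theta> C c elim by (intro divide_right_mono) (auto simp: powr_powr)
          ultimately show False
            using le by linarith
        qed
      qed (use D in auto)
    qed
  qed simp
qed

lemma powr_inverse_powr: "0 < x \<Longrightarrow> 0 < c \<Longrightarrow> (x powr inverse c) powr c = x" for x c :: real
  by (simp add: powr_powr)

text \<open>With L the inverse of \<kappa>, both bounds amount to
  \<open>\<kappa> * ln T * T powr \<theta>\<close> being of order 1. A time with
  \<open>T powr \<theta>\<close> a multiple of L / ln L has ln T comparable to ln L, since ln (ln L)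
  is negligible, and this resolves the implicit relation.\<close>

lemma sim_subcritical_eq:
  fixes k :: "'n::finite"
  assumes p: "1 < p"
  defines "\<theta> \<equiv> 1 / (2 * (p - 1)) - real CARD('n) / 2"
  assumes \<theta>: "0 < \<theta>"
  shows "sim_at_0 (\<lambda>\<kappa>. life_span k p (\<lambda>x. \<kappa> * weight CARD('n) x)) (\<lambda>\<kappa>. (inverse \<kappa> / ln (inverse \<kappa>)) powr inverse \<theta>)"
proof -
  let ?N = "real CARD('n)"
  obtain \<Lambda> where \<Lambda>: "1 \<le> \<Lambda>" and decay: "\<And>x t T. 0 < t \<Longrightarrow> t \<le> T \<Longrightarrow> 1 \<le> T \<Longrightarrow>
      weight_flow k ?N x t \<le> ennreal (\<Lambda> * (1 + ln T) * (max 1 t) powr (- ?N / 2))"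
    using heat_potential_weight_decay_eq[of k] by blast
  obtain \<delta> where \<delta>: "0 < \<delta>" and ge: "\<And>\<kappa> \<Lambda> T A. 0 < \<kappa> \<Longrightarrow> 0 \<le> A \<Longrightarrow> 0 < \<Lambda> \<Longrightarrow> 0 < T \<Longrightarrow>
    (\<And>x t. 0 < t \<Longrightarrow> t < T \<Longrightarrow> weight_flow k A x t \<le> ennreal (\<Lambda> * t powr (- ?N / 2))) \<Longrightarrow>
    \<kappa> * \<Lambda> * T powr \<theta> \<le> \<delta> \<Longrightarrow> ereal T \<le> life_span k p (\<lambda>x. \<kappa> * weight A x)"
    using life_span_ge_scaled[OF p _ \<theta>[unfolded \<theta>_def], of k] unfolding \<theta>_def by auto
  obtain C where C: "0 < C" and bound: "\<And>\<kappa> A T w R M. 0 < \<kappa> \<Longrightarrow> solution_on {0<..<T} k p (\<lambda>x. \<kappa> * weight A x) w \<Longrightarrow>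
    0 < R \<Longrightarrow> 2 * R < T \<Longrightarrow> 0 \<le> M \<Longrightarrow>
    ennreal M \<le> half_ball_mass k A (sqrt R) \<Longrightarrow>
    \<kappa> * M * R powr \<theta> \<le> C"
    using solution_scaled_bound[OF p, of k] unfolding \<theta>_def by blast
  obtain c where c: "0 < c" and mass: "\<And>\<rho>. 1 \<le> \<rho> \<Longrightarrow>
    ennreal (c * ln \<rho>) \<le> half_ball_mass k ?N \<rho>"
    using weight_mass_critical_ge[of k] by blast
  let ?f = "\<lambda>\<kappa>. (inverse \<kappa> / ln (inverse \<kappa>)) powr inverse \<theta>"
  \<comment> \<open>As 1 + ln T \<le> (1 + 1/\<theta>) ln L, this choice turns the quantity to be
    bounded by \<delta> into at most \<epsilon> \<Lambda> (1 + 1/\<theta>). The bound \<epsilon>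
    \<le> 1 is used to get ln T \<le> ln L / \<theta>.\<close>
  define \<epsilon> where "\<epsilon> = min 1 (\<delta> / (\<Lambda> * (1 + 1 / \<theta>)))"
  have \<epsilon>: "0 < \<epsilon>" "\<epsilon> \<le> 1" "\<epsilon> * (\<Lambda> * (1 + 1 / \<theta>)) \<le> \<delta>"
  proof -
    have "0 < \<Lambda> * (1 + 1 / \<theta>)"
      using \<Lambda> \<theta> by (intro mult_pos_pos add_pos_pos) auto
    then show "0 < \<epsilon>" "\<epsilon> \<le> 1" "\<epsilon> * (\<Lambda> * (1 + 1 / \<theta>)) \<le> \<delta>"
      using \<delta> by (auto simp: \<epsilon>_def pos_le_divide_eq[symmetric])
  qed
  \<comment> \<open>Large enough that c D / (4 \<theta>) exceeds C: one factor 2 comes from the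
    logarithm of \<open>sqrt R\<close>, the other from ln R being bounded below by ln L / (2
    \<theta>).\<close>
  define D where "D = 1 + 4 * \<theta> * C / c"
  have D: "1 \<le> D"
    using \<theta> C c by (simp add: D_def)
  have small: "\<forall>\<^sub>F \<kappa> in at_right 0. (0::real) < \<kappa> \<and> 1 \<le> ln (inverse \<kappa>) \<and> ln (ln (inverse \<kappa>)) \<le> ln (inverse \<kappa>) / 2"
  proof (intro eventually_conj)
    show "\<forall>\<^sub>F \<kappa> in at_right 0. (0::real) < \<kappa>"
      by (simp add: eventually_at_right_less)
    show "\<forall>\<^sub>F \<kappa> in at_right (0::real). 1 \<le> ln (inverse \<kappa>)"
      by real_asymp
    show "\<forall>\<^sub>F \<kappa> in at_right (0::real). ln (ln (inverse \<kappa>)) \<le> ln (inverse \<kappa>) / 2"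
      by real_asymp
  qed
  \<comment> \<open>Guarantees that the times T and R below are at least 1.\<close>
  have large: "\<forall>\<^sub>F \<kappa> in at_right (0::real). 1 \<le> \<epsilon> * (inverse \<kappa> / ln (inverse \<kappa>))"
    using \<epsilon>(1) by real_asymp
  show ?thesis
  proof (rule sim_at_0I)
    show "0 < \<epsilon> powr inverse \<theta>" "0 < 2 * D powr inverse \<theta>"
      using \<epsilon> D by auto
    show "\<forall>\<^sub>F \<kappa> in at_right 0. ereal (\<epsilon> powr inverse \<theta> * ?f \<kappa>) \<le> life_span k p (\<lambda>x. \<kappa> * weight CARD('n) x)"
      using small large
    proof eventually_elim
      case (elim \<kappa>)
      define L where "L = inverse \<kappa>"
      define T where "T = (\<epsilon> * (L / ln L)) powr inverse \<theta>"
      have L: "1 \<le> ln L" "0 < L" "\<kappa> * L = 1" "1 \<le> \<epsilon> * (L / ln L)"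
        using elim by (auto simp: L_def)
      have T1: "1 \<le> T"
        unfolding T_def using L \<theta> by (intro ge_one_powr_ge_zero) auto
      have "0 \<le> L / ln L"
        by (rule divide_nonneg_pos) (use L in linarith)+
      moreover have "L / ln L \<le> L / 1"
        by (rule divide_left_mono) (use L in linarith)+
      ultimately have "\<epsilon> * (L / ln L) \<le> 1 * (L / 1)"
        using \<epsilon> by (intro mult_mono) auto
      then have "\<epsilon> * (L / ln L) \<le> L"
        by simp
      moreover have "0 < \<epsilon> * (L / ln L)"
        using L(4) by linarith
      ultimately have "ln (\<epsilon> * (L / ln L)) \<le> ln L"
        using ln_le_cancel_iff L(2) by blast
      then have "inverse \<theta> * ln (\<epsilon> * (L / ln L)) \<le> inverse \<theta> * ln L"
        using \<theta> by (intro mult_left_mono) auto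
      moreover have "ln T = inverse \<theta> * ln (\<epsilon> * (L / ln L))"
        unfolding T_def by (rule ln_powr)
      ultimately have "ln T \<le> ln L / \<theta>"
        by (simp only: divide_inverse mult.commute)
      then have lnT: "1 + ln T \<le> (1 + 1 / \<theta>) * ln L"
        using L by (simp add: distrib_right)
      have "ereal T \<le> life_span k p (\<lambda>x. \<kappa> * weight CARD('n) x)"
      proof (rule ge[where \<Lambda> = "\<Lambda> * (1 + ln T)"])
        show "weight_flow k ?N x t \<le> ennreal (\<Lambda> * (1 + ln T) * t powr (- ?N / 2))"
          if "0 < t" "t < T" for x t
          using max_1_powr_le[of t "?N / 2"] that \<Lambda> T1
          by (intro order_trans[OF decay[of t T x]] ennreal_leI mult_left_mono mult_nonneg_nonneg) auto
        have "T powr \<theta> = \<epsilon> * (L / ln L)"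
          unfolding T_def using L(4) \<theta> by (intro powr_inverse_powr; linarith)
        then have "\<kappa> * (\<Lambda> * (1 + ln T)) * T powr \<theta> = \<kappa> * \<Lambda> * (\<epsilon> * (L / ln L)) * (1 + ln T)"
          by simp
        also have "\<dots> \<le> \<kappa> * \<Lambda> * (\<epsilon> * (L / ln L)) * ((1 + 1 / \<theta>) * ln L)"
        proof (rule mult_left_mono[OF lnT])
          have "0 \<le> \<kappa> * \<Lambda>"
            using elim \<Lambda> by simp
          moreover have "0 \<le> \<epsilon> * (L / ln L)"
            using L(4) by linarith
          ultimately show "0 \<le> \<kappa> * \<Lambda> * (\<epsilon> * (L / ln L))"
            by (rule mult_nonneg_nonneg)
        qed
        also have "\<dots> = (\<kappa> * L) * (\<epsilon> * (\<Lambda> * (1 + 1 / \<theta>)))"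
        proof -
          have "L \<noteq> 1"
            using L(1) by auto
          then show ?thesis
            using L by simp
        qed
        also have "\<dots> \<le> \<delta>"
          using \<epsilon>(3) L by simp
        finally show "\<kappa> * (\<Lambda> * (1 + ln T)) * T powr \<theta> \<le> \<delta>" .
      qed (use elim \<Lambda> T1 in \<open>auto intro!: mult_pos_pos add_pos_nonneg\<close>)
      then show ?case
        unfolding T_def L_def by (simp only: powr_mult)
    qed
    show "\<forall>\<^sub>F \<kappa> in at_right 0. life_span k p (\<lambda>x. \<kappa> * weight CARD('n) x) \<le> ereal (2 * D powr inverse \<theta> * ?f \<kappa>)"
      using small large
    proof eventually_elim
      case (elim \<kappa>)
      define L where "L = inverse \<kappa>"
      define R where "R = (D * (L / ln L)) powr inverse \<theta>"
      have L: "1 \<le> ln L" "0 < L" "\<kappa> * L = 1" "1 \<le> \<epsilon> * (L / ln L)" "ln (ln L) \<le> ln L / 2"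
        using elim by (auto simp: L_def)
      have "0 \<le> L / ln L"
        by (rule divide_nonneg_pos) (use L in linarith)+
      then have "\<epsilon> * (L / ln L) \<le> D * (L / ln L)"
        using \<epsilon> D by (intro mult_right_mono) auto
      then have DL: "1 \<le> D * (L / ln L)"
        using L by linarith
      have R1: "1 \<le> R"
        unfolding R_def using DL \<theta> by (intro ge_one_powr_ge_zero) auto
      have "ln (D * (L / ln L)) = ln D + (ln L - ln (ln L))"
      proof -
        have "0 < D" "0 < ln L" "0 < L / ln L"
          using D L(1,2) by (linarith, linarith, intro divide_pos_pos, linarith+)
        then show ?thesis
          using L(2) by (simp only: ln_mult_pos ln_divide_pos)
      qed
      then have "ln L / 2 \<le> ln (D * (L / ln L))"
        using L ln_ge_zero[OF D] by linarith
      then have "inverse \<theta> * (ln L / 2) \<le> inverse \<theta> * ln (D * (L / ln L))"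
        using \<theta> by (intro mult_left_mono) auto
      moreover have "ln R = inverse \<theta> * ln (D * (L / ln L))"
        unfolding R_def by (rule ln_powr)
      moreover have "inverse \<theta> * (ln L / 2) = ln L / (2 * \<theta>)"
        by (simp only: divide_inverse inverse_mult_distrib mult_ac)
      ultimately have lnR: "ln L / (2 * \<theta>) \<le> ln R"
        by linarith
      have "T \<le> 2 * R" if w: "solution_on {0<..<T} k p (\<lambda>x. \<kappa> * weight ?N x) w" for T w
      proof (rule ccontr)
        assume "\<not> ?thesis"
        then have T: "2 * R < T" by simp
        have sR: "1 \<le> sqrt R"
          using R1 by simp
        have "\<kappa> * (c * ln (sqrt R)) * R powr \<theta> \<le> C"
        proof (rule bound[OF _ w _ T])
          show "0 \<le> c * ln (sqrt R)"
            using c ln_ge_zero[OF sR] by simp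
        qed (use mass[OF sR] elim R1 in auto)
        also have "ln (sqrt R) = ln R / 2"
          using R1 by (simp add: ln_sqrt)
        also have "R powr \<theta> = D * (L / ln L)"
          unfolding R_def using DL \<theta> by (intro powr_inverse_powr; linarith)
        finally have "\<kappa> * (c * (ln R / 2)) * (D * (L / ln L)) \<le> C" .
        moreover have "\<kappa> * (c * (ln L / (2 * \<theta>) / 2)) * (D * (L / ln L)) \<le> \<kappa> * (c * (ln R / 2)) * (D * (L / ln L))"
          using lnR elim c DL by (intro mult_right_mono mult_left_mono divide_right_mono) auto
        moreover have "L \<noteq> 1"
          using L(1) by auto
        then have "\<kappa> * (c * (ln L / (2 * \<theta>) / 2)) * (D * (L / ln L)) = (\<kappa> * L) * (c * D / (4 * \<theta>))"
          using L \<theta> by (simp add: field_simps)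
        ultimately have "c * D / (4 * \<theta>) \<le> C"
          using L(3) by simp
        moreover have "c * D / (4 * \<theta>) = c / (4 * \<theta>) + C"
          using c \<theta> by (simp add: D_def field_simps)
        moreover have "0 < c / (4 * \<theta>)"
          using c \<theta> by simp
        ultimately show False
          by linarith
      qed
      then have "life_span k p (\<lambda>x. \<kappa> * weight ?N x) \<le> ereal (2 * R)"
        using R1 by (intro life_span_leI) auto
      then show ?case
        unfolding R_def L_def powr_mult by (simp only: mult.assoc)
    qed
  qed simp
qed

lemma sim_critical_gt:
  fixes k :: "'n::finite"
  assumes p: "p = 1 + 1 / real CARD('n)" and A: "real CARD('n) < A"
  shows "sim_at_0 (\<lambda>\<kappa>. ln_extended (life_span k p (\<lambda>x. \<kappa> * weight A x))) (\<lambda>\<kappa>. \<kappa> powr (- (p - 1)))"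
proof -
  let ?N = "real CARD('n)"
  have p1: "1 < p" "?N * (p - 1) = 1"
    by (auto simp: p)
  obtain \<Lambda> where \<Lambda>: "1 \<le> \<Lambda>" and decay: "\<And>x t. 0 < t \<Longrightarrow>
      weight_flow k A x t \<le> ennreal (\<Lambda> * (max 1 t) powr (- min A ?N / 2))"
    using heat_potential_weight_decay_neq[of A k] A by auto
  obtain C where C: "0 < C" and bound: "\<And>\<kappa> A \<sigma> M. 0 < \<kappa> \<Longrightarrow> 0 < \<sigma> \<Longrightarrow> 0 < M \<Longrightarrow>
    ennreal M \<le> half_ball_mass k A \<sigma> \<Longrightarrow>
    life_span k p (\<lambda>x. \<kappa> * weight A x) \<le> ereal (2 * \<sigma>\<^sup>2 * exp (C * (\<kappa> * M) powr (1 - p)))"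
    using life_span_bound_critical[OF p, of k] by blast
  obtain c where c: "0 < c" and mass: "\<And>\<rho>. 1 \<le> \<rho> \<Longrightarrow>
    ennreal (c * \<rho> powr (?N - min A ?N)) \<le> half_ball_mass k A \<rho>"
    using weight_mass_ge[of A k] A by auto
  \<comment> \<open>The smallness condition is met with 2 \<epsilon> in the place of
    \<open>\<kappa> powr (p - 1) * (2 + ln T)\<close>: one \<epsilon> is the share of ln T, the
    other majorises the remaining \<open>2 * \<kappa> powr (p - 1)\<close>.\<close>
  define \<epsilon> where "\<epsilon> = 1 / (2 powr (p + 2) * \<Lambda> powr (p - 1))"
  have \<epsilon>: "0 < \<epsilon>"
    using \<Lambda> by (simp add: \<epsilon>_def)
  have "\<forall>\<^sub>F \<kappa> in at_right 0. (0::real) < \<kappa> \<and> \<kappa> \<le> min 1 ((\<epsilon> / 2) powr (1 / (p - 1)))"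
    using \<epsilon> by (intro eventually_at_right_0_le) simp
  then have small: "\<forall>\<^sub>F \<kappa> in at_right 0. (0::real) < \<kappa> \<and> \<kappa> \<le> 1 \<and> 2 * \<kappa> powr (p - 1) \<le> \<epsilon>"
  proof eventually_elim
    case (elim \<kappa>)
    then have "\<kappa> powr (p - 1) \<le> ((\<epsilon> / 2) powr (1 / (p - 1))) powr (p - 1)"
      using p1 by (intro powr_mono2) auto
    then show ?case
      using elim p1 \<epsilon> by (simp add: powr_powr)
  qed
  show ?thesis
  proof (rule sim_at_0I)
    show "0 < \<epsilon>" "0 < 1 + C * c powr (1 - p)"
      using \<epsilon> C by (auto intro!: add_pos_nonneg)
    show "\<forall>\<^sub>F \<kappa> in at_right 0. ereal (\<epsilon> * \<kappa> powr - (p - 1)) \<le> ln_extended (life_span k p (\<lambda>x. \<kappa> * weight A x))"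
      using small
    proof eventually_elim
      case (elim \<kappa>)
      show ?case
      proof (rule ln_extended_ge, rule life_span_ge_critical[where a = ?N and \<Lambda> = \<Lambda>])
        show "weight_flow k A x t \<le> ennreal (\<Lambda> * (max 1 t) powr (- ?N / 2))" if "0 < t" for x t
          using decay[OF that, of x] A by simp
        have "2 powr (p + 1) * (\<kappa> * \<Lambda>) powr (p - 1) * (2 + ln (exp (\<epsilon> * \<kappa> powr - (p - 1)))) =
            2 powr (p + 1) * \<Lambda> powr (p - 1) * (2 * \<kappa> powr (p - 1) + \<epsilon> * (\<kappa> powr (p - 1) * \<kappa> powr - (p - 1)))"
          by (simp add: powr_mult algebra_simps)
        also have "\<kappa> powr (p - 1) * \<kappa> powr - (p - 1) = 1"
          using elim unfolding powr_add[symmetric] by simp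
        also have "2 powr (p + 1) * \<Lambda> powr (p - 1) * (2 * \<kappa> powr (p - 1) + \<epsilon> * 1) \<le>
            2 powr (p + 1) * \<Lambda> powr (p - 1) * (2 * \<epsilon>)"
          using elim by (intro mult_left_mono) auto
        also have "\<dots> = 1"
          using \<Lambda> by (simp add: \<epsilon>_def powr_add)
        finally show "2 powr (p + 1) * (\<kappa> * \<Lambda>) powr (p - 1) * (2 + ln (exp (\<epsilon> * \<kappa> powr - (p - 1)))) \<le> 1" .
      qed (use elim A \<Lambda> p1 \<epsilon> in auto)
    qed
    show "\<forall>\<^sub>F \<kappa> in at_right 0. ln_extended (life_span k p (\<lambda>x. \<kappa> * weight A x)) \<le> ereal ((1 + C * c powr (1 - p)) * \<kappa> powr - (p - 1))"
      using small
    proof eventually_elim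
      case (elim \<kappa>)
      \<comment> \<open>For A > N the mass does not grow with the radius, so nothing is gained by
        waiting and the radius is 1. The prefactor 2 is absorbed by 2 \<le> e, which costs the
        summand 1 in the constant.\<close>
      have "life_span k p (\<lambda>x. \<kappa> * weight A x) \<le> ereal (2 * 1\<^sup>2 * exp (C * (\<kappa> * c) powr (1 - p)))"
        using mass[of 1] elim c by (intro bound) auto
      also have "\<dots> \<le> ereal (exp ((1 + C * c powr (1 - p)) * \<kappa> powr - (p - 1)))"
      proof -
        have "1 powr - (p - 1) \<le> \<kappa> powr - (p - 1)"
          using elim p1 by (intro powr_mono2') auto
        then have "1 + C * (\<kappa> * c) powr (1 - p) \<le> (1 + C * c powr (1 - p)) * \<kappa> powr - (p - 1)"
          by (simp add: powr_mult algebra_simps)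
        then have "exp (1 + C * (\<kappa> * c) powr (1 - p)) \<le> exp ((1 + C * c powr (1 - p)) * \<kappa> powr - (p - 1))"
          by simp
        moreover have "2 * exp (C * (\<kappa> * c) powr (1 - p)) \<le> exp (1 + C * (\<kappa> * c) powr (1 - p))"
          unfolding exp_add using exp_ge_add_one_self[of 1] by (intro mult_right_mono) auto
        ultimately show ?thesis
          unfolding power_one mult_1_right ereal_less_eq(3) by linarith
      qed
      finally show ?case
        by (rule ln_extended_le)
    qed
  qed simp
qed

text \<open>From below, the amplitude contains ln T, so the condition is that
  \<open>\<kappa> powr (p - 1)\<close> times \<open>(ln T) powr p\<close> be small, which allows ln
  T of order X = \<open>\<kappa> powr (- ((p - 1) / p))\<close>. From above, the radius exp X makes
  the mass of order X and the waiting term \<open>(\<kappa> * X) powr (1 - p)\<close> exactly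
  X.\<close>

lemma sim_critical_eq:
  fixes k :: "'n::finite"
  assumes p: "p = 1 + 1 / real CARD('n)"
  shows "sim_at_0 (\<lambda>\<kappa>. ln_extended (life_span k p (\<lambda>x. \<kappa> * weight CARD('n) x))) (\<lambda>\<kappa>. \<kappa> powr (- ((p - 1) / p)))"
proof -
  let ?N = "real CARD('n)"
  have p1: "1 < p" "?N * (p - 1) = 1"
    by (auto simp: p)
  obtain \<Lambda> where \<Lambda>: "1 \<le> \<Lambda>" and decay: "\<And>x t T. 0 < t \<Longrightarrow> t \<le> T \<Longrightarrow> 1 \<le> T \<Longrightarrow>
      weight_flow k ?N x t \<le> ennreal (\<Lambda> * (1 + ln T) * (max 1 t) powr (- ?N / 2))"
    using heat_potential_weight_decay_eq[of k] by blast
  obtain C where C: "0 < C" and bound: "\<And>\<kappa> A \<sigma> M. 0 < \<kappa> \<Longrightarrow> 0 < \<sigma> \<Longrightarrow> 0 < M \<Longrightarrow>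
    ennreal M \<le> half_ball_mass k A \<sigma> \<Longrightarrow>
    life_span k p (\<lambda>x. \<kappa> * weight A x) \<le> ereal (2 * \<sigma>\<^sup>2 * exp (C * (\<kappa> * M) powr (1 - p)))"
    using life_span_bound_critical[OF p, of k] by blast
  obtain c where c: "0 < c" and mass: "\<And>\<rho>. 1 \<le> \<rho> \<Longrightarrow>
    ennreal (c * ln \<rho>) \<le> half_ball_mass k ?N \<rho>"
    using weight_mass_critical_ge[of k] by blast
  define B where "B = 2 powr (p + 1) * \<Lambda> powr (p - 1)"
  have B: "0 < B"
    using \<Lambda> by (simp add: B_def)
  \<comment> \<open>Chosen so that \<open>B * (2 * \<epsilon>) powr p\<close> = 1. The 2 arises
    because 1 + Y and 2 + Y are both at most 2Y when Y = \<epsilon> X \<ge> 2.\<close>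
  define \<epsilon> where "\<epsilon> = (1 / B) powr (1 / p) / 2"
  have \<epsilon>: "0 < \<epsilon>" "B * (2 * \<epsilon>) powr p = 1"
    using B p1 by (auto simp: \<epsilon>_def powr_powr)
  let ?X = "\<lambda>\<kappa>::real. \<kappa> powr (- ((p - 1) / p))"
  have q: "0 < (p - 1) / p"
    using p1 by simp
  have "\<forall>\<^sub>F \<kappa> in at_right 0. (0::real) < \<kappa> \<and> \<kappa> \<le> (max 1 (2 / \<epsilon>)) powr (- (p / (p - 1)))"
    by (intro eventually_at_right_0_le) auto
  then have small: "\<forall>\<^sub>F \<kappa> in at_right 0. (0::real) < \<kappa> \<and> 1 \<le> ?X \<kappa> \<and> 2 \<le> \<epsilon> * ?X \<kappa>"
  proof eventually_elim
    case (elim \<kappa>)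
    then have "((max 1 (2 / \<epsilon>)) powr (- (p / (p - 1)))) powr (- ((p - 1) / p)) \<le> ?X \<kappa>"
      using q by (intro powr_mono2') auto
    then have "max 1 (2 / \<epsilon>) \<le> ?X \<kappa>"
      using p1 by (simp add: powr_powr)
    then show ?case
      using elim \<epsilon> by (simp add: field_simps)
  qed
  show ?thesis
  proof (rule sim_at_0I)
    \<comment> \<open>Of the 3, the summand 2 stems from the square of the radius exp X and 1 from
      the prefactor 2 \<le> e.\<close>
    let ?D = "3 + C * c powr (1 - p)"
    show "0 < \<epsilon>" "0 < ?D"
      using \<epsilon> C by (auto intro!: add_pos_nonneg)
    show "\<forall>\<^sub>F \<kappa> in at_right 0. ereal (\<epsilon> * ?X \<kappa>) \<le> ln_extended (life_span k p (\<lambda>x. \<kappa> * weight CARD('n) x))"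
      using small
    proof eventually_elim
      case (elim \<kappa>)
      let ?Y = "\<epsilon> * ?X \<kappa>"
      show ?case
      proof (rule ln_extended_ge, rule life_span_ge_critical[where a = ?N and \<Lambda> = "\<Lambda> * (1 + ?Y)"])
        show "weight_flow k ?N x t \<le> ennreal (\<Lambda> * (1 + ?Y) * (max 1 t) powr (- ?N / 2))"
          if "0 < t" "t < exp ?Y" for x t
          using decay[of t "exp ?Y" x] that elim by simp
        have Xp: "\<kappa> powr (p - 1) * (?X \<kappa>) powr p = 1"
        proof -
          have "(?X \<kappa>) powr p = \<kappa> powr (- (p - 1))"
            using p1 by (simp add: powr_powr)
          then show ?thesis
            using elim by (simp add: powr_add[symmetric])
        qed
        have "(1 + ?Y) powr (p - 1) * (2 + ?Y) \<le> (2 * ?Y) powr (p - 1) * (2 * ?Y)"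
          using elim p1 by (intro mult_mono powr_mono2) auto
        also have "\<dots> = (2 * ?Y) powr p"
          using elim \<epsilon> by (simp add: powr_diff)
        finally have Y: "(1 + ?Y) powr (p - 1) * (2 + ?Y) \<le> (2 * \<epsilon>) powr p * (?X \<kappa>) powr p"
          by (simp only: powr_mult mult.assoc[symmetric])
        have "2 powr (p + 1) * (\<kappa> * (\<Lambda> * (1 + ?Y))) powr (p - 1) * (2 + ln (exp ?Y)) =
            B * \<kappa> powr (p - 1) * ((1 + ?Y) powr (p - 1) * (2 + ?Y))"
          by (simp only: ln_exp B_def powr_mult mult_ac)
        also have "\<dots> \<le> B * \<kappa> powr (p - 1) * ((2 * \<epsilon>) powr p * (?X \<kappa>) powr p)"
          using B by (intro mult_left_mono Y) auto
        also have "\<dots> = (B * (2 * \<epsilon>) powr p) * (\<kappa> powr (p - 1) * (?X \<kappa>) powr p)"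
          by (simp only: mult_ac)
        also have "\<dots> = 1"
          unfolding \<epsilon>(2) Xp by simp
        finally show "2 powr (p + 1) * (\<kappa> * (\<Lambda> * (1 + ?Y))) powr (p - 1) * (2 + ln (exp ?Y)) \<le> 1" .
        show "0 < \<Lambda> * (1 + ?Y)"
          using \<Lambda> elim by (intro mult_pos_pos) auto
      qed (use elim p1 in auto)
    qed
    show "\<forall>\<^sub>F \<kappa> in at_right 0. ln_extended (life_span k p (\<lambda>x. \<kappa> * weight CARD('n) x)) \<le> ereal (?D * ?X \<kappa>)"
      using small
    proof eventually_elim
      case (elim \<kappa>)
      have "life_span k p (\<lambda>x. \<kappa> * weight ?N x) \<le> ereal (2 * (exp (?X \<kappa>))\<^sup>2 * exp (C * (\<kappa> * (c * ?X \<kappa>)) powr (1 - p)))"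
        using mass[of "exp (?X \<kappa>)"] elim c by (intro bound) auto
      also have "\<dots> \<le> ereal (exp (?D * ?X \<kappa>))"
      proof -
        have "(\<kappa> * ?X \<kappa>) powr (1 - p) = ?X \<kappa>"
        proof -
          have "\<kappa> * ?X \<kappa> = \<kappa> powr (1 + - ((p - 1) / p))"
            unfolding powr_add using elim by simp
          also have "1 + - ((p - 1) / p) = 1 / p"
            using p1 by (simp add: field_simps)
          finally show ?thesis
            by (simp add: powr_powr minus_divide_left)
        qed
        moreover have "(\<kappa> * (c * ?X \<kappa>)) powr (1 - p) = c powr (1 - p) * (\<kappa> * ?X \<kappa>) powr (1 - p)"
          by (simp only: powr_mult mult_ac)
        ultimately have "1 + (2 * ?X \<kappa> + C * (\<kappa> * (c * ?X \<kappa>)) powr (1 - p)) \<le> ?D * ?X \<kappa>"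
          using elim by (simp add: algebra_simps)
        then have "exp (1 + (2 * ?X \<kappa> + C * (\<kappa> * (c * ?X \<kappa>)) powr (1 - p))) \<le> exp (?D * ?X \<kappa>)"
          by simp
        moreover have "2 * exp (2 * ?X \<kappa> + C * (\<kappa> * (c * ?X \<kappa>)) powr (1 - p)) \<le>
            exp (1 + (2 * ?X \<kappa> + C * (\<kappa> * (c * ?X \<kappa>)) powr (1 - p)))"
          by (subst (2) exp_add) (use exp_ge_add_one_self[of 1] in \<open>intro mult_right_mono, auto\<close>)
        moreover have "2 * (exp (?X \<kappa>))\<^sup>2 * exp (C * (\<kappa> * (c * ?X \<kappa>)) powr (1 - p)) =
            2 * exp (2 * ?X \<kappa> + C * (\<kappa> * (c * ?X \<kappa>)) powr (1 - p))"
          by (simp only: exp_add exp_double mult.assoc)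
        ultimately show ?thesis
          unfolding ereal_less_eq(3) by linarith
      qed
      finally show ?case
        by (rule ln_extended_le)
    qed
  qed simp
qed

theorem theorem1p2:
  fixes k :: "'n::finite" and N :: nat and p A :: real and \<psi> :: "real ^ 'n \<Rightarrow> real"
    and T :: "real \<Rightarrow> ereal"
  assumes N: "N = CARD('n)"
    and p: "p > 1"
    and A: "A > 0"
    and psi: "\<psi> = (\<lambda>x. (1 + norm x) powr (- A))"
    and T: "T = (\<lambda>\<kappa>. life_span k p (\<lambda>x. \<kappa> * \<psi> x))"
  shows
    "(T \<longlongrightarrow> \<infinity>) (at_right 0) \<and>
     (p < 1 + 1 / real N \<or> A < 1 / (p - 1) \<longrightarrow>
        (A \<noteq> real N \<longrightarrow>
           sim_at_0 T (\<lambda>\<kappa>. \<kappa> powr (- inverse (1 / (2 * (p - 1)) - min A (real N) / 2)))) \<and>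
        (A = real N \<longrightarrow>
           sim_at_0 T
             (\<lambda>\<kappa>. (inverse \<kappa> / ln (inverse \<kappa>)) powr inverse (1 / (2 * (p - 1)) - real N / 2)))) \<and>
     (p = 1 + 1 / real N \<and> A \<ge> 1 / (p - 1) \<longrightarrow>
        (A > real N \<longrightarrow>
           sim_at_0 (\<lambda>\<kappa>. ln_extended (T \<kappa>)) (\<lambda>\<kappa>. \<kappa> powr (- (p - 1)))) \<and>
        (A = real N \<longrightarrow>
           sim_at_0 (\<lambda>\<kappa>. ln_extended (T \<kappa>)) (\<lambda>\<kappa>. \<kappa> powr (- ((p - 1) / p))))) \<and>
     (p > 1 + 1 / real N \<and> A \<ge> 1 / (p - 1) \<longrightarrow>
        (\<forall>\<^sub>F \<kappa> in at_right 0. \<exists>u. is_global_solution k p (\<lambda>x. \<kappa> * \<psi> x) u))"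
proof -
  have \<psi>: "\<psi> = weight A"
    by (simp add: psi weight_def fun_eq_iff)
  have T': "T = (\<lambda>\<kappa>. life_span k p (\<lambda>x. \<kappa> * weight A x))"
    by (simp add: T \<psi>)
  have N0: "0 < real N"
    by (simp add: N)
  \<comment> \<open>Either alternative says that one of A and N is less than 1/(p - 1), hence so is
    their minimum.\<close>
  have \<theta>: "0 < 1 / (2 * (p - 1)) - min A (real N) / 2" if "p < 1 + 1 / real N \<or> A < 1 / (p - 1)"
  proof -
    have "real N < 1 / (p - 1)" if "p < 1 + 1 / real N"
    proof -
      have "(p - 1) * real N < 1"
        using that N0 by (simp add: field_simps)
      then show ?thesis
        using p by (simp add: pos_less_divide_eq mult.commute)
    qed
    then have "min A (real N) < 1 / (p - 1)"
      using that by (auto simp: min_less_iff_disj)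
    then have "0 < (1 / (p - 1) - min A (real N)) / 2"
      by simp
    then show ?thesis
      unfolding diff_divide_distrib by (simp only: divide_divide_eq_left mult.commute)
  qed
  show ?thesis
  proof (intro conjI impI)
    show "(T \<longlongrightarrow> \<infinity>) (at_right 0)"
      unfolding T' using p A by (intro life_span_tendsto_infinity) auto
    show "sim_at_0 T (\<lambda>\<kappa>. \<kappa> powr (- inverse (1 / (2 * (p - 1)) - min A (real N) / 2)))"
      if "p < 1 + 1 / real N \<or> A < 1 / (p - 1)" "A \<noteq> real N"
      unfolding T' using sim_subcritical_neq[OF p A _ \<theta>[OF that(1), unfolded N], of k] that(2) by (simp add: N)
    show "sim_at_0 T (\<lambda>\<kappa>. (inverse \<kappa> / ln (inverse \<kappa>)) powr inverse (1 / (2 * (p - 1)) - real N / 2))"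
      if "p < 1 + 1 / real N \<or> A < 1 / (p - 1)" "A = real N"
      unfolding T' using sim_subcritical_eq[OF p, where k = k] \<theta>[OF that(1)] that(2) by (simp add: N)
    show "sim_at_0 (\<lambda>\<kappa>. ln_extended (T \<kappa>)) (\<lambda>\<kappa>. \<kappa> powr (- (p - 1)))"
      if "p = 1 + 1 / real N \<and> A \<ge> 1 / (p - 1)" "A > real N"
      unfolding T' using that by (intro sim_critical_gt) (auto simp: N)
    show "sim_at_0 (\<lambda>\<kappa>. ln_extended (T \<kappa>)) (\<lambda>\<kappa>. \<kappa> powr (- ((p - 1) / p)))"
      if "p = 1 + 1 / real N \<and> A \<ge> 1 / (p - 1)" "A = real N"
      unfolding T' that(2) unfolding N using that by (intro sim_critical_eq) (auto simp: N)
    show "\<forall>\<^sub>F \<kappa> in at_right 0. \<exists>u. is_global_solution k p (\<lambda>x. \<kappa> * \<psi> x) u"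
      if c: "p > 1 + 1 / real N \<and> A \<ge> 1 / (p - 1)"
    proof -
      have "1 < (p - 1) * real N"
        using c N0 by (simp add: field_simps)
      then have "1 / (p - 1) < CARD('n)"
        using p by (simp add: N pos_divide_less_eq mult.commute)
      then obtain \<kappa>\<^sub>0 where "0 < \<kappa>\<^sub>0" "\<And>\<kappa> A. 0 < \<kappa> \<Longrightarrow> \<kappa> \<le> \<kappa>\<^sub>0 \<Longrightarrow> 1 / (p - 1) \<le> A \<Longrightarrow>
          \<exists>u. is_global_solution k p (\<lambda>x. \<kappa> * weight A x) u"
        using global_solution_supercritical[OF p, of k] by blast
      then show ?thesis
        unfolding \<psi> using c by (auto intro: eventually_mono[OF eventually_at_right_0_le])
    qed
  qed
qed

end
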